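(* Let $(M,D)$ be a compact metric space and let $(\mathcal{F},\mu)$, $\mathcal{F}=\{f_i\}_{i\in\mathcal{I}}$, be a random dynamical system of continuous maps on $M$ such that $\mathcal{F}$ is proximal on $(M,D)$ and $(\mathcal{F},\mu)$ has the local contraction property on $(M,D)$. Let $\nu$ be its unique $\mu$-stationary probability measure. Then $(\mathcal{F},\mu)$ satisfies the strong law of large numbers, the central limit theorem, and the law of the iterated logarithm for every Hölder continuous function $h\colon M\to\mathbb{R}$. That is, with $\nu(h)=\int h\,d\nu$ and $\sigma^2(h)$ as defined in the context: 1. (strong law of large numbers) for every $x\in M$, $\lim_{n\to\infty}\frac1n\sum_{k=0}^{n-1}h(X_k^x)=\nu(h)$ almost surely; 2. (central limit theorem) for every $x\in M$, $\frac{1}{\sqrt n}\sum_{k=0}^{n-1}h(X_k^x)\to\mathcal{N}(\nu(h),\sigma^2(h))$ as $n\to\infty$ (convergence to a normal distribution with mean $\nu(h)$ and variance $\sigma^2(h)$); 3. (law of the iterated logarithm) for every $x\in M$, $\limsup_{n\to\infty}\frac{1}{\sqrt{2n\log\log(n)}}\Big(\sum_{k=0}^{n-1}h(X_k^x)-n\nu(h)\Big)=\sqrt{\sigma^2(h)}$ almost surely.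
   Context: Random dynamical system: $C^0(M)$ is the space of continuous maps $f\colon M\to M$ with the supremum distance $D_\infty(f,g)=\sup_{x\in M}D(f(x),g(x))$. $\mathcal{F}=\{f_i\}_{i\in\mathcal{I}}\subset C^0(M)$ is indexed by a set $\mathcal{I}$ (possibly $\mathcal{I}=\mathcal{F}$); $\mathcal{I}$ carries the $\sigma$-algebra induced by the Borel $\sigma$-algebra of $(\mathcal{F},D_\infty)$, and $\mu$ is a probability measure on $\mathcal{I}$ which is non-degenerate, i.e. $\mathcal{I}$ is the support of $\mu$. $\mu^{\mathbb{N}}$ is the product measure on $\mathcal{I}^{\mathbb{N}}$. For $\mathbf{i}=(i_1,i_2,\ldots)\in\mathcal{I}^{\mathbb{N}}$ and $n\in\mathbb{N}$ put $f_{\mathbf{i}}^n=f_{i_n}\circ\cdots\circ f_{i_1}$, $X_n^x(\mathbf{i})=f_{\mathbf{i}}^n(x)$, $X_0^x(\mathbf{i})=x$; for each $x$, $X_n^x$ is regarded as a random variable on $(\mathcal{I}^{\mathbb{N}},\mu^{\mathbb{N}})$, and "almost surely" refers to $\mu^{\mathbb{N}}$. A Borel probability measure $\nu$ on $M$ is $\mu$-stationary if $\nu=\int (f_i)_*\nu\,d\mu(i)$, where $(f_i)_*\nu=\nu\circ f_i^{-1}$. Under the hypotheses of the claim the $\mu$-stationary probability measure is unique. The variance is defined by $$\sigma^2(h)=\lim_{n\to\infty}\frac1n\int_{\mathcal{I}^{\mathbb{N}}\times M}\Big(\sum_{k=0}^{n-1}h(X_k^x(\mathbf{i}))-n\nu(h)\Big)^2\,d(\mu^{\mathbb{N}}\otimes\nu)(\mathbf{i},x).$$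 Proximal: for every $x,y\in M$ there exist $\mathbf{i}\in\mathcal{I}^{\mathbb{N}}$ and a sequence $(n_k)_{k\in\mathbb{N}}$ such that $\lim_{k\to\infty}D(f_{\mathbf{i}}^{n_k}(x),f_{\mathbf{i}}^{n_k}(y))=0$. Local contraction property: there exists $q\in(0,1)$ such that for every $x\in M$, for almost every $\mathbf{i}\in\mathcal{I}^{\mathbb{N}}$ there exists a neighborhood $B$ of $x$ such that $\operatorname{diam}_D(f_{\mathbf{i}}^n(B))\le q^n$ for all $n\in\mathbb{N}$, where $\operatorname{diam}_D B=\sup_{y,z\in B}D(y,z)$.
   Formalization: The central limit theorem is stated in centred form: (1/√n)(Σ_{k<n} h(X_k^x) − nν(h)) → N(0, σ²(h)); as printed, uncentred with mean ν(h), it fails whenever ν(h) ≠ 0 (e.g. M a point, h = 1) and agrees with the centred form when ν(h) = 0. *)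

theory Defs
  imports "HOL-Probability.Probability"
begin

text \<open>
  The index set is \<open>space \<mu>\<close>, with arbitrary (not necessarily injective) indexing \<open>i \<mapsto> f i\<close>.
  When the state space is compact, \<open>Bcontfun (f i)\<close> is \<open>f i\<close> viewed as a point of the space of
  continuous self-maps with the supremum distance; its Borel sigma-algebra, and its topology, are
  pulled back to the index set along this map. Preimages of Borel (open) sets of the whole function
  space are the same as those of Borel (open) sets of the subspace formed by the family.
\<close>

definition index_support :: "('i \<Rightarrow> 'a::metric_space \<Rightarrow> 'a) \<Rightarrow> 'i measure \<Rightarrow> 'i set" where
  "index_support f \<mu> = {i \<in> space \<mu>. \<forall>U. open U \<longrightarrow> Bcontfun (f i) \<in> U \<longrightarrow>
     emeasure \<mu> {j \<in> space \<mu>. Bcontfun (f j) \<in> U} > 0}"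

definition random_dynamical_system :: "('i \<Rightarrow> 'a::metric_space \<Rightarrow> 'a) \<Rightarrow> 'i measure \<Rightarrow> bool" where
  "random_dynamical_system f \<mu> \<longleftrightarrow>
     prob_space \<mu> \<and>
     (\<forall>i\<in>space \<mu>. continuous_on UNIV (f i)) \<and>
     sets \<mu> = sets (vimage_algebra (space \<mu>) (\<lambda>i. Bcontfun (f i)) borel) \<and>
     index_support f \<mu> = space \<mu>"

definition sequence_measure :: "'i measure \<Rightarrow> (nat \<Rightarrow> 'i) measure" where
  "sequence_measure \<mu> = Pi\<^sub>M (UNIV :: nat set) (\<lambda>_. \<mu>)"

text \<open>Sequences are indexed from 0, so that the \<open>n\<close>-th iterate is
  \<open>f (\<omega> (n - 1)) \<circ> \<dots> \<circ> f (\<omega> 0)\<close>; this is also \<open>X\<^sub>n\<^sup>x(\<omega>)\<close> when applied to \<open>x\<close>.\<close>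

primrec rds_iter :: "('i \<Rightarrow> 'a \<Rightarrow> 'a) \<Rightarrow> (nat \<Rightarrow> 'i) \<Rightarrow> nat \<Rightarrow> 'a \<Rightarrow> 'a" where
  "rds_iter f \<omega> 0 = id"
| "rds_iter f \<omega> (Suc n) = f (\<omega> n) \<circ> rds_iter f \<omega> n"

definition birkhoff_sum ::
    "('i \<Rightarrow> 'a \<Rightarrow> 'a) \<Rightarrow> ('a \<Rightarrow> real) \<Rightarrow> nat \<Rightarrow> 'a \<Rightarrow> (nat \<Rightarrow> 'i) \<Rightarrow> real" where
  "birkhoff_sum f h n x \<omega> = (\<Sum>k<n. h (rds_iter f \<omega> k x))"

text \<open>The times \<open>nk k\<close> need not increase: if they are bounded then some time occurs infinitely
  often, the two orbits coincide at that time and hence at all later ones, so requiring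
  \<open>strict_mono nk\<close> would give an equivalent notion.\<close>

definition proximal :: "('i \<Rightarrow> 'a::metric_space \<Rightarrow> 'a) \<Rightarrow> 'i set \<Rightarrow> bool" where
  "proximal f I \<longleftrightarrow>
     (\<forall>x y. \<exists>\<omega> \<in> UNIV \<rightarrow> I. \<exists>nk :: nat \<Rightarrow> nat.
        (\<lambda>k. dist (rds_iter f \<omega> (nk k) x) (rds_iter f \<omega> (nk k) y)) \<longlonglongrightarrow> 0)"

definition local_contraction :: "('i \<Rightarrow> 'a::metric_space \<Rightarrow> 'a) \<Rightarrow> 'i measure \<Rightarrow> bool" where
  "local_contraction f \<mu> \<longleftrightarrow>
     (\<exists>q::real. 0 < q \<and> q < 1 \<and>
        (\<forall>x. AE \<omega> in sequence_measure \<mu>.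
           \<exists>B. x \<in> interior B \<and> (\<forall>n\<ge>1. diameter (rds_iter f \<omega> n ` B) \<le> q ^ n)))"

definition stationary :: "('i \<Rightarrow> 'a::metric_space \<Rightarrow> 'a) \<Rightarrow> 'i measure \<Rightarrow> 'a measure \<Rightarrow> bool" where
  "stationary f \<mu> \<nu> \<longleftrightarrow>
     prob_space \<nu> \<and> sets \<nu> = sets borel \<and>
     (\<forall>A\<in>sets borel. emeasure \<nu> A = (\<integral>\<^sup>+ i. emeasure (distr \<nu> borel (f i)) A \<partial>\<mu>))"

definition hoelder_continuous :: "('a::metric_space \<Rightarrow> real) \<Rightarrow> bool" where
  "hoelder_continuous h \<longleftrightarrow>
     (\<exists>\<alpha> C. 0 < \<alpha> \<and> \<alpha> \<le> 1 \<and> (\<forall>x y. \<bar>h x - h y\<bar> \<le> C * dist x y powr \<alpha>))"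

definition normalized_variance ::
    "('i \<Rightarrow> 'a::metric_space \<Rightarrow> 'a) \<Rightarrow> 'i measure \<Rightarrow> 'a measure \<Rightarrow> ('a \<Rightarrow> real) \<Rightarrow> nat \<Rightarrow> real" where
  "normalized_variance f \<mu> \<nu> h n =
     1 / real n * (\<integral>(\<omega>, x). (birkhoff_sum f h n x \<omega> - real n * (\<integral>y. h y \<partial>\<nu>))\<^sup>2
       \<partial>(sequence_measure \<mu> \<Otimes>\<^sub>M \<nu>))"

definition asymptotic_variance ::
    "('i \<Rightarrow> 'a::metric_space \<Rightarrow> 'a) \<Rightarrow> 'i measure \<Rightarrow> 'a measure \<Rightarrow> ('a \<Rightarrow> real) \<Rightarrow> real" where
  "asymptotic_variance f \<mu> \<nu> h = lim (normalized_variance f \<mu> \<nu> h)"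

text \<open>Unlike \<open>normal_density\<close>, this takes the variance as its parameter, and variance zero
  gives the Dirac measure.\<close>

definition normal_distribution :: "real \<Rightarrow> real \<Rightarrow> real measure" where
  "normal_distribution m v =
     (if v = 0 then return borel m else density lborel (\<lambda>t. ennreal (normal_density m (sqrt v) t)))"

end

theory Submission
  imports Defs "HOL-Real_Asymp.Real_Asymp"
begin

text \<open>
  Let \<open>P\<close> be the Markov operator, \<open>h\<close> Hoelder with exponent \<open>\<alpha>\<close>, and put
  \<open>D\<^sub>n = D (X\<^sub>n\<^sup>x, X\<^sub>n\<^sup>y)\<close>. Two nearby points contract geometrically for all times with probability
  at least 1/2; by proximality and compactness every pair gets close with probability bounded below
  in bounded time. A renewal argument that restarts at the first failure of contraction bounds
  \<open>\<Sum>\<^sub>n E D\<^sub>n\<^sup>\<alpha>\<close> uniformly in \<open>(x, y)\<close> (the restart needs only that failures at different times are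
  disjoint, so no tail estimate for the failure time enters). Hence
  \<open>g = \<Sum>\<^sub>n (P\<^sup>n h - \<nu>(h))\<close> converges, is continuous, and solves \<open>g - P g = h - \<nu>(h)\<close>, so that the Birkhoff
  sums are, up to a bounded term, a martingale \<open>M\<^sub>n\<close> with bounded increments whose conditional variance
  is a continuous function \<open>V\<close> of the state. Solving the Poisson equation for Lipschitz approximations
  of \<open>V\<close> makes the averages of \<open>V\<close> along orbits converge to \<open>\<sigma>\<^sup>2 = \<nu>(V)\<close>, uniformly in the starting
  point. This gives the central limit theorem uniformly in the starting point, the upper half of the
  law of the iterated logarithm by an exponential maximal inequality, and the lower half by applying
  the uniform central limit theorem to many consecutive blocks.
\<close>

section \<open>Random continuous maps and their Markov operator\<close>

text \<open>No filtration or conditional expectation appears: conditioning on the past is Fubini on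
  the sequence space, splitting off either the first letter (\<open>case_nat\<close>) or the first n
  letters (\<open>comb_seq\<close>), so most estimates are inductions on time with the starting
  point universally quantified. Pairs of orbits and pairs (martingale value, state) are treated as
  further systems of random maps driven by the same letters and share one theory of the Markov
  operator. The obstacle is that local contraction is only almost sure, on a neighbourhood whose
  size depends on the sequence without any control. Compactness turns it into a statement about
  probabilities near the diagonal, but yields no Hoelder modulus for \<open>g\<close>. Hence V is
  merely continuous, its Poisson equation is not solved exactly, and an equation with a uniform
  error takes its place. In the lower half of the iterated logarithm, block j consists of a multiple
  of ln j pieces of length j!: factorial growth makes everything before block j negligible, while ln
  ln of the total length is still asymptotic to ln j.\<close>

lemma borel_measurable_caratheodory:
  fixes g :: "'w \<Rightarrow> 'b::metric_space \<Rightarrow> 'c::metric_space"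
  assumes sep: "\<exists>D::'b set. countable D \<and> closure D = UNIV"
    and v: "v \<in> M \<rightarrow>\<^sub>M borel"
    and meas: "\<And>y. (\<lambda>\<omega>. g \<omega> y) \<in> M \<rightarrow>\<^sub>M borel"
    and cont: "\<And>\<omega>. \<omega> \<in> space M \<Longrightarrow> continuous_on UNIV (g \<omega>)"
  shows "(\<lambda>\<omega>. g \<omega> (v \<omega>)) \<in> M \<rightarrow>\<^sub>M borel"
proof -
  note [measurable] = v
  obtain D :: "'b set" where D: "countable D" "closure D = UNIV" using sep by auto
  have "D \<noteq> {}" using D(2) by auto
  define d where "d = from_nat_into D"
  have near: "\<exists>k. dist (d k) y < e" if e: "e > 0" for y e
  proof -
    have "y \<in> closure D" using D(2) by auto
    then obtain z where "z \<in> D" "dist z y < e" using e unfolding closure_approachable by blast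
    then show ?thesis unfolding d_def
      by (metis D(1) from_nat_into_surj)
  qed
  \<comment> \<open>A selection with countably many values: the least index is a measurable choice,
    so composing with \<open>g\<close> needs measurability only at the fixed points
    \<open>d k\<close>, and continuity in the second argument passes to the limit.\<close>
  define N where "N m \<omega> = (LEAST k. dist (d k) (v \<omega>) < 1 / real (Suc m))" for m \<omega>
  have N: "dist (d (N m \<omega>)) (v \<omega>) < 1 / real (Suc m)" for m \<omega>
    unfolding N_def by (rule LeastI_ex) (rule near, simp)
  have [measurable]: "N m \<in> M \<rightarrow>\<^sub>M count_space UNIV" for m
  proof -
    have "(\<lambda>\<omega>. dist (d k) (v \<omega>)) \<in> borel_measurable M" for k
      by (rule measurable_compose[OF v]) (intro borel_measurable_continuous_onI continuous_intros)
    then have [measurable]: "(\<lambda>\<omega>. dist (d k) (v \<omega>) < 1 / real (Suc m)) \<in> M \<rightarrow>\<^sub>M count_space UNIV" for k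
      by measurable
    show ?thesis unfolding N_def by measurable
  qed
  have dlim: "(\<lambda>m. d (N m \<omega>)) \<longlonglongrightarrow> v \<omega>" for \<omega>
  proof (rule metric_tendsto_imp_tendsto[where f="\<lambda>m. 1 / real (Suc m)" and a="0::real"])
    show "(\<lambda>m. 1 / real (Suc m)) \<longlonglongrightarrow> 0" using LIMSEQ_Suc[OF lim_1_over_n] by simp
    show "\<forall>\<^sub>F m in sequentially. dist (d (N m \<omega>)) (v \<omega>) \<le> dist (1 / real (Suc m)) 0"
      using N less_imp_le by (intro always_eventually allI) (simp add: dist_real_def less_imp_le)
  qed
  show ?thesis
  proof (rule borel_measurable_LIMSEQ_metric[where f="\<lambda>m \<omega>. g \<omega> (d (N m \<omega>))"])
    show "(\<lambda>\<omega>. g \<omega> (d (N m \<omega>))) \<in> borel_measurable M" for m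
      by (rule measurable_compose_countable[where f="\<lambda>k \<omega>. g \<omega> (d k)" and g="N m"])
         (auto intro: meas)
    show "(\<lambda>m. g \<omega> (d (N m \<omega>))) \<longlonglongrightarrow> g \<omega> (v \<omega>)" if "\<omega> \<in> space M" for \<omega>
      using continuous_on_tendsto_compose[OF cont[OF that] dlim, of \<omega>] by simp
  qed
qed

text \<open>In general metric spaces the Borel sigma-algebra of a product can be strictly larger
  than the product of the Borel sigma-algebras. Separability repairs this: pairing is continuous in
  each argument, so the preceding lemma applies twice, once per coordinate.\<close>

lemma borel_measurable_Pair_separable:
  fixes u :: "'w \<Rightarrow> 'b::metric_space" and v :: "'w \<Rightarrow> 'c::metric_space"
  assumes "\<exists>D::'b set. countable D \<and> closure D = UNIV"
    and "\<exists>D::'c set. countable D \<and> closure D = UNIV"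
    and "u \<in> M \<rightarrow>\<^sub>M borel" "v \<in> M \<rightarrow>\<^sub>M borel"
  shows "(\<lambda>\<omega>. (u \<omega>, v \<omega>)) \<in> M \<rightarrow>\<^sub>M borel"
proof (rule borel_measurable_caratheodory[where g="\<lambda>\<omega> y. (u \<omega>, y)", OF assms(2,4)])
  show "(\<lambda>\<omega>. (u \<omega>, y)) \<in> borel_measurable M" for y :: 'c
    by (rule borel_measurable_caratheodory[where g="\<lambda>\<omega> x. (x, y)", OF assms(1,3)])
       (auto intro!: continuous_intros)
qed (auto intro!: continuous_intros)

lemma separable_Times:
  assumes "\<exists>D::'b::metric_space set. countable D \<and> closure D = UNIV"
    and "\<exists>D::'c::metric_space set. countable D \<and> closure D = UNIV"
  shows "\<exists>D::('b \<times> 'c) set. countable D \<and> closure D = UNIV"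
proof -
  obtain D :: "'b set" and E :: "'c set" where "countable D" "closure D = UNIV" "countable E" "closure E = UNIV"
    using assms by auto
  then show ?thesis by (intro exI[of _ "D \<times> E"]) (auto simp: closure_Times)
qed

lemma separable_compact:
  assumes "compact (UNIV :: 'a::metric_space set)"
  shows "\<exists>D::'a set. countable D \<and> closure D = UNIV"
proof -
  have "\<exists>k. finite k \<and> (UNIV::'a set) \<subseteq> (\<Union>x\<in>k. ball x (1 / real (Suc n)))" for n
    using assms unfolding compact_eq_totally_bounded by auto
  then obtain k :: "nat \<Rightarrow> 'a set" where k: "\<And>n. finite (k n)" "\<And>n. (UNIV::'a set) \<subseteq> (\<Union>x\<in>k n. ball x (1 / real (Suc n)))"
    by metis
  have "y \<in> closure (\<Union>n. k n)" for y
    unfolding closure_approachable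
  proof (intro allI impI)
    fix e :: real assume "e > 0"
    then obtain n where n: "1 / real (Suc n) < e" using nat_approx_posE by metis
    obtain x where "x \<in> k n" "dist x y < 1 / real (Suc n)" using k(2)[of n] by (auto simp: subset_iff)
    then show "\<exists>z\<in>\<Union>n. k n. dist z y < e" using n by (auto intro!: bexI[of _ x] exI[of _ n])
  qed
  then show ?thesis using k(1) by (intro exI[of _ "\<Union>n. k n"]) (auto intro: countable_finite)
qed

lemma compact_continuous_bounded:
  fixes \<phi> :: "'a::metric_space \<Rightarrow> 'c::real_normed_vector"
  assumes "compact (UNIV :: 'a set)" "continuous_on UNIV \<phi>"
  obtains C where "0 < C" "\<And>x. norm (\<phi> x) \<le> C"
proof -
  have "bounded (range \<phi>)" using compact_continuous_image[OF assms(2,1)] by (rule compact_imp_bounded)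
  then show ?thesis using that unfolding bounded_pos by auto
qed

lemma continuous_on_integral_parameter:
  fixes \<phi> :: "'w \<Rightarrow> 'b::metric_space \<Rightarrow> 'c::{banach,second_countable_topology}"
  assumes "finite_measure M"
    and meas: "\<And>x. (\<lambda>\<omega>. \<phi> \<omega> x) \<in> borel_measurable M"
    and cont: "\<And>\<omega>. \<omega> \<in> space M \<Longrightarrow> continuous_on UNIV (\<phi> \<omega>)"
    and bound: "\<And>\<omega> x. \<omega> \<in> space M \<Longrightarrow> norm (\<phi> \<omega> x) \<le> C"
  shows "continuous_on UNIV (\<lambda>x. \<integral>\<omega>. \<phi> \<omega> x \<partial>M)"
  unfolding continuous_on_sequentially comp_def
proof safe
  fix X :: "nat \<Rightarrow> 'b" and x assume X: "X \<longlonglongrightarrow> x"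
  interpret finite_measure M by fact
  show "(\<lambda>n. \<integral>\<omega>. \<phi> \<omega> (X n) \<partial>M) \<longlonglongrightarrow> (\<integral>\<omega>. \<phi> \<omega> x \<partial>M)"
  proof (rule integral_dominated_convergence[where w="\<lambda>_. C"])
    show "AE \<omega> in M. (\<lambda>n. \<phi> \<omega> (X n)) \<longlonglongrightarrow> \<phi> \<omega> x"
    proof (rule AE_I2)
      fix \<omega> assume "\<omega> \<in> space M"
      from continuous_on_tendsto_compose[OF cont[OF this] X] show "(\<lambda>n. \<phi> \<omega> (X n)) \<longlonglongrightarrow> \<phi> \<omega> x" by auto
    qed
  qed (auto intro: meas bound)
qed

text \<open>The state space is only separable, not compact, because the locale is also interpreted
  for a chain with a real component. Measurability in the letter is asked pointwise in the state;
  with continuity in the state it gives joint measurability.\<close>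

locale random_maps = prob_space \<mu> for \<mu> :: "'i measure" +
  fixes f :: "'i \<Rightarrow> 'b::metric_space \<Rightarrow> 'b"
  assumes continuous_map: "i \<in> space \<mu> \<Longrightarrow> continuous_on UNIV (f i)"
    and measurable_map: "(\<lambda>i. f i x) \<in> \<mu> \<rightarrow>\<^sub>M borel"
    and separable: "\<exists>D::'b set. countable D \<and> closure D = UNIV"
begin

section \<open>Conditioning on initial letters\<close>

sublocale seq: sequence_space \<mu>
  by unfold_locales

abbreviation "\<Omega> \<equiv> sequence_measure \<mu>"

lemma Omega_eq: "\<Omega> = Pi\<^sub>M UNIV (\<lambda>_. \<mu>)" by (simp add: sequence_measure_def)

sublocale \<Omega>: prob_space \<Omega>
  unfolding Omega_eq by (rule prob_space_PiM) (rule prob_space_axioms)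

lemma space_Omega: "space \<Omega> = UNIV \<rightarrow> space \<mu>"
  by (auto simp: Omega_eq space_PiM PiE_def)

lemma component_in_space: "\<omega> \<in> space \<Omega> \<Longrightarrow> \<omega> n \<in> space \<mu>"
  by (auto simp: space_Omega)

lemma measurable_component_Omega[measurable]: "(\<lambda>\<omega>. \<omega> n) \<in> \<Omega> \<rightarrow>\<^sub>M \<mu>"
  unfolding Omega_eq by measurable

lemma measurable_case_nat_Omega[measurable]: "(\<lambda>(i, \<omega>). case_nat i \<omega>) \<in> \<mu> \<Otimes>\<^sub>M \<Omega> \<rightarrow>\<^sub>M \<Omega>"
  unfolding Omega_eq by measurable

lemma measurable_case_nat_Omega'[measurable]: "i \<in> space \<mu> \<Longrightarrow> case_nat i \<in> \<Omega> \<rightarrow>\<^sub>M \<Omega>"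
  unfolding Omega_eq by measurable

lemma measurable_comb_seq_Omega[measurable]: "(\<lambda>(\<omega>, \<omega>'). comb_seq n \<omega> \<omega>') \<in> \<Omega> \<Otimes>\<^sub>M \<Omega> \<rightarrow>\<^sub>M \<Omega>"
  unfolding Omega_eq by (rule measurable_comb_seq)

lemma measurable_comb_seq_Omega': "\<omega> \<in> space \<Omega> \<Longrightarrow> comb_seq n \<omega> \<in> \<Omega> \<rightarrow>\<^sub>M \<Omega>"
  unfolding Omega_eq by measurable

text \<open>The Markov property at time 1: prepending an independent letter preserves the law of the
  sequence, so Fubini conditions on the first letter.\<close>

lemma integral_shift:
  fixes F :: "(nat \<Rightarrow> 'i) \<Rightarrow> 'c::{banach,second_countable_topology}"
  assumes F[measurable]: "F \<in> borel_measurable \<Omega>" and bound: "\<And>\<omega>. \<omega> \<in> space \<Omega> \<Longrightarrow> norm (F \<omega>) \<le> C"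
  shows "(\<integral>\<omega>. F \<omega> \<partial>\<Omega>) = (\<integral>i. (\<integral>\<omega>. F (case_nat i \<omega>) \<partial>\<Omega>) \<partial>\<mu>)"
    and "(\<lambda>i. \<integral>\<omega>. F (case_nat i \<omega>) \<partial>\<Omega>) \<in> borel_measurable \<mu>"
proof -
  interpret P: pair_prob_space \<mu> \<Omega> by unfold_locales
  have d: "distr (\<mu> \<Otimes>\<^sub>M \<Omega>) \<Omega> (\<lambda>(i, \<omega>). case_nat i \<omega>) = \<Omega>"
    using seq.PiM_iter unfolding Omega_eq by simp
  have "(\<integral>\<omega>. F \<omega> \<partial>\<Omega>) = (\<integral>z. F (case z of (i, \<omega>) \<Rightarrow> case_nat i \<omega>) \<partial>(\<mu> \<Otimes>\<^sub>M \<Omega>))"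
    by (subst (1) d[symmetric], subst integral_distr) auto
  also have "\<dots> = (\<integral>z. F (case_nat (fst z) (snd z)) \<partial>(\<mu> \<Otimes>\<^sub>M \<Omega>))"
    by (simp add: case_prod_beta)
  also have "\<dots> = (\<integral>i. (\<integral>\<omega>. F (case_nat i \<omega>) \<partial>\<Omega>) \<partial>\<mu>)"
  proof -
    have "integrable (\<mu> \<Otimes>\<^sub>M \<Omega>) (\<lambda>z. F (case_nat (fst z) (snd z)))"
    proof (rule P.P.integrable_const_bound[where B=C])
      show "AE z in \<mu> \<Otimes>\<^sub>M \<Omega>. norm (F (case_nat (fst z) (snd z))) \<le> C"
        by (rule AE_I2) (auto simp: space_pair_measure space_Omega Pi_iff split: nat.split intro!: bound)
      show "(\<lambda>z. F (case_nat (fst z) (snd z))) \<in> borel_measurable (\<mu> \<Otimes>\<^sub>M \<Omega>)"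
        using measurable_compose[OF measurable_case_nat_Omega F] by (simp add: case_prod_beta)
    qed
    from P.integral_fst'[OF this] show ?thesis by simp
  qed
  finally show "(\<integral>\<omega>. F \<omega> \<partial>\<Omega>) = (\<integral>i. (\<integral>\<omega>. F (case_nat i \<omega>) \<partial>\<Omega>) \<partial>\<mu>)" .
  have "(\<lambda>(i, \<omega>). F (case_nat i \<omega>)) \<in> borel_measurable (\<mu> \<Otimes>\<^sub>M \<Omega>)"
    using measurable_compose[OF measurable_case_nat_Omega F] by (simp add: case_prod_beta)
  then show "(\<lambda>i. \<integral>\<omega>. F (case_nat i \<omega>) \<partial>\<Omega>) \<in> borel_measurable \<mu>"
    by (rule \<Omega>.borel_measurable_lebesgue_integral)
qed

lemma prob_shift:
  assumes [measurable]: "Measurable.pred \<Omega> Q"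
  shows "\<Omega>.prob {\<omega> \<in> space \<Omega>. Q \<omega>} = (\<integral>i. \<Omega>.prob {\<omega> \<in> space \<Omega>. Q (case_nat i \<omega>)} \<partial>\<mu>)"
    and "(\<lambda>i. \<Omega>.prob {\<omega> \<in> space \<Omega>. Q (case_nat i \<omega>)}) \<in> borel_measurable \<mu>"
proof -
  let ?F = "indicator {\<omega> \<in> space \<Omega>. Q \<omega>} :: _ \<Rightarrow> real"
  have F: "?F \<in> borel_measurable \<Omega>" by measurable
  have b: "norm (?F \<omega>) \<le> 1" for \<omega> by (simp add: indicator_def)
  have *: "(\<integral>\<omega>. ?F (case_nat i \<omega>) \<partial>\<Omega>) = \<Omega>.prob {\<omega> \<in> space \<Omega>. Q (case_nat i \<omega>)}" if "i \<in> space \<mu>" for i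
  proof -
    have m: "{\<omega> \<in> space \<Omega>. Q (case_nat i \<omega>)} \<in> sets \<Omega>"
      using measurable_compose[OF measurable_case_nat_Omega'[OF that] assms] by measurable
    have "(\<integral>\<omega>. ?F (case_nat i \<omega>) \<partial>\<Omega>) = (\<integral>\<omega>. indicator {\<omega> \<in> space \<Omega>. Q (case_nat i \<omega>)} \<omega> \<partial>\<Omega>)"
      using that by (intro Bochner_Integration.integral_cong) (auto simp: indicator_def space_Omega Pi_iff split: nat.split)
    then show ?thesis using m by simp
  qed
  have "\<Omega>.prob {\<omega> \<in> space \<Omega>. Q \<omega>} = (\<integral>\<omega>. ?F \<omega> \<partial>\<Omega>)" by simp
  also have "\<dots> = (\<integral>i. (\<integral>\<omega>. ?F (case_nat i \<omega>) \<partial>\<Omega>) \<partial>\<mu>)"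
    using F b by (rule integral_shift)
  also have "\<dots> = (\<integral>i. \<Omega>.prob {\<omega> \<in> space \<Omega>. Q (case_nat i \<omega>)} \<partial>\<mu>)"
    by (intro Bochner_Integration.integral_cong) (auto simp: *)
  finally show "\<Omega>.prob {\<omega> \<in> space \<Omega>. Q \<omega>} = (\<integral>i. \<Omega>.prob {\<omega> \<in> space \<Omega>. Q (case_nat i \<omega>)} \<partial>\<mu>)" .
  show "(\<lambda>i. \<Omega>.prob {\<omega> \<in> space \<Omega>. Q (case_nat i \<omega>)}) \<in> borel_measurable \<mu>"
    using integral_shift(2)[OF F b] by (rule measurable_cong[THEN iffD1, rotated]) (simp add: *)
qed

text \<open>The Markov property at a fixed time \<open>n\<close>. The hypothesis \<open>det\<close>
  says that \<open>A\<close> depends on the first \<open>n\<close> letters only; given these, the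
  remaining letters form a fresh copy \<open>\<omega>'\<close> of the sequence.\<close>

lemma prob_comb_seq:
  assumes A[measurable]: "Measurable.pred \<Omega> A" and Q[measurable]: "Measurable.pred \<Omega> Q"
    and det: "\<And>\<omega> \<omega>'. A (comb_seq n \<omega> \<omega>') \<longleftrightarrow> A \<omega>"
  shows "\<Omega>.prob {\<omega> \<in> space \<Omega>. A \<omega> \<and> Q \<omega>} =
     (\<integral>\<omega>. indicator {\<omega> \<in> space \<Omega>. A \<omega>} \<omega> * \<Omega>.prob {\<omega>' \<in> space \<Omega>. Q (comb_seq n \<omega> \<omega>')} \<partial>\<Omega>)"
    and "(\<lambda>\<omega>. \<Omega>.prob {\<omega>' \<in> space \<Omega>. Q (comb_seq n \<omega> \<omega>')}) \<in> borel_measurable \<Omega>"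
proof -
  interpret P: pair_prob_space \<Omega> \<Omega> by unfold_locales
  have d: "distr (\<Omega> \<Otimes>\<^sub>M \<Omega>) \<Omega> (\<lambda>(\<omega>, \<omega>'). comb_seq n \<omega> \<omega>') = \<Omega>"
    using seq.PiM_comb_seq unfolding Omega_eq by simp
  have cs: "comb_seq n \<omega> \<omega>' \<in> space \<Omega>" if "\<omega> \<in> space \<Omega>" "\<omega>' \<in> space \<Omega>" for \<omega> \<omega>'
    using that by (auto simp: space_Omega comb_seq_def Pi_iff)
  let ?F = "\<lambda>z. indicator {\<omega> \<in> space \<Omega>. A \<omega>} (fst z) * indicator {\<omega> \<in> space \<Omega>. Q \<omega>} (comb_seq n (fst z) (snd z)) :: real"
  have Fm: "?F \<in> borel_measurable (\<Omega> \<Otimes>\<^sub>M \<Omega>)"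
  proof -
    have "(\<lambda>z. indicator {\<omega> \<in> space \<Omega>. Q \<omega>} (case z of (\<omega>, \<omega>') \<Rightarrow> comb_seq n \<omega> \<omega>') :: real) \<in> borel_measurable (\<Omega> \<Otimes>\<^sub>M \<Omega>)"
      by (rule measurable_compose[OF measurable_comb_seq_Omega]) measurable
    then have "(\<lambda>z. indicator {\<omega> \<in> space \<Omega>. Q \<omega>} (comb_seq n (fst z) (snd z)) :: real) \<in> borel_measurable (\<Omega> \<Otimes>\<^sub>M \<Omega>)"
      by (simp add: case_prod_beta)
    then show ?thesis by measurable
  qed
  have one: "(\<integral>\<omega>'. ?F (\<omega>, \<omega>') \<partial>\<Omega>) = indicator {\<omega> \<in> space \<Omega>. A \<omega>} \<omega> * \<Omega>.prob {\<omega>' \<in> space \<Omega>. Q (comb_seq n \<omega> \<omega>')}"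
    if "\<omega> \<in> space \<Omega>" for \<omega>
  proof -
    have m: "{\<omega>' \<in> space \<Omega>. Q (comb_seq n \<omega> \<omega>')} \<in> sets \<Omega>"
      using measurable_compose[OF measurable_comb_seq_Omega'[OF that] Q] by measurable
    have "(\<integral>\<omega>'. ?F (\<omega>, \<omega>') \<partial>\<Omega>) = (\<integral>\<omega>'. indicator {\<omega> \<in> space \<Omega>. A \<omega>} \<omega> * indicator {\<omega>' \<in> space \<Omega>. Q (comb_seq n \<omega> \<omega>')} \<omega>' \<partial>\<Omega>)"
      using that by (intro Bochner_Integration.integral_cong) (auto simp: indicator_def cs)
    then show ?thesis using m by simp
  qed
  have "\<Omega>.prob {\<omega> \<in> space \<Omega>. A \<omega> \<and> Q \<omega>} = (\<integral>\<omega>. indicator {\<omega> \<in> space \<Omega>. A \<omega> \<and> Q \<omega>} \<omega> \<partial>\<Omega>)" by simp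
  also have "\<dots> = (\<integral>z. indicator {\<omega> \<in> space \<Omega>. A \<omega> \<and> Q \<omega>} (case z of (\<omega>, \<omega>') \<Rightarrow> comb_seq n \<omega> \<omega>') \<partial>(\<Omega> \<Otimes>\<^sub>M \<Omega>))"
    by (subst (1) d[symmetric], subst integral_distr) auto
  also have "\<dots> = (\<integral>z. ?F z \<partial>(\<Omega> \<Otimes>\<^sub>M \<Omega>))"
    by (intro Bochner_Integration.integral_cong) (auto simp: space_pair_measure indicator_def cs det)
  also have "\<dots> = (\<integral>\<omega>. (\<integral>\<omega>'. ?F (\<omega>, \<omega>') \<partial>\<Omega>) \<partial>\<Omega>)"
  proof (rule P.integral_fst'[symmetric])
    show "integrable (\<Omega> \<Otimes>\<^sub>M \<Omega>) ?F"
      by (rule P.P.integrable_const_bound[where B=1, OF _ Fm]) (auto simp: indicator_def)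
  qed
  also have "\<dots> = (\<integral>\<omega>. indicator {\<omega> \<in> space \<Omega>. A \<omega>} \<omega> * \<Omega>.prob {\<omega>' \<in> space \<Omega>. Q (comb_seq n \<omega> \<omega>')} \<partial>\<Omega>)"
    by (intro Bochner_Integration.integral_cong refl one)
  finally show "\<Omega>.prob {\<omega> \<in> space \<Omega>. A \<omega> \<and> Q \<omega>} =
     (\<integral>\<omega>. indicator {\<omega> \<in> space \<Omega>. A \<omega>} \<omega> * \<Omega>.prob {\<omega>' \<in> space \<Omega>. Q (comb_seq n \<omega> \<omega>')} \<partial>\<Omega>)" .
  have "Measurable.pred (\<Omega> \<Otimes>\<^sub>M \<Omega>) (\<lambda>z. Q (case z of (\<omega>, \<omega>') \<Rightarrow> comb_seq n \<omega> \<omega>'))"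
    by (rule measurable_compose[OF measurable_comb_seq_Omega Q])
  then have "{z \<in> space (\<Omega> \<Otimes>\<^sub>M \<Omega>). Q (case z of (\<omega>, \<omega>') \<Rightarrow> comb_seq n \<omega> \<omega>')} \<in> sets (\<Omega> \<Otimes>\<^sub>M \<Omega>)" by measurable
  from \<Omega>.measurable_emeasure_Pair[OF this]
  have "(\<lambda>\<omega>. \<Omega>.prob (Pair \<omega> -` {z \<in> space (\<Omega> \<Otimes>\<^sub>M \<Omega>). Q (case z of (\<omega>, \<omega>') \<Rightarrow> comb_seq n \<omega> \<omega>')})) \<in> borel_measurable \<Omega>"
    unfolding measure_def by measurable
  moreover have "Pair \<omega> -` {z \<in> space (\<Omega> \<Otimes>\<^sub>M \<Omega>). Q (case z of (\<omega>, \<omega>') \<Rightarrow> comb_seq n \<omega> \<omega>')} = {\<omega>' \<in> space \<Omega>. Q (comb_seq n \<omega> \<omega>')}"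
    if "\<omega> \<in> space \<Omega>" for \<omega> using that by (auto simp: space_pair_measure)
  ultimately show "(\<lambda>\<omega>. \<Omega>.prob {\<omega>' \<in> space \<Omega>. Q (comb_seq n \<omega> \<omega>')}) \<in> borel_measurable \<Omega>"
    by (simp cong: measurable_cong)
qed

section \<open>Regularity of the iterates and the Markov operator\<close>

lemma rds_iter_measurable[measurable]: "(\<lambda>\<omega>. rds_iter f \<omega> n x) \<in> \<Omega> \<rightarrow>\<^sub>M borel"
proof (induction n)
  case (Suc n)
  have "(\<lambda>\<omega>. f (\<omega> n) (rds_iter f \<omega> n x)) \<in> \<Omega> \<rightarrow>\<^sub>M borel"
    by (rule borel_measurable_caratheodory[OF separable Suc])
       (auto intro: measurable_compose[OF measurable_component_Omega measurable_map] continuous_map component_in_space)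
  then show ?case by simp
qed simp

lemma rds_iter_continuous: "\<omega> \<in> space \<Omega> \<Longrightarrow> continuous_on UNIV (rds_iter f \<omega> n)"
  by (induction n) (auto simp: comp_def id_def intro: continuous_on_compose2[OF continuous_map] component_in_space)

lemma rds_iter_case_nat: "rds_iter f (case_nat i \<omega>) (Suc n) x = rds_iter f \<omega> n (f i x)"
  by (induction n arbitrary: x) auto

lemma rds_iter_cong: "(\<And>k. k < n \<Longrightarrow> \<omega> k = \<omega>' k) \<Longrightarrow> rds_iter f \<omega> n x = rds_iter f \<omega>' n x"
  by (induction n) auto

lemma rds_iter_comb_seq_le: "k \<le> n \<Longrightarrow> rds_iter f (comb_seq n \<omega> \<omega>') k x = rds_iter f \<omega> k x"
  by (rule rds_iter_cong) (auto simp: comb_seq_def)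

lemma rds_iter_comb_seq: "rds_iter f (comb_seq n \<omega> \<omega>') (n + k) x = rds_iter f \<omega>' k (rds_iter f \<omega> n x)"
proof (induction k)
  case (Suc k)
  have "comb_seq n \<omega> \<omega>' (n + k) = \<omega>' k" by (simp add: comb_seq_def)
  with Suc show ?case by simp
qed (simp add: rds_iter_comb_seq_le)

text \<open>Values in a Banach space are allowed because the characteristic function argument
  applies the operator to a complex observable.\<close>

definition markov_op :: "('b \<Rightarrow> 'c::{banach,second_countable_topology}) \<Rightarrow> 'b \<Rightarrow> 'c" where
  "markov_op \<phi> x = (\<integral>i. \<phi> (f i x) \<partial>\<mu>)"

lemma measurable_continuous_map[measurable]:
  fixes \<phi> :: "'b \<Rightarrow> 'c::metric_space"
  shows "continuous_on UNIV \<phi> \<Longrightarrow> (\<lambda>i. \<phi> (f i x)) \<in> borel_measurable \<mu>"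
  by (rule measurable_compose[OF measurable_map borel_measurable_continuous_onI])

lemma measurable_continuous_iter[measurable]:
  fixes \<phi> :: "'b \<Rightarrow> 'c::metric_space"
  shows "continuous_on UNIV \<phi> \<Longrightarrow> (\<lambda>\<omega>. \<phi> (rds_iter f \<omega> n x)) \<in> borel_measurable \<Omega>"
  by (rule measurable_compose[OF rds_iter_measurable borel_measurable_continuous_onI])

lemma integrable_map:
  fixes \<phi> :: "'b \<Rightarrow> 'c::{banach,second_countable_topology}"
  assumes "continuous_on UNIV \<phi>" "\<And>x. norm (\<phi> x) \<le> C"
  shows "integrable \<mu> (\<lambda>i. \<phi> (f i x))"
  by (rule integrable_const_bound[where B=C]) (auto intro: assms measurable_continuous_map)

lemma integrable_iter:
  fixes \<phi> :: "'b \<Rightarrow> 'c::{banach,second_countable_topology}"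
  assumes "continuous_on UNIV \<phi>" "\<And>x. norm (\<phi> x) \<le> C"
  shows "integrable \<Omega> (\<lambda>\<omega>. \<phi> (rds_iter f \<omega> n x))"
  by (rule \<Omega>.integrable_const_bound[where B=C]) (auto intro: assms measurable_continuous_iter)

lemma markov_op_continuous:
  fixes \<phi> :: "'b \<Rightarrow> 'c::{banach,second_countable_topology}"
  assumes "continuous_on UNIV \<phi>" "\<And>x. norm (\<phi> x) \<le> C"
  shows "continuous_on UNIV (markov_op \<phi>)"
  unfolding markov_op_def
  by (rule continuous_on_integral_parameter[where C=C])
     (auto intro: assms measurable_continuous_map finite_measure_axioms continuous_on_compose2[OF assms(1) continuous_map])

lemma markov_op_bound:
  fixes \<phi> :: "'b \<Rightarrow> 'c::{banach,second_countable_topology}"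
  assumes "continuous_on UNIV \<phi>" "\<And>x. norm (\<phi> x) \<le> C"
  shows "norm (markov_op \<phi> x) \<le> C"
proof -
  have "norm (markov_op \<phi> x) \<le> (\<integral>i. norm (\<phi> (f i x)) \<partial>\<mu>)"
    unfolding markov_op_def by (rule integral_norm_bound)
  also have "\<dots> \<le> (\<integral>i. C \<partial>\<mu>)"
    using integrable_map[OF assms] by (intro integral_mono) (auto intro: assms)
  finally show ?thesis by (simp add: prob_space)
qed

lemma
  fixes \<phi> :: "'b \<Rightarrow> 'c::{banach,second_countable_topology}"
  assumes "continuous_on UNIV \<phi>" "\<And>x. norm (\<phi> x) \<le> C"
  shows markov_pow_continuous: "continuous_on UNIV ((markov_op ^^ n) \<phi>)"
    and markov_pow_bound: "norm ((markov_op ^^ n) \<phi> x) \<le> C"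
proof -
  have "continuous_on UNIV ((markov_op ^^ n) \<phi>) \<and> (\<forall>x. norm ((markov_op ^^ n) \<phi> x) \<le> C)"
    by (induction n) (auto intro: assms markov_op_continuous markov_op_bound)
  then show "continuous_on UNIV ((markov_op ^^ n) \<phi>)" "norm ((markov_op ^^ n) \<phi> x) \<le> C" by auto
qed

lemma markov_pow_eq:
  fixes \<phi> :: "'b \<Rightarrow> 'c::{banach,second_countable_topology}"
  assumes "continuous_on UNIV \<phi>" "\<And>x. norm (\<phi> x) \<le> C"
  shows "(markov_op ^^ n) \<phi> x = (\<integral>\<omega>. \<phi> (rds_iter f \<omega> n x) \<partial>\<Omega>)"
proof (induction n arbitrary: x)
  case 0 then show ?case by (simp add: \<Omega>.prob_space)
next
  case (Suc n)
  have "(\<integral>\<omega>. \<phi> (rds_iter f \<omega> (Suc n) x) \<partial>\<Omega>) = (\<integral>i. (\<integral>\<omega>. \<phi> (rds_iter f (case_nat i \<omega>) (Suc n) x) \<partial>\<Omega>) \<partial>\<mu>)"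
    by (rule integral_shift(1)[OF measurable_continuous_iter[OF assms(1)] assms(2)])
  also have "\<dots> = (\<integral>i. (\<integral>\<omega>. \<phi> (rds_iter f \<omega> n (f i x)) \<partial>\<Omega>) \<partial>\<mu>)"
    by (simp only: rds_iter_case_nat)
  also have "\<dots> = (\<integral>i. (markov_op ^^ n) \<phi> (f i x) \<partial>\<mu>)" using Suc by simp
  finally show ?case by (simp add: markov_op_def[of "(markov_op ^^ n) \<phi>"])
qed

end

section \<open>Contraction of pairs of orbits\<close>

text \<open>The coupling in which both points are driven by the same letters.\<close>

definition pair_map :: "('i \<Rightarrow> 'a \<Rightarrow> 'a) \<Rightarrow> 'i \<Rightarrow> 'a \<times> 'a \<Rightarrow> 'a \<times> 'a" where
  "pair_map f i z = (f i (fst z), f i (snd z))"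

lemma rds_iter_pair_map:
  "rds_iter (pair_map f) \<omega> n z = (rds_iter f \<omega> n (fst z), rds_iter f \<omega> n (snd z))"
  by (induction n) (auto simp: pair_map_def)

lemma (in random_maps) random_maps_pair_map: "random_maps \<mu> (pair_map f)"
proof
  show "continuous_on UNIV (pair_map f i)" if "i \<in> space \<mu>" for i
    unfolding pair_map_def by (intro continuous_intros continuous_on_compose2[OF continuous_map[OF that]]) auto
  show "(\<lambda>i. pair_map f i x) \<in> borel_measurable \<mu>" for x
    unfolding pair_map_def by (intro borel_measurable_Pair_separable separable measurable_map)
  show "\<exists>D::('b \<times> 'b) set. countable D \<and> closure D = UNIV"
    by (intro separable_Times separable)
qed

text \<open>The assumption \<open>support\<close> is the usable form of non-degeneracy: near each
  map of the family, in the supremum distance, lies a set of maps of positive measure.\<close>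

locale contracting_maps = random_maps \<mu> f for \<mu> :: "'i measure" and f :: "'i \<Rightarrow> 'a::metric_space \<Rightarrow> 'a" +
  assumes compact_space: "compact (UNIV :: 'a set)"
    and support: "i \<in> space \<mu> \<Longrightarrow> 0 < e \<Longrightarrow>
      \<exists>A\<in>sets \<mu>. 0 < measure \<mu> A \<and> (\<forall>j\<in>A. \<forall>x. dist (f j x) (f i x) < e)"
    and proximal: "proximal f (space \<mu>)"
    and local_contraction: "local_contraction f \<mu>"
begin

sublocale pair: random_maps \<mu> "pair_map f"
  by (rule random_maps_pair_map)

lemma compact_pairs: "compact (UNIV :: ('a \<times> 'a) set)"
  using compact_Times[OF compact_space compact_space] by simp

abbreviation iter_dist :: "(nat \<Rightarrow> 'i) \<Rightarrow> nat \<Rightarrow> 'a \<times> 'a \<Rightarrow> real" where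
  "iter_dist \<omega> n z \<equiv> dist (rds_iter f \<omega> n (fst z)) (rds_iter f \<omega> n (snd z))"

lemma iter_dist_measurable[measurable]: "(\<lambda>\<omega>. iter_dist \<omega> n z) \<in> borel_measurable \<Omega>"
proof -
  have "(\<lambda>\<omega>. dist (fst (rds_iter (pair_map f) \<omega> n z)) (snd (rds_iter (pair_map f) \<omega> n z))) \<in> borel_measurable \<Omega>"
    by (rule pair.measurable_continuous_iter) (intro continuous_intros)
  then show ?thesis by (simp add: rds_iter_pair_map)
qed

text \<open>Otherwise pairs ever closer to each other would fail with probability at least
  \<epsilon>. By compactness they accumulate at a diagonal point. For almost every sequence both
  coordinates eventually enter its contracted neighbourhood, so the failure indicators tend to 0 and
  dominated convergence contradicts the lower bound.\<close>

lemma contraction_probability: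
  "\<exists>Q::real. 0 < Q \<and> Q < 1 \<and> (\<forall>J. \<forall>\<epsilon>>0. \<exists>\<delta>>0. \<forall>z. dist (fst z) (snd z) < \<delta> \<longrightarrow>
       \<Omega>.prob {\<omega> \<in> space \<Omega>. \<exists>m. Q ^ (J + m) < iter_dist \<omega> m z} < \<epsilon>)"
proof -
  obtain q :: real where q: "0 < q" "q < 1" and con: "\<And>x. AE \<omega> in \<Omega>.
      \<exists>B. x \<in> interior B \<and> (\<forall>n\<ge>1. diameter (rds_iter f \<omega> n ` B) \<le> q ^ n)"
    using local_contraction unfolding local_contraction_def by auto
  \<comment> \<open>The slack between q and its square root pays for the offset \<open>J\<close>:
    \<open>q ^ m = Q ^ (2 * m)\<close> is at most \<open>Q ^ (J + m)\<close> once m \<ge> J.\<close>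
  define Q where "Q = sqrt q"
  have Q: "0 < Q" "Q < 1" "Q ^ 2 = q" using q by (auto simp: Q_def)
  show ?thesis
  proof (rule exI[of _ Q], intro conjI Q(1,2) allI impI, rule ccontr)
    fix J :: nat and \<epsilon> :: real assume "0 < \<epsilon>"
    let ?E = "\<lambda>z. {\<omega> \<in> space \<Omega>. \<exists>m. Q ^ (J + m) < iter_dist \<omega> m z}"
    assume "\<not> (\<exists>\<delta>>0. \<forall>z. dist (fst z) (snd z) < \<delta> \<longrightarrow> \<Omega>.prob (?E z) < \<epsilon>)"
    then have "\<forall>\<delta>>0. \<exists>z. dist (fst z) (snd z) < \<delta> \<and> \<epsilon> \<le> \<Omega>.prob (?E z)" by (meson not_less)
    moreover have "0 < 1 / real (Suc k)" for k by simp
    ultimately have "\<forall>k. \<exists>z. dist (fst z) (snd z) < 1 / real (Suc k) \<and> \<epsilon> \<le> \<Omega>.prob (?E z)" by blast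
    from choice[OF this] obtain Z where Z: "\<And>k. dist (fst (Z k)) (snd (Z k)) < 1 / real (Suc k)"
        "\<And>k. \<epsilon> \<le> \<Omega>.prob (?E (Z k))"
      by blast
    obtain z r where r: "strict_mono (r :: nat \<Rightarrow> nat)" "(Z \<circ> r) \<longlonglongrightarrow> z"
      using seq_compactE[OF compact_imp_seq_compact[OF compact_pairs], of Z] by blast
    have d0: "(\<lambda>k. dist (fst (Z k)) (snd (Z k))) \<longlonglongrightarrow> 0"
    proof (rule tendsto_sandwich[where f="\<lambda>_. 0" and h="\<lambda>k. 1 / real (Suc k)"])
      show "\<forall>\<^sub>F k in sequentially. dist (fst (Z k)) (snd (Z k)) \<le> 1 / real (Suc k)"
        by (intro always_eventually allI less_imp_le Z(1))
      show "(\<lambda>k. 1 / real (Suc k)) \<longlonglongrightarrow> 0" using LIMSEQ_Suc[OF lim_1_over_n] by simp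
    qed auto
    have fz: "(\<lambda>k. fst (Z (r k))) \<longlonglongrightarrow> fst z" and sz: "(\<lambda>k. snd (Z (r k))) \<longlonglongrightarrow> snd z"
      using tendsto_fst[OF r(2)] tendsto_snd[OF r(2)] by (auto simp: comp_def)
    have "(\<lambda>k. dist (fst (Z (r k))) (snd (Z (r k)))) \<longlonglongrightarrow> dist (fst z) (snd z)"
      by (intro tendsto_dist fz sz)
    moreover have "(\<lambda>k. dist (fst (Z (r k))) (snd (Z (r k)))) \<longlonglongrightarrow> 0"
      using LIMSEQ_subseq_LIMSEQ[OF d0 r(1)] by (simp add: comp_def)
    ultimately have "dist (fst z) (snd z) = 0" using LIMSEQ_unique by blast
    then have sfz: "snd z = fst z" by simp
    have "(\<lambda>k. \<integral>\<omega>. indicator (?E (Z (r k))) \<omega> \<partial>\<Omega>) \<longlonglongrightarrow> (\<integral>\<omega>. (0::real) \<partial>\<Omega>)"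
    proof (rule integral_dominated_convergence[where w="\<lambda>_. 1"])
      show "AE \<omega> in \<Omega>. (\<lambda>k. indicator (?E (Z (r k))) \<omega> :: real) \<longlonglongrightarrow> 0"
        using con[of "fst z"]
      proof eventually_elim
        case (elim \<omega>)
        then obtain B where B: "fst z \<in> interior B" and diam: "\<And>n. n \<ge> 1 \<Longrightarrow> diameter (rds_iter f \<omega> n ` B) \<le> q ^ n" by auto
        show ?case
        proof (cases "\<omega> \<in> space \<Omega>")
          case True
          have e1: "\<forall>\<^sub>F k in sequentially. fst (Z (r k)) \<in> interior B"
            and e2: "\<forall>\<^sub>F k in sequentially. snd (Z (r k)) \<in> interior B"
            using topological_tendstoD[OF fz open_interior B] topological_tendstoD[OF sz open_interior] B sfz by auto
          have "\<forall>m\<in>{..<Suc J}. \<forall>\<^sub>F k in sequentially. iter_dist \<omega> m (Z (r k)) < Q ^ (J + m)"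
          proof
            fix m
            have c: "(\<lambda>k. rds_iter f \<omega> m (y k)) \<longlonglongrightarrow> rds_iter f \<omega> m x" if "y \<longlonglongrightarrow> x" for y x
              using continuous_on_tendsto_compose[OF rds_iter_continuous[OF True] that, of m] by simp
            have "(\<lambda>k. iter_dist \<omega> m (Z (r k))) \<longlonglongrightarrow> iter_dist \<omega> m z"
              by (intro tendsto_dist c fz sz)
            then have "(\<lambda>k. iter_dist \<omega> m (Z (r k))) \<longlonglongrightarrow> 0" using sfz by simp
            then show "\<forall>\<^sub>F k in sequentially. iter_dist \<omega> m (Z (r k)) < Q ^ (J + m)"
              by (rule order_tendstoD(2)) (use Q in simp)
          qed
          then have "\<forall>\<^sub>F k in sequentially. \<forall>m\<in>{..<Suc J}. iter_dist \<omega> m (Z (r k)) < Q ^ (J + m)"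
            by (rule eventually_ball_finite[rotated]) simp
          with e1 e2 have "\<forall>\<^sub>F k in sequentially. indicator (?E (Z (r k))) \<omega> = (0::real)"
          proof eventually_elim
            case (elim k)
            have "iter_dist \<omega> m (Z (r k)) \<le> Q ^ (J + m)" for m
            \<comment> \<open>Finitely many times are handled by continuity at the diagonal point.
              The range includes m = 0 even if J = 0, because the contraction hypothesis starts at
              time 1.\<close>
            proof (cases "m < Suc J")
              case True with elim(3) show ?thesis by (auto intro: less_imp_le)
            next
              case False
              have "bounded (rds_iter f \<omega> m ` B)"
                using compact_imp_bounded[OF compact_space] bounded_subset by blast
              then have "iter_dist \<omega> m (Z (r k)) \<le> diameter (rds_iter f \<omega> m ` B)"
                using elim(1,2) interior_subset[of B] by (intro diameter_bounded_bound) auto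
              also have "\<dots> \<le> q ^ m" using diam False by simp
              also have "\<dots> = Q ^ (2 * m)" using Q(3) by (simp add: power_mult)
              also have "\<dots> \<le> Q ^ (J + m)" using False Q by (intro power_decreasing) auto
              finally show ?thesis .
            qed
            then show ?case by (simp add: not_less)
          qed
          then show ?thesis by (rule tendsto_eventually)
        qed simp
      qed
    qed auto
    then have "(\<lambda>k. \<Omega>.prob (?E (Z (r k)))) \<longlonglongrightarrow> 0" by simp
    from LIMSEQ_le_const[OF this] have "\<epsilon> \<le> 0" using Z(2) by blast
    with \<open>0 < \<epsilon>\<close> show False by simp
  qed
qed

text \<open>Proximality provides a single sequence, which may have measure zero. Non-degeneracy
  repairs this one letter at a time: letters close to the given one have positive measure and still
  lead to points where \<open>\<phi>\<close> is bounded away from 0. The induction peels off the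
  last letter by replacing \<open>\<phi>\<close> with its image under the Markov operator.\<close>

lemma markov_pow_positive:
  assumes "continuous_on UNIV \<phi>" "\<And>z. norm (\<phi> z :: real) \<le> C" "\<And>z. 0 \<le> \<phi> z"
    and "\<omega> \<in> UNIV \<rightarrow> space \<mu>" "0 < \<phi> (rds_iter (pair_map f) \<omega> n z)"
  shows "0 < (pair.markov_op ^^ n) \<phi> z"
  using assms
proof (induction n arbitrary: \<phi>)
  case (Suc n)
  note cont = Suc.prems(1) and bd = Suc.prems(2) and nn = Suc.prems(3)
  have one: "0 < pair.markov_op \<phi> y" if i: "i \<in> space \<mu>" and pos: "0 < \<phi> (pair_map f i y)" for i y
  proof -
    let ?p = "pair_map f i y"
    have "continuous (at ?p) \<phi>" using cont continuous_on_eq_continuous_at by blast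
    then obtain e where e: "e > 0" "\<And>z'. dist z' ?p < e \<Longrightarrow> dist (\<phi> z') (\<phi> ?p) < \<phi> ?p / 2"
      using pos unfolding continuous_at_eps_delta by (metis half_gt_zero)
    obtain A where A: "A \<in> sets \<mu>" "0 < measure \<mu> A" "\<And>j x. j \<in> A \<Longrightarrow> dist (f j x) (f i x) < e / 2"
      using support[OF i, of "e / 2"] e(1) by auto
    have "\<phi> ?p / 2 * measure \<mu> A = (\<integral>j. \<phi> ?p / 2 * indicator A j \<partial>\<mu>)" using A(1) by simp
    also have "\<dots> \<le> (\<integral>j. \<phi> (pair_map f j y) \<partial>\<mu>)"
    proof (rule integral_mono)
      fix j
      have "\<phi> ?p / 2 \<le> \<phi> (pair_map f j y)" if "j \<in> A"
      proof -
        have "dist (pair_map f j y) ?p \<le> dist (f j (fst y)) (f i (fst y)) + dist (f j (snd y)) (f i (snd y))"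
          by (simp add: pair_map_def dist_Pair_Pair sqrt_sum_squares_le_sum)
        also have "\<dots> < e" using A(3)[OF that, of "fst y"] A(3)[OF that, of "snd y"] by simp
        finally have "dist (\<phi> (pair_map f j y)) (\<phi> ?p) < \<phi> ?p / 2" by (rule e(2))
        then show ?thesis unfolding dist_real_def by linarith
      qed
      then show "\<phi> ?p / 2 * indicator A j \<le> \<phi> (pair_map f j y)" using nn by (auto simp: indicator_def)
    qed (use A(1) in \<open>auto intro!: pair.integrable_map[OF cont bd] simp: fmeasurable_eq_sets less_top[symmetric]\<close>)
    finally show ?thesis using A(2) pos unfolding pair.markov_op_def
      by (smt (verit) mult_pos_pos half_gt_zero)
  qed
  have "0 < (pair.markov_op ^^ n) (pair.markov_op \<phi>) z"
  proof (rule Suc.IH)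
    show "continuous_on UNIV (pair.markov_op \<phi>)" by (rule pair.markov_op_continuous[OF cont bd])
    show "norm (pair.markov_op \<phi> y) \<le> C" for y by (rule pair.markov_op_bound[OF cont bd])
    show "0 \<le> pair.markov_op \<phi> y" for y unfolding pair.markov_op_def by (simp add: nn)
    show "\<omega> \<in> UNIV \<rightarrow> space \<mu>" by fact
    show "0 < pair.markov_op \<phi> (rds_iter (pair_map f) \<omega> n z)"
      using Suc.prems(4,5) by (intro one[of "\<omega> n"]) auto
  qed
  then show ?case by (simp add: funpow_Suc_right del: funpow.simps)
qed simp

end

text \<open>Interpreted with two exponents: the Hoelder exponent of the observable, and 1 for the
  Lipschitz approximations of the conditional variance.\<close>

locale dist_power = contracting_maps \<mu> f for \<mu> :: "'i measure" and f :: "'i \<Rightarrow> 'a::metric_space \<Rightarrow> 'a" +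
  fixes \<alpha> :: real
  assumes alpha_pos: "0 < \<alpha>"
begin

section \<open>Sums of expected powers of the distance between two orbits\<close>

definition dpow :: "'a \<times> 'a \<Rightarrow> real" where "dpow z = dist (fst z) (snd z) powr \<alpha>"

text \<open>The sum is truncated so that it is continuous and bounded before any bound uniform in
  \<open>n\<close> is known; the maximum over all pairs then exists and can be estimated.\<close>

definition dsum :: "nat \<Rightarrow> 'a \<times> 'a \<Rightarrow> real" where
  "dsum n z = (\<Sum>k<n. (pair.markov_op ^^ k) dpow z)"

lemma dpow_continuous: "continuous_on UNIV dpow"
  unfolding dpow_def using alpha_pos by (intro continuous_on_powr' continuous_intros) auto

lemma dpow_nonneg: "0 \<le> dpow z"
  by (simp add: dpow_def)

definition dmax where "dmax = (SOME C. 0 < C \<and> (\<forall>z. norm (dpow z) \<le> C))"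

lemma dmax: "0 < dmax" "norm (dpow z) \<le> dmax"
proof -
  have "\<exists>C. 0 < C \<and> (\<forall>z. norm (dpow z) \<le> C)"
    using compact_continuous_bounded[OF compact_pairs dpow_continuous] by metis
  then have "0 < dmax \<and> (\<forall>z. norm (dpow z) \<le> dmax)" unfolding dmax_def by (rule someI_ex)
  then show "0 < dmax" "norm (dpow z) \<le> dmax" by blast+
qed

lemmas dpow_pow_continuous = pair.markov_pow_continuous[OF dpow_continuous dmax(2)]
  and dpow_pow_bound = pair.markov_pow_bound[OF dpow_continuous dmax(2)]
  and dpow_pow_eq = pair.markov_pow_eq[OF dpow_continuous dmax(2)]

lemma dpow_pow_nonneg: "0 \<le> (pair.markov_op ^^ n) dpow z"
  unfolding dpow_pow_eq by (simp add: dpow_nonneg)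

lemma dsum_continuous: "continuous_on UNIV (dsum n)"
  unfolding dsum_def[abs_def] by (intro continuous_intros dpow_pow_continuous)

lemma dsum_nonneg: "0 \<le> dsum n z"
  unfolding dsum_def by (intro sum_nonneg dpow_pow_nonneg)

lemma dsum_mono: "m \<le> n \<Longrightarrow> dsum m z \<le> dsum n z"
  unfolding dsum_def by (rule sum_mono2) (auto intro: dpow_pow_nonneg)

lemma dsum_bound: "norm (dsum n z) \<le> real n * dmax"
proof -
  have "norm (dsum n z) \<le> (\<Sum>k<n. dmax)"
    unfolding dsum_def using dpow_pow_bound by (rule sum_norm_le)
  then show ?thesis by simp
qed

lemma dsum_add: "dsum (n + m) z = dsum n z + (pair.markov_op ^^ n) (dsum m) z"
proof -
  have "(pair.markov_op ^^ n) (dsum m) z = (\<integral>\<omega>. dsum m (rds_iter (pair_map f) \<omega> n z) \<partial>\<Omega>)"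
    by (rule pair.markov_pow_eq[OF dsum_continuous dsum_bound])
  also have "\<dots> = (\<Sum>k<m. \<integral>\<omega>. (pair.markov_op ^^ k) dpow (rds_iter (pair_map f) \<omega> n z) \<partial>\<Omega>)"
    unfolding dsum_def by (rule Bochner_Integration.integral_sum)
      (rule pair.integrable_iter[OF dpow_pow_continuous dpow_pow_bound])
  also have "\<dots> = (\<Sum>k<m. (pair.markov_op ^^ n) ((pair.markov_op ^^ k) dpow) z)"
    by (simp add: pair.markov_pow_eq[OF dpow_pow_continuous dpow_pow_bound])
  also have "\<dots> = (\<Sum>k<m. (pair.markov_op ^^ (n + k)) dpow z)"
    by (simp add: funpow_add)
  finally have "(pair.markov_op ^^ n) (dsum m) z = (\<Sum>k<m. (pair.markov_op ^^ (n + k)) dpow z)" .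
  moreover have "(\<Sum>k<n + m. a k) = (\<Sum>k<n. a k) + (\<Sum>k<m. a (n + k))" for a :: "nat \<Rightarrow> real"
    by (induction m) auto
  ultimately show ?thesis unfolding dsum_def by simp
qed

definition leaves :: "real \<Rightarrow> nat \<Rightarrow> nat \<Rightarrow> 'a \<times> 'a \<Rightarrow> (nat \<Rightarrow> 'i) \<Rightarrow> bool" where
  "leaves Q j n z \<omega> \<longleftrightarrow> (\<exists>m<n. Q ^ (j + m) < iter_dist \<omega> m z)"

lemma leaves_measurable[measurable]: "Measurable.pred \<Omega> (leaves Q j n z)"
  unfolding leaves_def[abs_def] by measurable

text \<open>Time 0 is passed without failure, so a failure comes later. Seen from the pair after one
  step the thresholds start one power further on, which is why \<open>j\<close> is a parameter of
  \<open>leaves\<close>.\<close>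

lemma leaves_case_nat:
  assumes "\<not> Q ^ j < dist (fst z) (snd z)"
  shows "leaves Q j (Suc n) z (case_nat i \<omega>) = leaves Q (Suc j) n (pair_map f i z) \<omega>"
  unfolding leaves_def Ex_less_Suc2 using assms
  by (simp add: rds_iter_case_nat pair_map_def del: rds_iter.simps(2))

text \<open>Compares a pair of orbits with the sequence \<open>Q\<^bsup>j+m\<^esup>\<close> up to the first time that
  the comparison fails; from then on the a priori bound \<open>B\<close> is used. Since the failures at
  different times are disjoint, their total weight is the probability of a failure.\<close>

lemma dsum_le_failure_prob:
  assumes Q: "0 < Q" "Q < 1" and B: "\<And>m z. m \<le> N \<Longrightarrow> dsum m z \<le> B" and "n \<le> N"
  shows "dsum n z \<le> (\<Sum>k<n. (Q powr \<alpha>) ^ (j + k)) +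
     \<Omega>.prob {\<omega> \<in> space \<Omega>. leaves Q j n z \<omega>} * B"
  using \<open>n \<le> N\<close>
proof (induction n arbitrary: j z)
  case 0 then show ?case by (simp add: dsum_def leaves_def)
next
  case (Suc n)
  let ?r = "Q powr \<alpha>"
  let ?A = "\<lambda>n j z. \<Omega>.prob {\<omega> \<in> space \<Omega>. leaves Q j n z \<omega>}"
  show ?case
  proof (cases "Q ^ j < dist (fst z) (snd z)")
    \<comment> \<open>Failure at time 0: the probability on the right is 1, and the a priori bound
      alone suffices.\<close>
    case True
    have "{\<omega> \<in> space \<Omega>. leaves Q j (Suc n) z \<omega>} = space \<Omega>"
      using True by (auto simp: leaves_def Ex_less_Suc2)
    then have "?A (Suc n) j z = 1" by (simp add: \<Omega>.prob_space)
    moreover have "0 \<le> (\<Sum>k<Suc n. ?r ^ (j + k))" by (intro sum_nonneg) simp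
    ultimately show ?thesis using B[OF Suc.prems, of z] by simp
  next
    case False
    note eqv = leaves_case_nat[OF False, of n]
    have A: "?A (Suc n) j z = (\<integral>i. ?A n (Suc j) (pair_map f i z) \<partial>\<mu>)"
      and Am: "(\<lambda>i. ?A n (Suc j) (pair_map f i z)) \<in> borel_measurable \<mu>"
      using prob_shift[OF leaves_measurable, of Q j "Suc n" z] unfolding eqv by this+
    have Ai: "integrable \<mu> (\<lambda>i. ?A n (Suc j) (pair_map f i z))"
      by (rule integrable_const_bound[where B=1]) (use Am in auto)
    have "dsum (Suc n) z = dpow z + pair.markov_op (dsum n) z"
      using dsum_add[of 1 n z] by (simp add: dsum_def)
    also have "pair.markov_op (dsum n) z \<le> (\<integral>i. (\<Sum>k<n. ?r ^ (Suc j + k)) + ?A n (Suc j) (pair_map f i z) * B \<partial>\<mu>)"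
      unfolding pair.markov_op_def
    proof (rule integral_mono)
      show "integrable \<mu> (\<lambda>i. dsum n (pair_map f i z))"
        by (rule pair.integrable_map[OF dsum_continuous dsum_bound])
      show "integrable \<mu> (\<lambda>i. (\<Sum>k<n. ?r ^ (Suc j + k)) + ?A n (Suc j) (pair_map f i z) * B)"
        using Ai by auto
      show "dsum n (pair_map f i z) \<le> (\<Sum>k<n. ?r ^ (Suc j + k)) + ?A n (Suc j) (pair_map f i z) * B" for i
        by (rule Suc.IH) (use Suc.prems in simp)
    qed
    also have "\<dots> = (\<Sum>k<n. ?r ^ (Suc j + k)) + ?A (Suc n) j z * B"
      using Ai by (simp add: prob_space A del: add_Suc)
    also have "dpow z \<le> ?r ^ j"
    proof -
      have "dpow z \<le> (Q ^ j) powr \<alpha>" unfolding dpow_def using False alpha_pos by (intro powr_mono2) auto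
      also have "\<dots> = ?r ^ j"
        using Q by (simp add: powr_realpow[symmetric] powr_powr mult.commute)
      finally show ?thesis .
    qed
    finally show ?thesis unfolding sum.lessThan_Suc_shift by simp
  qed
qed

lemma geometric_sum_le:
  fixes r :: real assumes "0 < r" "r < 1" shows "(\<Sum>k<n. r ^ (j + k)) \<le> r ^ j / (1 - r)"
proof -
  have "(\<Sum>k<n. r ^ (j + k)) = r ^ j * (\<Sum>k<n. r ^ k)" by (simp add: power_add sum_distrib_left)
  also have "(\<Sum>k<n. r ^ k) \<le> 1 / (1 - r)"
    using assms by (simp add: sum_gp_strict divide_right_mono)
  finally show ?thesis using assms by (simp add: mult_left_mono)
qed

text \<open>The tent function replaces the indicator of closeness so that its images under powers of
  the Markov operator are continuous. Proximality makes one of them positive at each pair; the sets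
  where some power exceeds some 1 / (k + 1) are then an open cover, and a finite subcover gives
  \<open>N\<close> and \<open>p\<close>.\<close>

lemma approach_probability:
  assumes "0 < \<delta>"
  obtains N p where "0 < p" "\<forall>z. \<exists>n\<le>N. p < (pair.markov_op ^^ n) (\<lambda>z. max 0 (\<delta> - dist (fst z) (snd z))) z"
proof -
  define \<psi> :: "'a \<times> 'a \<Rightarrow> real" where "\<psi> z = max 0 (\<delta> - dist (fst z) (snd z))" for z
  have c: "continuous_on UNIV \<psi>" unfolding \<psi>_def by (intro continuous_intros)
  have b: "norm (\<psi> z) \<le> \<delta>" for z using assms by (auto simp: \<psi>_def)
  have nn: "0 \<le> \<psi> z" for z by (simp add: \<psi>_def)
  define U where "U nk = {z. 1 / real (Suc (snd nk)) < (pair.markov_op ^^ (fst nk)) \<psi> z}" for nk :: "nat \<times> nat"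
  have op: "open (U nk)" for nk unfolding U_def
    by (intro open_Collect_less pair.markov_pow_continuous[OF c b] continuous_intros)
  have cov: "z \<in> (\<Union>nk\<in>UNIV. U nk)" for z
  proof -
    obtain \<omega> nk where \<omega>: "\<omega> \<in> UNIV \<rightarrow> space \<mu>"
      "(\<lambda>k::nat. dist (rds_iter f \<omega> (nk k) (fst z)) (rds_iter f \<omega> (nk k) (snd z))) \<longlonglongrightarrow> 0"
      using proximal unfolding proximal_def by blast
    from order_tendstoD(2)[OF \<omega>(2) assms] obtain k where "iter_dist \<omega> (nk k) z < \<delta>"
      by (auto dest: eventually_happens)
    then have "0 < \<psi> (rds_iter (pair_map f) \<omega> (nk k) z)" by (simp add: \<psi>_def rds_iter_pair_map)
    from markov_pow_positive[OF c b nn \<omega>(1) this] have "0 < (pair.markov_op ^^ nk k) \<psi> z" .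
    then obtain l where "1 / real (Suc l) < (pair.markov_op ^^ nk k) \<psi> z" by (rule nat_approx_posE)
    then have "z \<in> U (nk k, l)" by (simp add: U_def)
    then show ?thesis by blast
  qed
  obtain S where S: "finite S" "UNIV \<subseteq> (\<Union>nk\<in>S. U nk)"
    by (rule compactE_image[OF compact_pairs, of UNIV U]) (use op cov in blast)+
  define N K where "N = Max (insert 0 (fst ` S))" and "K = Max (insert 0 (snd ` S))"
  show ?thesis
  proof (rule that[of "1 / real (Suc K)" N], safe)
    fix z :: "'a \<times> 'a"
    obtain nk where nk: "nk \<in> S" "z \<in> U nk" using S(2) by blast
    have "fst nk \<le> N" "snd nk \<le> K" using nk(1) S(1) by (auto simp: N_def K_def)
    then have "1 / real (Suc K) \<le> 1 / real (Suc (snd nk))" by (simp add: frac_le)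
    also have "\<dots> < (pair.markov_op ^^ (fst nk)) \<psi> z" using nk(2) by (simp add: U_def)
    finally show "\<exists>n\<le>N. 1 / real (Suc K) < (pair.markov_op ^^ n) (\<lambda>z. max 0 (\<delta> - dist (fst z) (snd z))) z"
      using \<open>fst nk \<le> N\<close> unfolding \<psi>_def[abs_def] by blast
  qed simp
qed

text \<open>For fixed m let B be the maximum of \<open>dsum m\<close>. Close pairs satisfy
  \<open>dsum m z \<le> C + B / 2\<close>, because failure has probability below 1/2. From the
  maximiser some close pair is reached with definite weight within \<open>N\<close> steps, so B
  cannot exceed a constant by much: otherwise the loss on close pairs would outweigh the at most
  \<open>N * dmax\<close> collected on the way. The constant does not involve m.\<close>

lemma dsum_uniform_bound: obtains B where "\<forall>n z. dsum n z \<le> B"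
proof -
  obtain Q :: real where Q: "0 < Q" "Q < 1" and
    close: "\<And>J \<epsilon>. 0 < \<epsilon> \<Longrightarrow> \<exists>\<delta>>0. \<forall>z. dist (fst z) (snd z) < \<delta> \<longrightarrow>
       \<Omega>.prob {\<omega> \<in> space \<Omega>. \<exists>m. Q ^ (J + m) < iter_dist \<omega> m z} < \<epsilon>"
    using contraction_probability by blast
  define r where "r = Q powr \<alpha>"
  have r: "0 < r" "r < 1" using Q alpha_pos powr_less_mono2[of \<alpha> Q 1] by (auto simp: r_def)
  obtain \<delta> where \<delta>: "\<delta> > 0" "\<And>z. dist (fst z) (snd z) < \<delta> \<Longrightarrow>
       \<Omega>.prob {\<omega> \<in> space \<Omega>. \<exists>m. Q ^ (0 + m) < iter_dist \<omega> m z} < 1 / 2"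
    using close[of "1/2" 0] by auto
  define \<psi> :: "'a \<times> 'a \<Rightarrow> real" where "\<psi> z = max 0 (\<delta> - dist (fst z) (snd z))" for z
  have c: "continuous_on UNIV \<psi>" unfolding \<psi>_def by (intro continuous_intros)
  have b: "norm (\<psi> z) \<le> \<delta>" for z using \<delta> by (auto simp: \<psi>_def)
  obtain N p where p: "0 < p" "\<forall>z. \<exists>n\<le>N. p < (pair.markov_op ^^ n) \<psi> z"
    unfolding \<psi>_def[abs_def] by (rule approach_probability[OF \<delta>(1)])
  define C where "C = 1 / (1 - r)"
  have C: "0 < C" using r by (simp add: C_def)
  have "dsum m z \<le> 2 * (C + real N * dmax * \<delta> / p)" for m z
  proof -
    obtain z0 where z0: "\<And>z. dsum m z \<le> dsum m z0"
      using continuous_attains_sup[OF compact_pairs UNIV_not_empty dsum_continuous] by blast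
    define B where "B = dsum m z0"
    have B0: "0 \<le> B" unfolding B_def by (rule dsum_nonneg)
    have near: "dsum m z \<le> C + B / 2" if "dist (fst z) (snd z) < \<delta>" for z
    proof -
      have "dsum m z \<le> (\<Sum>k<m. r ^ (0 + k)) +
         \<Omega>.prob {\<omega> \<in> space \<Omega>. leaves Q 0 m z \<omega>} * B"
        unfolding r_def by (rule dsum_le_failure_prob[OF Q _ order_refl])
          (auto simp: B_def intro: order_trans[OF dsum_mono z0])
      also have "(\<Sum>k<m. r ^ (0 + k)) \<le> C" unfolding C_def using geometric_sum_le[OF r, where j=0] by simp
      also have "\<Omega>.prob {\<omega> \<in> space \<Omega>. leaves Q 0 m z \<omega>} \<le>
          \<Omega>.prob {\<omega> \<in> space \<Omega>. \<exists>l. Q ^ (0 + l) < iter_dist \<omega> l z}"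
        by (rule \<Omega>.finite_measure_mono) (auto simp: leaves_def)
      also have "\<dots> \<le> 1 / 2" using \<delta>(2)[OF that] by simp
      finally show ?thesis using B0 by (simp add: mult_right_mono)
    qed
    have "B / 2 - C \<le> real N * dmax * \<delta> / p"
    proof (cases "B / 2 - C \<le> 0")
      case True
      moreover have "0 \<le> real N * dmax * \<delta> / p" using dmax(1) \<delta>(1) p(1) by simp
      ultimately show ?thesis by linarith
    next
      case False
      \<comment> \<open>The tent function is at most \<delta> and vanishes away from the diagonal;
        this slope makes \<open>B - \<kappa> * \<psi>\<close> a majorant of \<open>dsum m\<close> in
        both regions.\<close>
      define \<kappa> where "\<kappa> = (B / 2 - C) / \<delta>"
      have \<kappa>: "\<kappa> > 0" using False \<delta>(1) by (simp add: \<kappa>_def)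
      have le: "dsum m z \<le> B - \<kappa> * \<psi> z" for z
      proof (cases "dist (fst z) (snd z) < \<delta>")
        case True
        have "\<psi> z \<le> \<delta>" using b[of z] by simp
        then have "\<kappa> * \<psi> z \<le> \<kappa> * \<delta>" using \<kappa> by simp
        also have "\<dots> = B / 2 - C" using \<delta>(1) by (simp add: \<kappa>_def)
        finally show ?thesis using near[OF True] by (simp add: field_simps)
      next
        case False
        then have "\<psi> z = 0" by (simp add: \<psi>_def)
        then show ?thesis using z0[of z] by (simp add: B_def)
      qed
      obtain n where n: "n \<le> N" "p < (pair.markov_op ^^ n) \<psi> z0" using p(2) by blast
      \<comment> \<open>At the maximiser the Markov property after n steps gives
        \<open>B \<le> N * dmax + B - \<kappa> * p\<close>; B cancels and \<kappa> is
        bounded.\<close>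
      have "B \<le> dsum (n + m) z0" unfolding B_def by (rule dsum_mono) simp
      also have "\<dots> = dsum n z0 + (pair.markov_op ^^ n) (dsum m) z0" by (rule dsum_add)
      also have "dsum n z0 \<le> real n * dmax" using dsum_bound[of n z0] by simp
      also have "\<dots> \<le> real N * dmax" using n(1) dmax(1) by simp
      also have "(pair.markov_op ^^ n) (dsum m) z0 = (\<integral>\<omega>. dsum m (rds_iter (pair_map f) \<omega> n z0) \<partial>\<Omega>)"
        by (rule pair.markov_pow_eq[OF dsum_continuous dsum_bound])
      also have "\<dots> \<le> (\<integral>\<omega>. B - \<kappa> * \<psi> (rds_iter (pair_map f) \<omega> n z0) \<partial>\<Omega>)"
        using pair.integrable_iter[OF c b] le
        by (intro integral_mono pair.integrable_iter[OF dsum_continuous dsum_bound]) auto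
      also have "\<dots> = B - \<kappa> * (pair.markov_op ^^ n) \<psi> z0"
        using pair.integrable_iter[OF c b] by (simp add: pair.markov_pow_eq[OF c b] \<Omega>.prob_space)
      also have "\<dots> \<le> B - \<kappa> * p" using n(2) \<kappa> by simp
      finally have "\<kappa> * p \<le> real N * dmax" by simp
      then show ?thesis using p(1) \<delta>(1) unfolding \<kappa>_def by (simp add: field_simps)
    qed
    then have "B \<le> 2 * (C + real N * dmax * \<delta> / p)" by simp
    then show ?thesis using z0[of z] unfolding B_def by linarith
  qed
  then show ?thesis using that by blast
qed

text \<open>This is the equicontinuity estimate behind the continuity of the Poisson solution.
  Starting the comparison at a high power \<open>Q ^ J\<close> makes the geometric part small, and
  the uniform bound now available makes the contribution of failures as small as their
  probability.\<close>

lemma dsum_small: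
  assumes "0 < \<eta>"
  obtains \<delta> where "0 < \<delta>" "\<forall>n z. dist (fst z) (snd z) < \<delta> \<longrightarrow> dsum n z \<le> \<eta>"
proof -
  obtain Q :: real where Q: "0 < Q" "Q < 1" and
    close: "\<And>J \<epsilon>. 0 < \<epsilon> \<Longrightarrow> \<exists>\<delta>>0. \<forall>z. dist (fst z) (snd z) < \<delta> \<longrightarrow>
       \<Omega>.prob {\<omega> \<in> space \<Omega>. \<exists>m. Q ^ (J + m) < iter_dist \<omega> m z} < \<epsilon>"
    using contraction_probability by blast
  define r where "r = Q powr \<alpha>"
  have r: "0 < r" "r < 1" using Q alpha_pos powr_less_mono2[of \<alpha> Q 1] by (auto simp: r_def)
  obtain B where "\<forall>n z. dsum n z \<le> B" by (rule dsum_uniform_bound)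
  then have B: "dsum n z \<le> B" for n z by blast
  have B0: "0 \<le> B" by (rule order_trans[OF dsum_nonneg B])
  \<comment> \<open>The factor 1 - r cancels the one in the geometric series; below,
    \<open>B + 1\<close> keeps the denominator positive when B = 0.\<close>
  obtain J where J: "r ^ J < (1 - r) * (\<eta> / 2)" using real_arch_pow_inv[of "(1 - r) * (\<eta> / 2)" r] r assms by auto
  obtain \<delta> where \<delta>: "\<delta> > 0" "\<And>z. dist (fst z) (snd z) < \<delta> \<Longrightarrow>
       \<Omega>.prob {\<omega> \<in> space \<Omega>. \<exists>m. Q ^ (J + m) < iter_dist \<omega> m z} < \<eta> / (2 * (B + 1))"
    using close[of "\<eta> / (2 * (B + 1))" J] B0 assms by auto
  show ?thesis
  proof (rule that[OF \<delta>(1)], intro allI impI)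
    fix n and z :: "'a \<times> 'a" assume z: "dist (fst z) (snd z) < \<delta>"
    have "dsum n z \<le> (\<Sum>k<n. r ^ (J + k)) +
         \<Omega>.prob {\<omega> \<in> space \<Omega>. leaves Q J n z \<omega>} * B"
      unfolding r_def by (rule dsum_le_failure_prob[OF Q _ order_refl]) (rule B)
    also have "(\<Sum>k<n. r ^ (J + k)) \<le> r ^ J / (1 - r)" by (rule geometric_sum_le[OF r])
    also have "\<dots> \<le> \<eta> / 2" using J r by (simp add: field_simps)
    also have "\<Omega>.prob {\<omega> \<in> space \<Omega>. leaves Q J n z \<omega>} \<le>
          \<Omega>.prob {\<omega> \<in> space \<Omega>. \<exists>l. Q ^ (J + l) < iter_dist \<omega> l z}"
      by (rule \<Omega>.finite_measure_mono) (auto simp: leaves_def)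
    also have "\<dots> \<le> \<eta> / (2 * (B + 1))" using \<delta>(2)[OF z] by simp
    also have "\<eta> / (2 * (B + 1)) * B \<le> \<eta> / 2" using B0 assms by (simp add: field_simps)
    finally show "dsum n z \<le> \<eta>" using B0 by (simp add: mult_right_mono)
  qed
qed

end

section \<open>The Poisson equation\<close>

context random_maps
begin

lemma map_measurable_pair:
  assumes "sets \<nu> = sets borel"
  shows "(\<lambda>z. f (fst z) (snd z)) \<in> \<mu> \<Otimes>\<^sub>M \<nu> \<rightarrow>\<^sub>M borel"
proof (rule borel_measurable_caratheodory[OF separable, where g="\<lambda>z. f (fst z)"])
  show "snd \<in> \<mu> \<Otimes>\<^sub>M \<nu> \<rightarrow>\<^sub>M borel" using measurable_snd[of \<mu> \<nu>] assms by (simp cong: measurable_cong_sets)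
  show "(\<lambda>z. f (fst z) y) \<in> borel_measurable (\<mu> \<Otimes>\<^sub>M \<nu>)" for y
    by (rule measurable_compose[OF measurable_fst measurable_map])
  show "continuous_on UNIV (f (fst z))" if "z \<in> space (\<mu> \<Otimes>\<^sub>M \<nu>)" for z
    using that by (intro continuous_map) (auto simp: space_pair_measure)
qed

lemma stationary_integral:
  fixes \<phi> :: "'b \<Rightarrow> 'c::{banach,second_countable_topology}"
  assumes st: "stationary f \<mu> \<nu>" and c: "continuous_on UNIV \<phi>" and b: "\<And>x. norm (\<phi> x) \<le> C"
  shows "(\<integral>x. markov_op \<phi> x \<partial>\<nu>) = (\<integral>x. \<phi> x \<partial>\<nu>)"
proof -
  interpret nu: prob_space \<nu> using st by (simp add: stationary_def)
  interpret P: pair_prob_space \<mu> \<nu> by unfold_locales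
  have sets: "sets \<nu> = sets borel" using st by (simp add: stationary_def)
  then have sp: "space \<nu> = UNIV" using sets_eq_imp_space_eq by fastforce
  note m = map_measurable_pair[OF sets]
  have m1: "f i \<in> \<nu> \<rightarrow>\<^sub>M borel" if "i \<in> space \<mu>" for i
    using borel_measurable_continuous_onI[OF continuous_map[OF that]] sets by (simp cong: measurable_cong_sets)
  have cm: "\<phi> \<in> borel_measurable borel" by (rule borel_measurable_continuous_onI[OF c])
  \<comment> \<open>Stationarity says that \<nu> is the law of \<open>f i x\<close> under the
    product of \<mu> and \<nu>; after this the claim is Fubini.\<close>
  have d: "\<nu> = distr (\<mu> \<Otimes>\<^sub>M \<nu>) borel (\<lambda>z. f (fst z) (snd z))"
  proof (rule measure_eqI)
    fix A assume "A \<in> sets \<nu>"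
    then have A: "A \<in> sets borel" using sets by simp
    have "emeasure \<nu> A = (\<integral>\<^sup>+ i. emeasure (distr \<nu> borel (f i)) A \<partial>\<mu>)"
      using st A by (simp add: stationary_def)
    also have "\<dots> = (\<integral>\<^sup>+ i. emeasure \<nu> (Pair i -` ((\<lambda>z. f (fst z) (snd z)) -` A \<inter> space (\<mu> \<Otimes>\<^sub>M \<nu>))) \<partial>\<mu>)"
    proof (rule nn_integral_cong)
      fix i assume i: "i \<in> space \<mu>"
      have "Pair i -` ((\<lambda>z. f (fst z) (snd z)) -` A \<inter> space (\<mu> \<Otimes>\<^sub>M \<nu>)) = f i -` A \<inter> space \<nu>"
        using i by (auto simp: space_pair_measure)
      then show "emeasure (distr \<nu> borel (f i)) A = emeasure \<nu> (Pair i -` ((\<lambda>z. f (fst z) (snd z)) -` A \<inter> space (\<mu> \<Otimes>\<^sub>M \<nu>)))"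
        by (simp add: emeasure_distr[OF m1[OF i] A])
    qed
    also have "\<dots> = emeasure (\<mu> \<Otimes>\<^sub>M \<nu>) ((\<lambda>z. f (fst z) (snd z)) -` A \<inter> space (\<mu> \<Otimes>\<^sub>M \<nu>))"
      by (rule nu.emeasure_pair_measure_alt[symmetric]) (rule measurable_sets[OF m A])
    also have "\<dots> = emeasure (distr (\<mu> \<Otimes>\<^sub>M \<nu>) borel (\<lambda>z. f (fst z) (snd z))) A"
      by (rule emeasure_distr[OF m A, symmetric])
    finally show "emeasure \<nu> A = emeasure (distr (\<mu> \<Otimes>\<^sub>M \<nu>) borel (\<lambda>z. f (fst z) (snd z))) A" .
  qed (simp add: sets)
  have int: "integrable (\<mu> \<Otimes>\<^sub>M \<nu>) (\<lambda>z. \<phi> (f (fst z) (snd z)))"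
    by (rule P.P.integrable_const_bound[where B=C]) (auto intro: b measurable_compose[OF m cm])
  have "(\<integral>x. \<phi> x \<partial>\<nu>) = (\<integral>z. \<phi> (f (fst z) (snd z)) \<partial>(\<mu> \<Otimes>\<^sub>M \<nu>))"
    by (subst d, rule integral_distr[OF m cm])
  also have "\<dots> = (\<integral>x. (\<integral>i. \<phi> (f i x) \<partial>\<mu>) \<partial>\<nu>)"
    using P.integral_snd[of "\<lambda>i x. \<phi> (f i x)"] int by (simp add: case_prod_beta')
  finally show ?thesis by (simp add: markov_op_def)
qed

lemma stationary_integral_pow:
  fixes \<phi> :: "'b \<Rightarrow> 'c::{banach,second_countable_topology}"
  assumes st: "stationary f \<mu> \<nu>" and c: "continuous_on UNIV \<phi>" and b: "\<And>x. norm (\<phi> x) \<le> C"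
  shows "(\<integral>x. (markov_op ^^ n) \<phi> x \<partial>\<nu>) = (\<integral>x. \<phi> x \<partial>\<nu>)"
  by (induction n) (simp_all add: stationary_integral[OF st markov_pow_continuous[OF c b] markov_pow_bound[OF c b]])

end

lemma stationary_integrable:
  fixes \<phi> :: "'a::metric_space \<Rightarrow> 'c::{banach,second_countable_topology}"
  assumes "stationary f \<mu> \<nu>" "continuous_on UNIV \<phi>" "\<And>x. norm (\<phi> x) \<le> C"
  shows "integrable \<nu> \<phi>"
proof -
  interpret nu: prob_space \<nu> using assms(1) by (simp add: stationary_def)
  show ?thesis
    using assms borel_measurable_continuous_onI[OF assms(2)]
    by (intro nu.integrable_const_bound[where B=C]) (auto simp: stationary_def cong: measurable_cong_sets)
qed

context dist_power
begin

text \<open>Stationarity writes the n-th term as an average over y of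
  \<open>(markov_op ^^ n) h x - (markov_op ^^ n) h y\<close>, dominated by the expected power of the
  distance at time n. Hence the series converges absolutely at each point with bounded partial sums.
  Uniform convergence is not shown: continuity of the limit comes from equicontinuity of the partial
  sums.\<close>

theorem poisson_equation:
  fixes h :: "'a \<Rightarrow> real"
  assumes st: "stationary f \<mu> \<nu>" and C: "0 \<le> C" and h: "\<And>x y. \<bar>h x - h y\<bar> \<le> C * dist x y powr \<alpha>"
  shows "\<exists>g. continuous_on UNIV g \<and> (\<forall>x. h x - (\<integral>y. h y \<partial>\<nu>) = g x - markov_op g x)"
proof -
  interpret nu: prob_space \<nu> using st by (simp add: stationary_def)
  have hd: "\<bar>h x - h y\<bar> \<le> C * dpow (x, y)" for x y using h by (simp add: dpow_def)
  have hc: "continuous_on UNIV h"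
    unfolding continuous_on_sequentially comp_def
  proof safe
    fix X x assume X: "(X :: nat \<Rightarrow> 'a) \<longlonglongrightarrow> x"
    have "(\<lambda>n. C * dist (X n) x powr \<alpha>) \<longlonglongrightarrow> C * dist x x powr \<alpha>"
      using alpha_pos by (intro tendsto_intros X tendsto_powr') auto
    then have "(\<lambda>n. C * dist (X n) x powr \<alpha>) \<longlonglongrightarrow> 0" by simp
    then have "(\<lambda>n. h (X n) - h x) \<longlonglongrightarrow> 0"
      by (rule Lim_null_comparison[rotated]) (auto intro: always_eventually h)
    then show "(\<lambda>n. h (X n)) \<longlonglongrightarrow> h x" by (simp add: LIM_zero_iff)
  qed
  obtain H where "0 < H" and H: "\<And>x. norm (h x) \<le> H" by (rule compact_continuous_bounded[OF compact_space hc]) blast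
  note pc = markov_pow_continuous[OF hc H] and pb = markov_pow_bound[OF hc H] and pe = markov_pow_eq[OF hc H]
  obtain B where "\<forall>n z. dsum n z \<le> B" by (rule dsum_uniform_bound)
  then have B: "dsum n z \<le> B" for n z by blast
  have diff: "\<bar>(markov_op ^^ n) h x - (markov_op ^^ n) h y\<bar> \<le> C * (pair.markov_op ^^ n) dpow (x, y)" for n x y
  proof -
    have "\<bar>(markov_op ^^ n) h x - (markov_op ^^ n) h y\<bar> = \<bar>\<integral>\<omega>. h (rds_iter f \<omega> n x) - h (rds_iter f \<omega> n y) \<partial>\<Omega>\<bar>"
      unfolding pe by (subst Bochner_Integration.integral_diff) (auto intro: integrable_iter[OF hc H])
    also have "\<dots> \<le> (\<integral>\<omega>. \<bar>h (rds_iter f \<omega> n x) - h (rds_iter f \<omega> n y)\<bar> \<partial>\<Omega>)" by (rule integral_abs_bound)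
    also have "\<dots> \<le> (\<integral>\<omega>. C * dpow (rds_iter (pair_map f) \<omega> n (x, y)) \<partial>\<Omega>)"
      by (intro integral_mono integrable_abs Bochner_Integration.integrable_diff integrable_mult_right
           pair.integrable_iter[OF dpow_continuous dmax(2)] integrable_iter[OF hc H])
         (simp add: rds_iter_pair_map hd)
    finally show ?thesis by (simp add: dpow_pow_eq)
  qed
  define u where "u n x = (markov_op ^^ n) h x - (\<integral>y. h y \<partial>\<nu>)" for n x
  define G where "G m x = (\<Sum>n<m. u n x)" for m x
  have uc: "continuous_on UNIV (u n)" for n unfolding u_def[abs_def] by (intro continuous_intros pc)
  have Gc: "continuous_on UNIV (G m)" for m unfolding G_def[abs_def] by (intro continuous_intros uc)
  have pi: "integrable \<nu> ((markov_op ^^ n) h)" for n by (rule stationary_integrable[OF st pc pb])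
  have abs_sum: "(\<Sum>n<m. \<bar>u n x\<bar>) \<le> C * B" for m x
  proof -
    have slc: "continuous_on UNIV (\<lambda>y. \<phi> (x, y))" if "continuous_on UNIV \<phi>" for \<phi> :: "'a \<times> 'a \<Rightarrow> real"
      by (rule continuous_on_compose2[OF that]) (auto intro!: continuous_intros)
    have di: "integrable \<nu> (\<lambda>y. (pair.markov_op ^^ n) dpow (x, y))" for n
      by (rule stationary_integrable[OF st slc[OF dpow_pow_continuous] dpow_pow_bound])
    have "\<bar>u n x\<bar> \<le> (\<integral>y. C * (pair.markov_op ^^ n) dpow (x, y) \<partial>\<nu>)" for n
    proof -
      have "u n x = (\<integral>y. (markov_op ^^ n) h x - (markov_op ^^ n) h y \<partial>\<nu>)"
        using pi by (simp add: u_def stationary_integral_pow[OF st hc H] nu.prob_space)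
      also have "\<bar>\<dots>\<bar> \<le> (\<integral>y. \<bar>(markov_op ^^ n) h x - (markov_op ^^ n) h y\<bar> \<partial>\<nu>)" by (rule integral_abs_bound)
      also have "\<dots> \<le> (\<integral>y. C * (pair.markov_op ^^ n) dpow (x, y) \<partial>\<nu>)"
        using pi di diff by (intro integral_mono integrable_abs) auto
      finally show ?thesis .
    qed
    then have "(\<Sum>n<m. \<bar>u n x\<bar>) \<le> (\<Sum>n<m. \<integral>y. C * (pair.markov_op ^^ n) dpow (x, y) \<partial>\<nu>)" by (rule sum_mono)
    also have "\<dots> = (\<integral>y. C * dsum m (x, y) \<partial>\<nu>)"
      using di by (simp add: dsum_def Bochner_Integration.integral_sum sum_distrib_left)
    also have "\<dots> \<le> (\<integral>y. C * B \<partial>\<nu>)"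
      using C B stationary_integrable[OF st slc[OF dsum_continuous] dsum_bound, of m]
      by (intro integral_mono) (auto intro: mult_left_mono)
    finally show ?thesis by (simp add: nu.prob_space)
  qed
  have Gb: "norm (G m x) \<le> C * B" for m x
    unfolding G_def real_norm_def by (rule order_trans[OF sum_abs abs_sum])
  have "summable (\<lambda>n. u n x)" for x
    by (rule summable_rabs_cancel, rule bounded_imp_summable[where B="C * B"])
       (use abs_sum[of x "Suc _"] in \<open>auto simp: lessThan_Suc_atMost\<close>)
  then have Gl: "(\<lambda>m. G m x) \<longlonglongrightarrow> (\<Sum>n. u n x)" for x
    unfolding G_def by (rule summable_LIMSEQ)
  define g where "g x = (\<Sum>n. u n x)" for x
  note Gl = Gl[folded g_def]
  have Gd: "\<bar>G m x - G m y\<bar> \<le> C * dsum m (x, y)" for m x y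
  proof -
    have "\<bar>G m x - G m y\<bar> \<le> (\<Sum>n<m. \<bar>u n x - u n y\<bar>)"
      unfolding G_def sum_subtractf[symmetric] by (rule sum_abs)
    also have "\<dots> \<le> (\<Sum>n<m. C * (pair.markov_op ^^ n) dpow (x, y))"
      using diff by (intro sum_mono) (simp add: u_def)
    finally show ?thesis by (simp add: dsum_def sum_distrib_left)
  qed
  \<comment> \<open>By \<open>Gd\<close> and \<open>dsum_small\<close> the modulus of continuity of
    \<open>G m\<close> does not depend on m and survives the pointwise limit.\<close>
  have gc: "continuous_on UNIV g"
    unfolding continuous_on_iff
  proof (intro ballI allI impI)
    fix x and e :: real assume e: "0 < e"
    obtain d where d: "0 < d" "\<forall>n z. dist (fst z) (snd z) < d \<longrightarrow> dsum n z \<le> e / (2 * (C + 1))"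
      using dsum_small[of "e / (2 * (C + 1))"] e C by auto
    have "dist (g y) (g x) < e" if "dist y x < d" for y
    proof -
      have "\<bar>G m y - G m x\<bar> \<le> e / 2" for m
      proof -
        have "\<bar>G m y - G m x\<bar> \<le> C * dsum m (y, x)" by (rule Gd)
        also have "\<dots> \<le> C * (e / (2 * (C + 1)))" using d(2) that C by (intro mult_left_mono) auto
        also have "\<dots> \<le> e / 2" using C e by (simp add: field_simps)
        finally show ?thesis .
      qed
      moreover have "(\<lambda>m. \<bar>G m y - G m x\<bar>) \<longlonglongrightarrow> \<bar>g y - g x\<bar>" by (intro tendsto_intros Gl)
      ultimately have "\<bar>g y - g x\<bar> \<le> e / 2" by (intro LIMSEQ_le_const2[of _ "\<bar>g y - g x\<bar>"]) auto
      then show ?thesis using e by (simp add: dist_real_def)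
    qed
    then show "\<exists>d>0. \<forall>x'\<in>UNIV. dist x' x < d \<longrightarrow> dist (g x') (g x) < e" using d(1) by blast
  qed
  have "h x - (\<integral>y. h y \<partial>\<nu>) = g x - markov_op g x" for x
  proof -
    have "(\<lambda>m. \<integral>i. G m (f i x) \<partial>\<mu>) \<longlonglongrightarrow> (\<integral>i. g (f i x) \<partial>\<mu>)"
      using Gb Gl by (intro integral_dominated_convergence[where w="\<lambda>_. C * B"])
        (auto intro: measurable_continuous_map Gc gc)
    \<comment> \<open>The operator shifts the series by one term, so only the term at time 0 is
      lost.\<close>
    moreover have "(\<integral>i. G m (f i x) \<partial>\<mu>) = G (Suc m) x - (h x - (\<integral>y. h y \<partial>\<nu>))" for m
    proof -
      have "(\<integral>i. u n (f i x) \<partial>\<mu>) = u (Suc n) x" for n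
        using integrable_map[OF pc pb, of n] by (simp add: u_def prob_space markov_op_def[of "(markov_op ^^ n) h"])
      moreover have "integrable \<mu> (\<lambda>i. u n (f i x))" for n
        using integrable_map[OF pc pb, of n] by (simp add: u_def)
      ultimately have "(\<integral>i. G m (f i x) \<partial>\<mu>) = (\<Sum>n<m. u (Suc n) x)"
        by (simp add: G_def Bochner_Integration.integral_sum)
      also have "\<dots> = G (Suc m) x - u 0 x" unfolding G_def sum.lessThan_Suc_shift by simp
      finally show ?thesis by (simp add: u_def)
    qed
    ultimately have "(\<lambda>m. G (Suc m) x - (h x - (\<integral>y. h y \<partial>\<nu>))) \<longlonglongrightarrow> markov_op g x"
      by (simp add: markov_op_def)
    moreover have "(\<lambda>m. G (Suc m) x - (h x - (\<integral>y. h y \<partial>\<nu>))) \<longlonglongrightarrow> g x - (h x - (\<integral>y. h y \<partial>\<nu>))"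
      by (intro tendsto_intros LIMSEQ_Suc Gl)
    ultimately have "markov_op g x = g x - (h x - (\<integral>y. h y \<partial>\<nu>))" by (rule LIMSEQ_unique)
    then show ?thesis by simp
  qed
  with gc show ?thesis by blast
qed

end

text \<open>\<open>\<phi>\<close> is the infimal convolution of \<open>V\<close> with L times the
  distance, the largest L-Lipschitz minorant of \<open>V\<close>.\<close>

lemma lipschitz_approximation:
  fixes V :: "'a::metric_space \<Rightarrow> real"
  assumes cpt: "compact (UNIV :: 'a set)" and V: "continuous_on UNIV V" and \<epsilon>: "0 < \<epsilon>"
  obtains L \<phi> where "0 \<le> L" "\<forall>x y. \<bar>\<phi> x - \<phi> y\<bar> \<le> L * dist x y" "\<forall>x. \<bar>V x - \<phi> x\<bar> \<le> \<epsilon>"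
proof -
  obtain K where K: "0 < K" "\<And>x. norm (V x) \<le> K" by (rule compact_continuous_bounded[OF cpt V]) blast
  have "uniformly_continuous_on UNIV V" by (rule compact_uniformly_continuous[OF V cpt])
  then obtain d where d: "d > 0" "\<And>x y. dist x y < d \<Longrightarrow> dist (V x) (V y) < \<epsilon>"
    using \<epsilon> unfolding uniformly_continuous_on_def by (metis UNIV_I)
  \<comment> \<open>With this slope the penalty at distance d equals 2 K, a bound for the
    oscillation of \<open>V\<close>, so only points within the modulus of continuity can lower the
    infimum.\<close>
  define L where "L = 2 * K / d"
  have L: "0 \<le> L" using K d by (simp add: L_def)
  define \<phi> where "\<phi> x = (INF y. V y + L * dist x y)" for x
  have Vb: "- K \<le> V y" "V y \<le> K" for y using K(2)[of y] by (auto simp: abs_le_iff)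
  have bdd: "bdd_below (range (\<lambda>y. V y + L * dist x y))" for x
    by (rule bdd_belowI[of _ "- K"]) (use Vb L in \<open>auto intro: add_increasing2\<close>)
  have up: "\<phi> x \<le> V y + L * dist x y" for x y
    unfolding \<phi>_def by (rule cINF_lower[OF bdd]) simp
  have low: "V x - \<epsilon> \<le> \<phi> x" for x
    unfolding \<phi>_def
  proof (rule cINF_greatest)
    fix y
    show "V x - \<epsilon> \<le> V y + L * dist x y"
    proof (cases "dist x y < d")
      case True
      have "0 \<le> L * dist x y" using L by simp
      then show ?thesis using d(2)[OF True] unfolding dist_real_def by linarith
    next
      case False
      then have "L * d \<le> L * dist x y" using L by (intro mult_left_mono) auto
      moreover have "L * d = 2 * K" using d by (simp add: L_def)
      ultimately show ?thesis using Vb[of x] Vb[of y] \<epsilon> by linarith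
    qed
  qed simp
  have lip: "\<phi> x - \<phi> y \<le> L * dist x y" for x y
  proof -
    have "\<phi> x - L * dist x y \<le> \<phi> y"
      unfolding \<phi>_def[of y]
    proof (rule cINF_greatest)
      fix z
      have "L * dist x z \<le> L * (dist x y + dist y z)" using L by (intro mult_left_mono dist_triangle) auto
      then show "\<phi> x - L * dist x y \<le> V z + L * dist y z" using up[of x z] by (simp add: distrib_left)
    qed simp
    then show ?thesis by simp
  qed
  show ?thesis
  proof (rule that[OF L])
    show "\<forall>x y. \<bar>\<phi> x - \<phi> y\<bar> \<le> L * dist x y" using lip by (metis abs_le_iff dist_commute minus_diff_eq)
    show "\<forall>x. \<bar>V x - \<phi> x\<bar> \<le> \<epsilon>"
    proof
      fix x show "\<bar>V x - \<phi> x\<bar> \<le> \<epsilon>" using low[of x] up[of x x] \<epsilon> by (simp add: abs_le_iff)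
    qed
  qed
qed

text \<open>Evaluation at a point is continuous for the supremum distance, hence measurable for the
  pulled-back Borel sigma-algebra. The open ball around a map supplies the set required by
  \<open>support\<close>.\<close>

lemma contracting_maps_rds:
  fixes f :: "'i \<Rightarrow> 'a::metric_space \<Rightarrow> 'a"
  assumes cpt: "compact (UNIV :: 'a set)" and rds: "random_dynamical_system f \<mu>"
    and prox: "proximal f (space \<mu>)" and loc: "local_contraction f \<mu>"
  shows "contracting_maps \<mu> f"
proof -
  have ps: "prob_space \<mu>" and cont: "\<And>i. i \<in> space \<mu> \<Longrightarrow> continuous_on UNIV (f i)"
    and sets: "sets \<mu> = sets (vimage_algebra (space \<mu>) (\<lambda>i. Bcontfun (f i)) borel)"
    and supp: "index_support f \<mu> = space \<mu>"
    using rds by (auto simp: random_dynamical_system_def)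
  have Bm: "(\<lambda>i. Bcontfun (f i)) \<in> \<mu> \<rightarrow>\<^sub>M borel"
  proof -
    have "(\<lambda>i. Bcontfun (f i)) \<in> vimage_algebra (space \<mu>) (\<lambda>i. Bcontfun (f i)) borel \<rightarrow>\<^sub>M borel"
      by (rule measurable_vimage_algebra1) simp
    then show ?thesis using sets by (simp cong: measurable_cong_sets)
  qed
  \<comment> \<open>\<open>Bcontfun\<close> represents its argument faithfully only if that is
    bounded and continuous; compactness gives boundedness.\<close>
  have ap: "apply_bcontfun (Bcontfun (f i)) = f i" if "i \<in> space \<mu>" for i
  proof (rule Bcontfun_inverse)
    have "bounded (range (f i))" using compact_imp_bounded[OF cpt] bounded_subset by blast
    then show "f i \<in> bcontfun" using cont[OF that] by (simp add: bcontfun_def)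
  qed
  interpret prob_space \<mu> by fact
  show ?thesis
  proof (unfold_locales)
    show "(\<lambda>i. f i x) \<in> \<mu> \<rightarrow>\<^sub>M borel" for x
    proof -
      have "continuous_on UNIV (\<lambda>F :: 'a \<Rightarrow>\<^sub>C 'a. apply_bcontfun F x)"
        unfolding continuous_on_iff by (metis dist_bounded order_le_less_trans)
      then have "(\<lambda>i. apply_bcontfun (Bcontfun (f i)) x) \<in> \<mu> \<rightarrow>\<^sub>M borel"
        by (intro measurable_compose[OF Bm] borel_measurable_continuous_onI)
      then show ?thesis by (simp add: ap cong: measurable_cong)
    qed
    show "\<exists>A\<in>sets \<mu>. 0 < measure \<mu> A \<and> (\<forall>j\<in>A. \<forall>x. dist (f j x) (f i x) < e)"
      if i: "i \<in> space \<mu>" and e: "0 < e" for i e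
    proof (rule bexI[of _ "{j \<in> space \<mu>. Bcontfun (f j) \<in> ball (Bcontfun (f i)) e}"])
      have "i \<in> index_support f \<mu>" using i supp by simp
      then have "emeasure \<mu> {j \<in> space \<mu>. Bcontfun (f j) \<in> ball (Bcontfun (f i)) e} > 0"
        using e unfolding index_support_def by (auto dest!: spec[of _ "ball (Bcontfun (f i)) e"])
      then show "0 < measure \<mu> {j \<in> space \<mu>. Bcontfun (f j) \<in> ball (Bcontfun (f i)) e} \<and>
        (\<forall>j\<in>{j \<in> space \<mu>. Bcontfun (f j) \<in> ball (Bcontfun (f i)) e}. \<forall>x. dist (f j x) (f i x) < e)"
        using dist_bounded[of "Bcontfun (f i)" _ "Bcontfun (f _)"] ap i
        by (auto simp: emeasure_eq_measure dist_commute) (metis dist_bounded dist_commute order_le_less_trans)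
      show "{j \<in> space \<mu>. Bcontfun (f j) \<in> ball (Bcontfun (f i)) e} \<in> sets \<mu>"
        using measurable_sets[OF Bm, of "ball (Bcontfun (f i)) e"] by (simp add: vimage_def Int_def conj_commute)
    qed
  qed (use cont prox loc cpt separable_compact in auto)
qed

section \<open>Exponential supermartingales and the upper half of the law of the iterated logarithm\<close>

text \<open>The factor \<theta> may be as close to 1 as desired at the price of a small range; a
  fixed larger factor would spoil the constant in the law of the iterated logarithm.\<close>

lemma exp_le_quadratic:
  fixes \<theta> :: real assumes "1 < \<theta>"
  obtains y0 where "0 < y0" "\<forall>y. \<bar>y\<bar> \<le> y0 \<longrightarrow> exp y \<le> 1 + y + \<theta> * y\<^sup>2 / 2"
proof -
  have "\<forall>\<^sub>F y in at_right 0. exp y \<le> 1 + y + \<theta> * y\<^sup>2 / 2" using assms by real_asymp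
  moreover have "\<forall>\<^sub>F y in at_left 0. exp y \<le> 1 + y + \<theta> * y\<^sup>2 / 2" using assms by real_asymp
  ultimately have "\<forall>\<^sub>F y in at 0. exp y \<le> 1 + y + \<theta> * y\<^sup>2 / 2" by (simp add: eventually_at_split)
  then obtain d where "d > 0" "\<And>y. y \<noteq> 0 \<Longrightarrow> dist y 0 < d \<Longrightarrow> exp y \<le> 1 + y + \<theta> * y\<^sup>2 / 2"
    unfolding eventually_at by blast
  then have "exp y \<le> 1 + y + \<theta> * y\<^sup>2 / 2" if "\<bar>y\<bar> \<le> d / 2" for y
    using that by (cases "y = 0") (auto simp: dist_real_def)
  then show ?thesis using \<open>d > 0\<close> by (intro that[of "d / 2"]) auto
qed

text \<open>For n \<le> 2 the value is zero or negative by the conventions for \<open>ln\<close> and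
  \<open>sqrt\<close>, so all uses are for large n.\<close>

definition lil_scale :: "nat \<Rightarrow> real" where
  "lil_scale n = sqrt (2 * real n * ln (ln (real n)))"

lemma lil_scale_pos: "\<forall>\<^sub>F n in sequentially. 0 < lil_scale n"
  unfolding lil_scale_def by real_asymp

lemma lil_scale_sublinear: "(\<lambda>n. lil_scale n / real n) \<longlonglongrightarrow> 0"
  unfolding lil_scale_def by real_asymp

section \<open>Additive functionals and a maximal inequality\<close>

context random_maps
begin

definition cocycle :: "('i \<Rightarrow> 'b \<Rightarrow> real) \<Rightarrow> bool" where
  "cocycle a \<longleftrightarrow> (\<forall>x. (\<lambda>i. a i x) \<in> borel_measurable \<mu>) \<and> (\<forall>i\<in>space \<mu>. continuous_on UNIV (a i))"

text \<open>The increment at time k sees the letter \<open>\<omega> k\<close> and the state before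
  that letter acts. A function of the state alone is covered by ignoring the letter, as in
  \<open>\<lambda>_. cond_var g\<close>.\<close>

definition addf :: "('i \<Rightarrow> 'b \<Rightarrow> real) \<Rightarrow> nat \<Rightarrow> 'b \<Rightarrow> (nat \<Rightarrow> 'i) \<Rightarrow> real" where
  "addf a n x \<omega> = (\<Sum>k<n. a (\<omega> k) (rds_iter f \<omega> k x))"

lemma addf_measurable:
  assumes "cocycle a" shows "(\<lambda>\<omega>. addf a n x \<omega>) \<in> borel_measurable \<Omega>"
  unfolding addf_def
proof (rule borel_measurable_sum)
  fix k
  show "(\<lambda>\<omega>. a (\<omega> k) (rds_iter f \<omega> k x)) \<in> borel_measurable \<Omega>"
    using assms
    by (intro borel_measurable_caratheodory[where g="\<lambda>\<omega>. a (\<omega> k)", OF separable rds_iter_measurable])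
       (auto simp: cocycle_def intro: measurable_compose[OF measurable_component_Omega] component_in_space)
qed

lemma addf_0 [simp]: "addf a 0 x \<omega> = 0"
  by (simp add: addf_def)

lemma addf_case_nat: "addf a (Suc n) x (case_nat i \<omega>) = a i x + addf a n (f i x) \<omega>"
  unfolding addf_def sum.lessThan_Suc_shift by (simp add: rds_iter_case_nat del: rds_iter.simps(2))

lemma addf_cong: "(\<And>k. k < n \<Longrightarrow> \<omega> k = \<omega>' k) \<Longrightarrow> addf a n x \<omega> = addf a n x \<omega>'"
  unfolding addf_def by (intro sum.cong refl arg_cong2[where f=a] rds_iter_cong) auto

lemma addf_comb_seq_le: "k \<le> n \<Longrightarrow> addf a k x (comb_seq n \<omega> \<omega>') = addf a k x \<omega>"
  by (rule addf_cong) (auto simp: comb_seq_def)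

lemma addf_comb_seq: "addf a (n + k) x (comb_seq n \<omega> \<omega>') = addf a n x \<omega> + addf a k (rds_iter f \<omega> n x) \<omega>'"
proof (induction k)
  case (Suc k)
  have "comb_seq n \<omega> \<omega>' (n + k) = \<omega>' k" by (simp add: comb_seq_def)
  with Suc show ?case by (simp add: addf_def rds_iter_comb_seq)
qed (simp add: addf_comb_seq_le)

definition reaches :: "('i \<Rightarrow> 'b \<Rightarrow> real) \<Rightarrow> real \<Rightarrow> nat \<Rightarrow> 'b \<Rightarrow> (nat \<Rightarrow> 'i) \<Rightarrow> bool" where
  "reaches a s n x \<omega> \<longleftrightarrow> (\<exists>k<n. s \<le> addf a k x \<omega>)"

lemma reaches_measurable:
  assumes "cocycle a" shows "Measurable.pred \<Omega> (reaches a s n x)"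
proof -
  note [measurable] = addf_measurable[OF assms]
  show ?thesis unfolding reaches_def[abs_def] by measurable
qed

lemma reaches_case_nat:
  assumes "0 < s" shows "reaches a s (Suc n) x (case_nat i \<omega>) = reaches a (s - a i x) n (f i x) \<omega>"
  unfolding reaches_def Ex_less_Suc2 using assms by (simp add: addf_case_nat algebra_simps)

text \<open>The maximal inequality for the nonnegative supermartingale \<open>exp (addf a k x)\<close>.\<close>

lemma addf_maximal_finite:
  assumes a: "cocycle a" and int: "\<And>x. integrable \<mu> (\<lambda>i. exp (a i x))" and le: "\<And>x. (\<integral>i. exp (a i x) \<partial>\<mu>) \<le> 1"
  shows "\<Omega>.prob {\<omega> \<in> space \<Omega>. reaches a s n x \<omega>} \<le> exp (- s)"
proof (induction n arbitrary: s x)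
  case (Suc n)
  show ?case
  proof (cases "s \<le> 0")
    case True
    then have "1 \<le> exp (- s)" by simp
    then show ?thesis using \<Omega>.prob_le_1 order_trans by blast
  next
    case False
    \<comment> \<open>As s > 0, level s is not reached at time 0. After the first letter the
      remaining level is \<open>s - a i x\<close>, so the induction hypothesis gives
      \<open>exp (- s) * exp (a i x)\<close>, whose mean is at most
      \<open>exp (- s)\<close>.\<close>
    then have eqv: "reaches a s (Suc n) x (case_nat i \<omega>) = reaches a (s - a i x) n (f i x) \<omega>" for i \<omega>
      by (intro reaches_case_nat) simp
    note pred = reaches_measurable[OF a, of s "Suc n" x]
    let ?P = "\<lambda>i. \<Omega>.prob {\<omega> \<in> space \<Omega>. reaches a (s - a i x) n (f i x) \<omega>}"
    have "\<Omega>.prob {\<omega> \<in> space \<Omega>. reaches a s (Suc n) x \<omega>} = (\<integral>i. ?P i \<partial>\<mu>)"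
      using prob_shift(1)[OF pred] by (simp only: eqv)
    also have "\<dots> \<le> (\<integral>i. exp (- s) * exp (a i x) \<partial>\<mu>)"
    proof (rule integral_mono)
      have "?P \<in> borel_measurable \<mu>"
        using prob_shift(2)[OF pred] by (simp only: eqv)
      then show "integrable \<mu> ?P" by (intro integrable_const_bound[where B=1]) auto
      show "integrable \<mu> (\<lambda>i. exp (- s) * exp (a i x))" using int by simp
      show "?P i \<le> exp (- s) * exp (a i x)" for i
        using Suc[of "s - a i x" "f i x"] by (simp add: exp_add[symmetric] algebra_simps)
    qed
    also have "\<dots> \<le> exp (- s) * 1" using le[of x] int by simp
    finally show ?thesis by simp
  qed
qed (simp add: reaches_def)

lemma addf_maximal:
  assumes a: "cocycle a" and int: "\<And>x. integrable \<mu> (\<lambda>i. exp (a i x))" and le: "\<And>x. (\<integral>i. exp (a i x) \<partial>\<mu>) \<le> 1"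
  shows "\<Omega>.prob {\<omega> \<in> space \<Omega>. \<exists>k. s \<le> addf a k x \<omega>} \<le> exp (- s)"
proof -
  let ?A = "\<lambda>n. {\<omega> \<in> space \<Omega>. reaches a s n x \<omega>}"
  have "(\<lambda>n. \<Omega>.prob (?A n)) \<longlonglongrightarrow> \<Omega>.prob (\<Union>n. ?A n)"
  proof (rule \<Omega>.finite_Lim_measure_incseq)
    show "incseq ?A" by (rule incseq_SucI) (auto simp: reaches_def intro: less_SucI)
    have "?A n \<in> sets \<Omega>" for n using reaches_measurable[OF a, of s n x] by measurable
    then show "range ?A \<subseteq> sets \<Omega>" by blast
  qed
  then have "\<Omega>.prob (\<Union>n. ?A n) \<le> exp (- s)"
    by (rule LIMSEQ_le_const2) (auto intro: addf_maximal_finite[OF assms])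
  also have "(\<Union>n. ?A n) = {\<omega> \<in> space \<Omega>. \<exists>k. s \<le> addf a k x \<omega>}" by (auto simp: reaches_def)
  finally show ?thesis .
qed

section \<open>The martingale attached to an observable\<close>

definition mart_diff :: "('b \<Rightarrow> real) \<Rightarrow> 'i \<Rightarrow> 'b \<Rightarrow> real" where
  "mart_diff g i x = g (f i x) - markov_op g x"

text \<open>The function called V in the overview.\<close>

definition cond_var :: "('b \<Rightarrow> real) \<Rightarrow> 'b \<Rightarrow> real" where
  "cond_var g x = (\<integral>i. (mart_diff g i x)\<^sup>2 \<partial>\<mu>)"

abbreviation mart :: "('b \<Rightarrow> real) \<Rightarrow> nat \<Rightarrow> 'b \<Rightarrow> (nat \<Rightarrow> 'i) \<Rightarrow> real" where
  "mart g \<equiv> addf (mart_diff g)"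

text \<open>The martingale-coboundary decomposition: if \<open>g\<close> solves a Poisson equation,
  the sum on the right is a centred Birkhoff sum, which thus differs from the martingale by boundary
  terms only.\<close>

lemma mart_telescope:
  "mart g n x \<omega> = g (rds_iter f \<omega> n x) - g x + (\<Sum>k<n. g (rds_iter f \<omega> k x) - markov_op g (rds_iter f \<omega> k x))"
  by (induction n) (auto simp: addf_def mart_diff_def)

lemma markov_op_uminus: "markov_op (\<lambda>y. - g y :: real) x = - markov_op g x"
  by (simp add: markov_op_def)

lemma mart_uminus: "mart (\<lambda>y. - g y) n x \<omega> = - mart g n x \<omega>"
  by (simp add: addf_def mart_diff_def markov_op_uminus sum_negf[symmetric])

lemma cond_var_uminus: "cond_var (\<lambda>y. - g y) x = cond_var g x"
proof -
  have "mart_diff (\<lambda>y. - g y) i x = - mart_diff g i x" for i by (simp add: mart_diff_def markov_op_uminus)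
  then show ?thesis by (simp add: cond_var_def)
qed

end

locale bounded_observable = random_maps \<mu> f for \<mu> :: "'i measure" and f :: "'i \<Rightarrow> 'b::metric_space \<Rightarrow> 'b" +
  fixes g :: "'b \<Rightarrow> real" and G :: real
  assumes g_continuous: "continuous_on UNIV g" and g_bound: "\<And>x. norm (g x) \<le> G"
begin

lemma G_nonneg: "0 \<le> G"
  using order_trans[OF norm_ge_zero g_bound] by blast

lemma cocycle_mart_diff: "cocycle (mart_diff g)"
  unfolding cocycle_def mart_diff_def[abs_def]
proof (intro conjI allI ballI)
  show "(\<lambda>i. g (f i x) - markov_op g x) \<in> borel_measurable \<mu>" for x
    using measurable_continuous_map[OF g_continuous, of x] by simp
  show "continuous_on UNIV (\<lambda>x. g (f i x) - markov_op g x)" if "i \<in> space \<mu>" for i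
    by (intro continuous_intros continuous_on_compose2[OF g_continuous continuous_map[OF that]]
        markov_op_continuous[OF g_continuous g_bound]) auto
qed

lemma mart_diff_measurable[measurable]: "(\<lambda>i. mart_diff g i x) \<in> borel_measurable \<mu>"
  using cocycle_mart_diff by (simp add: cocycle_def)

lemma mart_diff_continuous: "i \<in> space \<mu> \<Longrightarrow> continuous_on UNIV (mart_diff g i)"
  using cocycle_mart_diff by (simp add: cocycle_def)

lemma mart_measurable[measurable]: "(\<lambda>\<omega>. mart g n x \<omega>) \<in> borel_measurable \<Omega>"
  by (rule addf_measurable[OF cocycle_mart_diff])

lemma mart_diff_bound: "\<bar>mart_diff g i x\<bar> \<le> 2 * G"
  using g_bound[of "f i x"] markov_op_bound[OF g_continuous g_bound, of x] unfolding mart_diff_def by simp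

lemma mart_diff_integrable: "integrable \<mu> (\<lambda>i. mart_diff g i x)"
  by (rule integrable_const_bound[where B="2 * G"]) (auto intro: mart_diff_bound)

lemma mart_diff_integral: "(\<integral>i. mart_diff g i x \<partial>\<mu>) = 0"
  using integrable_map[OF g_continuous g_bound] by (simp add: mart_diff_def prob_space markov_op_def)

lemma mart_diff_square: "(mart_diff g i x)\<^sup>2 \<le> 4 * G\<^sup>2"
  using abs_le_square_iff[of "mart_diff g i x" "2 * G"] mart_diff_bound[of i x] G_nonneg
  by (simp add: power_mult_distrib)

lemma mart_diff_square_integrable: "integrable \<mu> (\<lambda>i. (mart_diff g i x)\<^sup>2)"
  by (rule integrable_const_bound[where B="4 * G\<^sup>2"]) (auto intro: mart_diff_square)

lemma cond_var_nonneg: "0 \<le> cond_var g x"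
  by (simp add: cond_var_def)

lemma cond_var_bound: "norm (cond_var g x) \<le> 4 * G\<^sup>2"
proof -
  have "cond_var g x \<le> (\<integral>i. 4 * G\<^sup>2 \<partial>\<mu>)"
    unfolding cond_var_def by (intro integral_mono mart_diff_square_integrable mart_diff_square) simp
  then show ?thesis using cond_var_nonneg by (simp add: prob_space)
qed

lemma cond_var_continuous: "continuous_on UNIV (cond_var g)"
  unfolding cond_var_def[abs_def]
  by (rule continuous_on_integral_parameter[where C="4 * G\<^sup>2"])
     (auto intro!: finite_measure_axioms continuous_intros mart_diff_continuous mart_diff_square)

lemma mart_bound: "\<bar>mart g n x \<omega>\<bar> \<le> real n * (2 * G)"
proof -
  have "\<bar>mart g n x \<omega>\<bar> \<le> (\<Sum>k<n. 2 * G)"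
    unfolding addf_def by (intro order_trans[OF sum_abs] sum_mono mart_diff_bound)
  then show ?thesis by simp
qed

text \<open>In the quadratic bound for exp the linear term has mean zero and the quadratic one gives
  the conditional variance; \<open>1 + t \<le> exp t\<close> then puts the mean in the form that the
  compensator cancels.\<close>

lemma exponential_supermartingale:
  assumes "1 < \<theta>"
  obtains b where "0 < b" "\<forall>r x. 0 \<le> r \<longrightarrow> r \<le> b \<longrightarrow>
    (\<integral>i. exp (r * mart_diff g i x - \<theta> * r\<^sup>2 / 2 * cond_var g x) \<partial>\<mu>) \<le> 1"
proof -
  obtain y0 where y0: "0 < y0" "\<forall>y. \<bar>y\<bar> \<le> y0 \<longrightarrow> exp y \<le> 1 + y + \<theta> * y\<^sup>2 / 2"
    by (rule exp_le_quadratic[OF assms])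
  show ?thesis
  \<comment> \<open>Increments are bounded by 2 G, so this keeps the exponent within y0; the added 1
    covers G = 0.\<close>
  proof (intro that[of "y0 / (2 * G + 1)"] allI impI)
    fix r x assume l: "0 \<le> r" "r \<le> y0 / (2 * G + 1)"
    have small: "\<bar>r * mart_diff g i x\<bar> \<le> y0" for i
    proof -
      have "\<bar>r * mart_diff g i x\<bar> \<le> r * (2 * G + 1)"
        unfolding abs_mult using l(1) mart_diff_bound[of i x] by (simp add: mult_left_mono)
      also have "\<dots> \<le> y0" using l(2) G_nonneg by (simp add: field_simps)
      finally show ?thesis .
    qed
    have int: "integrable \<mu> (\<lambda>i. exp (r * mart_diff g i x))"
    proof (rule integrable_const_bound[where B="exp y0"])
      show "AE i in \<mu>. norm (exp (r * mart_diff g i x)) \<le> exp y0"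
        using small by (intro AE_I2) (simp add: abs_le_iff)
    qed measurable
    have "(\<integral>i. exp (r * mart_diff g i x) \<partial>\<mu>) \<le> (\<integral>i. 1 + r * mart_diff g i x + \<theta> * r\<^sup>2 / 2 * (mart_diff g i x)\<^sup>2 \<partial>\<mu>)"
    proof (rule integral_mono[OF int])
      show "integrable \<mu> (\<lambda>i. 1 + r * mart_diff g i x + \<theta> * r\<^sup>2 / 2 * (mart_diff g i x)\<^sup>2)"
        using mart_diff_integrable mart_diff_square_integrable by simp
      show "exp (r * mart_diff g i x) \<le> 1 + r * mart_diff g i x + \<theta> * r\<^sup>2 / 2 * (mart_diff g i x)\<^sup>2" for i
        using y0(2)[rule_format, OF small[of i]] by (simp add: power_mult_distrib mult.assoc)
    qed
    also have "\<dots> = 1 + \<theta> * r\<^sup>2 / 2 * cond_var g x"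
      using mart_diff_integrable mart_diff_square_integrable
      by (simp add: prob_space mart_diff_integral cond_var_def)
    also have "\<dots> \<le> exp (\<theta> * r\<^sup>2 / 2 * cond_var g x)" by (rule exp_ge_add_one_self)
    finally show "(\<integral>i. exp (r * mart_diff g i x - \<theta> * r\<^sup>2 / 2 * cond_var g x) \<partial>\<mu>) \<le> 1"
      using int by (simp add: exp_diff)
  qed (use y0 G_nonneg in simp)
qed

text \<open>Times are grouped by \<open>\<theta>^j \<le> n < \<theta>^(j+1)\<close>. One exponential
  parameter per group lets the maximal inequality control the whole group, and the first
  Borel-Cantelli lemma applies. The loss \<open>\<theta> ^ 3\<close> consists of \<theta>^2, where
  the \<theta> of the supermartingale meets the variance at the end of the group, and of \<theta>
  from comparing ln j with ln ln n.\<close>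

lemma lil_upper_theta:
  assumes v: "0 < v" and \<theta>: "1 < \<theta>"
    and avg: "AE \<omega> in \<Omega>. \<forall>\<^sub>F n in sequentially. addf (\<lambda>_. cond_var g) n x \<omega> \<le> v * real n"
  shows "AE \<omega> in \<Omega>. \<forall>\<^sub>F n in sequentially. mart g n x \<omega> \<le> \<theta> ^ 3 * sqrt v * lil_scale n"
proof -
  obtain b where l0: "0 < b" "\<forall>r x. 0 \<le> r \<longrightarrow> r \<le> b \<longrightarrow>
    (\<integral>i. exp (r * mart_diff g i x - \<theta> * r\<^sup>2 / 2 * cond_var g x) \<partial>\<mu>) \<le> 1"
    by (rule exponential_supermartingale[OF \<theta>])
  \<comment> \<open>Minimises \<open>ln j / l + l * v * \<theta>^j / 2\<close>, the bound for the
    martingale resulting from level ln j and accumulated variance \<open>v * \<theta>^j\<close>, up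
    to factors \<theta>.\<close>
  define l where "l j = sqrt (2 * ln (real j) / (v * \<theta> ^ j))" for j :: nat
  define a where "a j i y = l j * mart_diff g i y - \<theta> * (l j)\<^sup>2 / 2 * cond_var g y" for j i y
  have l_nonneg: "0 \<le> l j" for j using v \<theta> by (cases "j = 0") (auto simp: l_def)
  have "l \<longlonglongrightarrow> 0"
    unfolding l_def[abs_def] using v \<theta> by real_asymp
  then have l_small: "\<forall>\<^sub>F j in sequentially. l j \<le> b"
    using order_tendstoD(2)[of l 0 sequentially b] l0(1) by (auto elim: eventually_mono)
  have coc: "cocycle (a j)" for j
    unfolding cocycle_def a_def[abs_def]
    by (auto intro!: continuous_intros mart_diff_continuous cond_var_continuous)
  note [measurable] = addf_measurable[OF coc]
  have aint: "integrable \<mu> (\<lambda>i. exp (a j i y))" for j y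
  proof (rule integrable_const_bound[where B="exp (l j * (2 * G))"])
    show "AE i in \<mu>. norm (exp (a j i y)) \<le> exp (l j * (2 * G))"
    proof (rule AE_I2)
      fix i
      have "l j * mart_diff g i y \<le> l j * (2 * G)"
        using mart_diff_bound[of i y] l_nonneg[of j] by (intro mult_left_mono) auto
      moreover have "0 \<le> \<theta> * (l j)\<^sup>2 / 2 * cond_var g y" using \<theta> cond_var_nonneg by simp
      ultimately show "norm (exp (a j i y)) \<le> exp (l j * (2 * G))" by (simp add: a_def)
    qed
    have "(\<lambda>i. a j i y) \<in> borel_measurable \<mu>" using coc[of j] by (simp add: cocycle_def)
    then show "(\<lambda>i. exp (a j i y)) \<in> borel_measurable \<mu>" by measurable
  qed
  \<comment> \<open>The empty default covers the finitely many j for which \<open>l j\<close> is too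
    large for the supermartingale bound. The level \<theta> ln j makes the probability at most
    j^(-\<theta>), which is summable.\<close>
  define A where "A j = (if l j \<le> b then {\<omega> \<in> space \<Omega>. \<exists>k. \<theta> * ln (real j) \<le> addf (a j) k x \<omega>} else {})" for j
  have Ap: "\<Omega>.prob (A j) \<le> exp (- (\<theta> * ln (real j)))" for j
  proof (cases "l j \<le> b")
    case True
    then have "\<Omega>.prob {\<omega> \<in> space \<Omega>. \<exists>k. \<theta> * ln (real j) \<le> addf (a j) k x \<omega>} \<le> exp (- (\<theta> * ln (real j)))"
      using l0(2) l_nonneg[of j] by (intro addf_maximal[OF coc aint]) (simp add: a_def)
    then show ?thesis using True by (simp add: A_def)
  qed (simp add: A_def)
  have "AE \<omega> in \<Omega>. \<forall>\<^sub>F j in sequentially. \<omega> \<in> space \<Omega> - A j"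
  proof (rule borel_cantelli_AE1)
    show "A j \<in> sets \<Omega>" for j unfolding A_def by auto
    show "emeasure \<Omega> (A j) < \<infinity>" for j by (simp add: less_top[symmetric])
    show "summable (\<lambda>j. \<Omega>.prob (A j))"
    proof (rule summable_comparison_test_ev)
      show "summable (\<lambda>j. real j powr (- \<theta>))" using \<theta> by (simp add: summable_real_powr_iff)
      show "\<forall>\<^sub>F j in sequentially. norm (\<Omega>.prob (A j)) \<le> real j powr (- \<theta>)"
        using eventually_gt_at_top[of 0]
      proof eventually_elim
        case (elim j)
        then show ?case using Ap[of j] by (simp add: powr_def)
      qed
    qed
  qed
  then show ?thesis using avg
  proof eventually_elim
    case (elim \<omega>)
    have e1: "\<forall>\<^sub>F j in sequentially. \<forall>k. addf (a j) k x \<omega> < \<theta> * ln (real j)"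
      using elim(1) l_small
    proof eventually_elim
      case (elim j)
      then show ?case by (auto simp: A_def not_le)
    qed
    \<comment> \<open>Since \<open>\<theta> ^ j \<le> n\<close> gives
      \<open>j * ln \<theta> \<le> ln n\<close>, this bounds ln j by \<theta>^2 ln ln n: the two
      differ by an additive constant, which the factor absorbs.\<close>
    have e2: "\<forall>\<^sub>F j in sequentially. ln (real j) \<le> \<theta>\<^sup>2 * ln (real j * ln \<theta>) \<and> 1 < real j * ln \<theta> \<and> 0 < ln (real j)"
    proof -
      have \<theta>2: "1 < \<theta>\<^sup>2" using \<theta> by (simp add: one_less_power)
      have "0 < ln \<theta>" using \<theta> by simp
      then have "\<forall>\<^sub>F j in sequentially. ln (real j) \<le> \<theta>\<^sup>2 * ln (real j * ln \<theta>)"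
        using \<theta>2 by real_asymp
      moreover have "\<forall>\<^sub>F j in sequentially. 1 < real j * ln \<theta>" using \<open>0 < ln \<theta>\<close> by real_asymp
      moreover have "\<forall>\<^sub>F j in sequentially. 0 < ln (real j)" by real_asymp
      ultimately show ?thesis by eventually_elim simp
    qed
    obtain N where N: "\<And>n. n \<ge> N \<Longrightarrow> addf (\<lambda>_. cond_var g) n x \<omega> \<le> v * real n"
      using elim(2) unfolding eventually_sequentially by blast
    obtain j0 where j0: "\<And>j k. j \<ge> j0 \<Longrightarrow> addf (a j) k x \<omega> < \<theta> * ln (real j)"
      "\<And>j. j \<ge> j0 \<Longrightarrow> ln (real j) \<le> \<theta>\<^sup>2 * ln (real j * ln \<theta>) \<and> 1 < real j * ln \<theta> \<and> 0 < ln (real j)"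
      using eventually_conj[OF e1 e2] unfolding eventually_sequentially by blast
    show ?case
      unfolding eventually_sequentially
    proof (intro exI allI impI)
      fix n assume n: "max (max N 1) (nat \<lceil>\<theta> ^ j0\<rceil>) \<le> n"
      then have n': "N \<le> n" "1 \<le> n" "\<theta> ^ j0 \<le> real n" by linarith+
      define j where "j = nat \<lfloor>log \<theta> (real n)\<rfloor>"
      have lognn: "0 \<le> log \<theta> (real n)" using \<theta> n'(2) by simp
      have jlog: "real j \<le> log \<theta> (real n)" "log \<theta> (real n) < real (Suc j)"
        using lognn unfolding j_def by linarith+
      have jn: "\<theta> ^ j \<le> real n" using jlog(1) \<theta> n'(2) by (simp add: le_log_iff powr_realpow)
      have nj: "real n < \<theta> ^ Suc j"
        using jlog(2) \<theta> n'(2) powr_realpow[of \<theta> "Suc j"] by (simp add: log_less_iff)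
      have "\<theta> ^ j0 < \<theta> ^ Suc j" using n'(3) nj by linarith
      then have "j0 < Suc j" using \<theta> by (simp only: power_strict_increasing_iff)
      then have jj: "j0 \<le> j" by simp
      note j2 = j0(2)[OF jj]
      define L where "L = ln (real j)"
      define R where "R = sqrt (v * \<theta> ^ j * L / 2)"
      have L: "0 < L" using j2 by (simp add: L_def)
      have vt: "0 < v * \<theta> ^ j" using v \<theta> by simp
      have lj: "0 < l j" using L vt by (simp add: l_def L_def)
      have lj2: "(l j)\<^sup>2 = 2 * L / (v * \<theta> ^ j)" using L vt by (simp add: l_def L_def)
      have R2: "R\<^sup>2 = v * \<theta> ^ j * L / 2" "0 \<le> R" using L vt by (simp_all add: R_def)
      have lR: "l j * R = L"
      proof -
        have "(l j * R)\<^sup>2 = L\<^sup>2" unfolding power_mult_distrib lj2 R2(1) using v \<theta> by (simp add: power2_eq_square)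
        then show ?thesis using lj R2(2) L by (simp add: power2_eq_iff_nonneg)
      qed
      have lR': "(l j)\<^sup>2 * (v * \<theta> ^ j) = 2 * L" unfolding lj2 using v \<theta> by simp
      have "addf (a j) n x \<omega> = l j * mart g n x \<omega> - \<theta> * (l j)\<^sup>2 / 2 * addf (\<lambda>_. cond_var g) n x \<omega>"
        by (simp add: addf_def a_def sum_subtractf sum_distrib_left)
      then have "l j * mart g n x \<omega> \<le> \<theta> * L + \<theta> * (l j)\<^sup>2 / 2 * addf (\<lambda>_. cond_var g) n x \<omega>"
        using j0(1)[OF jj, of n] by (simp add: L_def)
      also have "\<theta> * (l j)\<^sup>2 / 2 * addf (\<lambda>_. cond_var g) n x \<omega> \<le> \<theta> * (l j)\<^sup>2 / 2 * (v * (\<theta> * \<theta> ^ j))"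
      proof (rule mult_left_mono)
        have "addf (\<lambda>_. cond_var g) n x \<omega> \<le> v * real n" by (rule N[OF n'(1)])
        also have "\<dots> \<le> v * (\<theta> * \<theta> ^ j)" using nj v by simp
        finally show "addf (\<lambda>_. cond_var g) n x \<omega> \<le> v * (\<theta> * \<theta> ^ j)" .
      qed (use \<theta> in simp)
      also have "\<dots> = \<theta>\<^sup>2 / 2 * ((l j)\<^sup>2 * (v * \<theta> ^ j))" by (simp add: power2_eq_square)
      also have "\<dots> = \<theta>\<^sup>2 * L" unfolding lR' by simp
      also have "\<theta> * L \<le> \<theta>\<^sup>2 * L" using \<theta> L by (simp add: power2_eq_square)
      finally have "l j * mart g n x \<omega> \<le> 2 * \<theta>\<^sup>2 * L" by (simp add: mult_ac)
      also have "\<dots> = l j * (2 * \<theta>\<^sup>2 * R)" by (simp flip: lR)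
      finally have "l j * mart g n x \<omega> \<le> l j * (2 * \<theta>\<^sup>2 * R)" .
      then have "mart g n x \<omega> \<le> 2 * \<theta>\<^sup>2 * R" using lj by simp
      also have "2 * R \<le> \<theta> * sqrt v * lil_scale n"
      proof -
        have "2 * R = sqrt (4 * (v * \<theta> ^ j * L / 2))" unfolding R_def by (subst real_sqrt_mult) simp
        also have "\<dots> \<le> sqrt (\<theta>\<^sup>2 * v * (2 * real n * ln (ln (real n))))"
        proof (rule real_sqrt_le_mono)
          have "real j * ln \<theta> = ln (\<theta> ^ j)" using \<theta> by (simp add: ln_realpow)
          also have "\<dots> \<le> ln (real n)" using jn \<theta> n'(2) by simp
          finally have "ln (real j * ln \<theta>) \<le> ln (ln (real n))" using j2 by simp
          then have "L \<le> \<theta>\<^sup>2 * ln (ln (real n))"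
            using j2 \<theta> unfolding L_def by (smt (verit) mult_left_mono zero_le_power2)
          moreover have "0 \<le> \<theta>\<^sup>2 * ln (ln (real n))" using \<open>L \<le> \<theta>\<^sup>2 * ln (ln (real n))\<close> L by linarith
          ultimately have "\<theta> ^ j * L \<le> real n * (\<theta>\<^sup>2 * ln (ln (real n)))"
            using jn L \<theta> by (intro mult_mono) auto
          then have "v * (\<theta> ^ j * L) \<le> v * (real n * (\<theta>\<^sup>2 * ln (ln (real n))))" using v by simp
          then show "4 * (v * \<theta> ^ j * L / 2) \<le> \<theta>\<^sup>2 * v * (2 * real n * ln (ln (real n)))"
            by (simp add: algebra_simps)
        qed
        also have "\<dots> = \<theta> * sqrt v * lil_scale n"
          using \<theta> by (simp add: real_sqrt_mult lil_scale_def)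
        finally show ?thesis .
      qed
      then have "2 * \<theta>\<^sup>2 * R \<le> \<theta>\<^sup>2 * (\<theta> * sqrt v * lil_scale n)" using \<theta> by (simp add: mult_left_mono[of "2 * R", simplified])
      also have "\<dots> = \<theta> ^ 3 * sqrt v * lil_scale n" by (simp add: power2_eq_square power3_eq_cube)
      finally show "mart g n x \<omega> \<le> \<theta> ^ 3 * sqrt v * lil_scale n" .
    qed
  qed
qed

end

section \<open>Characteristic functions of the martingale part\<close>

lemma separable_UNIV_second_countable: "\<exists>D::'c::{metric_space,second_countable_topology} set. countable D \<and> closure D = UNIV"
proof -
  obtain D :: "'c set" where D: "countable D" "\<And>X. open X \<Longrightarrow> X \<noteq> {} \<Longrightarrow> \<exists>d\<in>D. d \<in> X"
    using countable_dense_exists by blast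
  have "y \<in> closure D" for y
    unfolding closure_approachable
  proof (intro allI impI)
    fix e :: real assume "e > 0"
    then obtain d where "d \<in> D" "d \<in> ball y e" using D(2)[of "ball y e"] by auto
    then show "\<exists>z\<in>D. dist z y < e" by (auto simp: dist_commute)
  qed
  then show ?thesis using D(1) by blast
qed

lemma char_normal_distribution:
  assumes "0 \<le> v"
  shows "char (normal_distribution 0 v) t = complex_of_real (exp (- (t\<^sup>2 * v / 2)))"
    and "real_distribution (normal_distribution 0 v)"
proof -
  have "char (normal_distribution 0 v) t = complex_of_real (exp (- (t\<^sup>2 * v / 2))) \<and>
        real_distribution (normal_distribution 0 v)"
  proof (cases "v = 0")
    case True
    have "real_distribution (return borel (0::real))"
      by (simp add: real_distribution_def real_distribution_axioms_def prob_space_return)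
    moreover have "char (return borel 0) t = 1"
      unfolding char_def by (subst integral_return) auto
    ultimately show ?thesis using True by (simp add: normal_distribution_def)
  next
    case False
    with assms have v: "0 < v" by simp
    interpret N: real_distribution std_normal_distribution by (rule real_dist_normal_dist)
    have "distributed std_normal_distribution lborel (\<lambda>x. x) std_normal_density"
      by (auto simp: distributed_def distr_id2)
    then have "distributed std_normal_distribution lborel (\<lambda>x. 0 + sqrt v * x) (normal_density (0 + sqrt v * 0) (\<bar>sqrt v\<bar> * 1))"
      using v by (intro N.normal_density_affine) auto
    then have d: "distr std_normal_distribution lborel (\<lambda>x. sqrt v * x) = normal_distribution 0 v"
      using v by (simp add: distributed_def normal_distribution_def)
    have d': "normal_distribution 0 v = distr std_normal_distribution borel (\<lambda>x. sqrt v * x)"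
      unfolding d[symmetric] by (intro distr_cong) auto
    have "real_distribution (normal_distribution 0 v)"
      unfolding d' by (rule N.real_distribution_distr) simp
    moreover have "char (normal_distribution 0 v) t = char std_normal_distribution (t * sqrt v)"
      unfolding d' char_def by (subst integral_distr) (auto simp: mult.assoc)
    ultimately show ?thesis
      using v by (simp add: char_std_normal_distribution power_mult_distrib)
  qed
  then show "char (normal_distribution 0 v) t = complex_of_real (exp (- (t\<^sup>2 * v / 2)))"
    "real_distribution (normal_distribution 0 v)" by auto
qed

lemma norm_sub_triangle:
  fixes a b c :: "'v::real_normed_vector"
  shows "norm (a - c) \<le> norm (a - b) + norm (b - c)"
  using norm_triangle_ineq[of "a - b" "b - c"] by simp

context bounded_observable
begin

text \<open>The martingale together with the state is again an iteration of random maps, so its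
  characteristic function is governed by powers of a Markov operator.\<close>

definition mart_chain :: "'i \<Rightarrow> real \<times> 'b \<Rightarrow> real \<times> 'b" where
  "mart_chain i z = (fst z + mart_diff g i (snd z), f i (snd z))"

lemma rds_iter_mart_chain:
  "rds_iter mart_chain \<omega> n z = (fst z + mart g n (snd z) \<omega>, rds_iter f \<omega> n (snd z))"
  by (induction n) (auto simp: mart_chain_def addf_def)

lemma random_maps_mart_chain: "random_maps \<mu> mart_chain"
proof
  show "continuous_on UNIV (mart_chain i)" if "i \<in> space \<mu>" for i
    unfolding mart_chain_def
    by (intro continuous_intros continuous_on_compose2[OF continuous_map[OF that]]
        continuous_on_compose2[OF mart_diff_continuous[OF that]]) auto
  show "(\<lambda>i. mart_chain i z) \<in> borel_measurable \<mu>" for z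
    unfolding mart_chain_def
    by (intro borel_measurable_Pair_separable separable separable_UNIV_second_countable measurable_map) measurable
  show "\<exists>D::(real \<times> 'b) set. countable D \<and> closure D = UNIV"
    by (intro separable_Times separable separable_UNIV_second_countable)
qed

text \<open>To second order in s the integral is \<open>1 - s^2/2 * (V x + markov_op u x)\<close>,
  with V the conditional variance, and the target is \<open>1 - s^2/2 * (s2 + u x)\<close>. The
  approximate Poisson equation says that these agree up to \<epsilon>, so the corrector turns a
  variance depending on the state into the constant \<open>s2\<close>.\<close>

lemma one_step_char:
  fixes u :: "'b \<Rightarrow> real" and s s2 \<epsilon> C :: real
  assumes u: "continuous_on UNIV u" "\<And>x. norm (u x) \<le> C"
    and approx: "\<And>x. \<bar>cond_var g x - s2 - (u x - markov_op u x)\<bar> \<le> \<epsilon>" and s2: "0 \<le> s2"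
  defines "\<rho> \<equiv> 1 - s\<^sup>2 * s2 / 2"
  shows "cmod ((\<integral>i. iexp (s * mart_diff g i x) * complex_of_real (1 - s\<^sup>2 / 2 * u (f i x)) \<partial>\<mu>)
      - complex_of_real (\<rho> * (1 - s\<^sup>2 / 2 * u x)))
    \<le> s\<^sup>2 * \<epsilon> / 2 + \<bar>s\<bar> ^ 3 * (8 * G ^ 3 / 6 + G * C) + s ^ 4 * s2 * C / 4"
proof -
  have C: "0 \<le> C" using order_trans[OF norm_ge_zero u(2)] by blast
  let ?D = "\<lambda>i. mart_diff g i x"
  note [measurable] = measurable_continuous_map[OF u(1)]
  define B1 where "B1 i = iexp (s * ?D i) - (\<Sum>k\<le>2. (\<i> * complex_of_real (s * ?D i)) ^ k / fact k)" for i
  define B2 where "B2 i = - complex_of_real (s\<^sup>2 / 2 * u (f i x)) * (iexp (s * ?D i) - 1)" for i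
  define r where "r i = 1 - s\<^sup>2 / 2 * (?D i)\<^sup>2 - s\<^sup>2 / 2 * u (f i x) - \<rho> * (1 - s\<^sup>2 / 2 * u x)" for i
  have sD: "\<bar>s * ?D i\<bar> \<le> \<bar>s\<bar> * (2 * G)" for i
    unfolding abs_mult by (intro mult_left_mono mart_diff_bound) simp
  have B1b: "cmod (B1 i) \<le> \<bar>s\<bar> ^ 3 * (8 * G ^ 3 / 6)" for i
  proof -
    have "cmod (B1 i) \<le> \<bar>s * ?D i\<bar> ^ 3 / 6"
      unfolding B1_def using iexp_approx1[of "s * ?D i" 2] by (simp add: eval_nat_numeral)
    also have "\<dots> \<le> (\<bar>s\<bar> * (2 * G)) ^ 3 / 6" by (intro divide_right_mono power_mono sD) auto
    finally show ?thesis by (simp add: power_mult_distrib mult_ac)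
  qed
  have B2b: "cmod (B2 i) \<le> \<bar>s\<bar> ^ 3 * (G * C)" for i
  proof -
    have "cmod (iexp (s * ?D i) - 1) \<le> \<bar>s * ?D i\<bar>" using iexp_approx1[of "s * ?D i" 0] by simp
    also have "\<dots> \<le> \<bar>s\<bar> * (2 * G)" by (rule sD)
    finally have "cmod (B2 i) \<le> (s\<^sup>2 / 2 * C) * (\<bar>s\<bar> * (2 * G))"
      unfolding B2_def norm_mult norm_minus_cancel norm_of_real abs_mult
      using u(2)[of "f i x"] C G_nonneg by (intro mult_mono) auto
    also have "\<dots> = \<bar>s\<bar> ^ 3 * (G * C)"
    proof -
      have "s\<^sup>2 = \<bar>s\<bar> * \<bar>s\<bar>" by (simp add: power2_eq_square)
      moreover have "(a * a / 2 * C) * (a * (2 * G)) = a * a * a * (G * C)" for a by simp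
      ultimately show ?thesis unfolding power3_eq_cube by (simp only:)
    qed
    finally show ?thesis .
  qed
  have B1m: "B1 \<in> borel_measurable \<mu>" unfolding B1_def[abs_def] by measurable
  have B2m: "B2 \<in> borel_measurable \<mu>" unfolding B2_def[abs_def] by measurable
  have B1i: "integrable \<mu> B1" by (rule integrable_const_bound[OF AE_I2 B1m]) (rule B1b)
  have B2i: "integrable \<mu> B2" by (rule integrable_const_bound[OF AE_I2 B2m]) (rule B2b)
  have ui: "integrable \<mu> (\<lambda>i. u (f i x))" by (rule integrable_map[OF u])
  have ri: "integrable \<mu> r" unfolding r_def[abs_def]
    using ui mart_diff_square_integrable by auto
  have rint: "(\<integral>i. r i \<partial>\<mu>) = - (s\<^sup>2 / 2) * (cond_var g x - s2 - (u x - markov_op u x)) - s ^ 4 * s2 * u x / 4"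
  proof -
    have "(\<integral>i. r i \<partial>\<mu>) = 1 - s\<^sup>2 / 2 * cond_var g x - s\<^sup>2 / 2 * markov_op u x - \<rho> * (1 - s\<^sup>2 / 2 * u x)"
      unfolding r_def using ui mart_diff_square_integrable
      by (simp add: prob_space cond_var_def markov_op_def)
    then show ?thesis unfolding \<rho>_def by (simp add: algebra_simps power2_eq_square eval_nat_numeral)
  qed
  \<comment> \<open>\<open>B1\<close> is the third-order Taylor remainder, \<open>B2\<close> the
    interaction of the corrector with \<open>iexp - 1\<close>, and \<open>r\<close> collects the
    real terms; the remaining linear term has mean zero.\<close>
  have eq: "iexp (s * ?D i) * complex_of_real (1 - s\<^sup>2 / 2 * u (f i x)) - complex_of_real (\<rho> * (1 - s\<^sup>2 / 2 * u x))
     = B1 i + B2 i + complex_of_real (r i) + \<i> * complex_of_real (s * ?D i)" for i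
    unfolding B1_def B2_def r_def
    by (simp add: eval_nat_numeral power_mult_distrib field_simps)
  have int1: "integrable \<mu> (\<lambda>i. iexp (s * ?D i) * complex_of_real (1 - s\<^sup>2 / 2 * u (f i x)))"
  proof (rule integrable_const_bound[where B="1 + s\<^sup>2 / 2 * C"])
    have "\<bar>1 - s\<^sup>2 / 2 * u (f i x)\<bar> \<le> 1 + s\<^sup>2 / 2 * C" for i
    proof -
      have "\<bar>s\<^sup>2 / 2 * u (f i x)\<bar> \<le> s\<^sup>2 / 2 * C" unfolding abs_mult using u(2)[of "f i x"] by (intro mult_mono) auto
      then show ?thesis by linarith
    qed
    then show "AE i in \<mu>. cmod (iexp (s * ?D i) * complex_of_real (1 - s\<^sup>2 / 2 * u (f i x))) \<le> 1 + s\<^sup>2 / 2 * C"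
      by (intro AE_I2) (simp only: norm_mult norm_exp_i_times norm_of_real mult_1)
  qed measurable
  have "(\<integral>i. iexp (s * ?D i) * complex_of_real (1 - s\<^sup>2 / 2 * u (f i x)) \<partial>\<mu>) - complex_of_real (\<rho> * (1 - s\<^sup>2 / 2 * u x))
     = (\<integral>i. iexp (s * ?D i) * complex_of_real (1 - s\<^sup>2 / 2 * u (f i x)) - complex_of_real (\<rho> * (1 - s\<^sup>2 / 2 * u x)) \<partial>\<mu>)"
    by (subst Bochner_Integration.integral_diff[OF int1]) (simp_all add: prob_space)
  also have "\<dots> = (\<integral>i. B1 i + B2 i + complex_of_real (r i) + \<i> * complex_of_real (s * ?D i) \<partial>\<mu>)"
    by (simp only: eq)
  also have "\<dots> = (\<integral>i. B1 i \<partial>\<mu>) + (\<integral>i. B2 i \<partial>\<mu>) + complex_of_real (\<integral>i. r i \<partial>\<mu>)"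
  proof -
    have "(\<integral>i. \<i> * complex_of_real (s * ?D i) \<partial>\<mu>) = 0"
      by (simp add: integral_complex_of_real mart_diff_integral del: of_real_mult)
    moreover have "integrable \<mu> (\<lambda>i. \<i> * complex_of_real (s * ?D i))"
      using mart_diff_integrable by (intro integrable_mult_right integrable_of_real) auto
    ultimately show ?thesis using B1i B2i ri
      by (simp add: integral_complex_of_real del: of_real_mult)
  qed
  also have "cmod \<dots> \<le> cmod (\<integral>i. B1 i \<partial>\<mu>) + cmod (\<integral>i. B2 i \<partial>\<mu>) + \<bar>\<integral>i. r i \<partial>\<mu>\<bar>"
    using norm_triangle_ineq[of "(\<integral>i. B1 i \<partial>\<mu>) + (\<integral>i. B2 i \<partial>\<mu>)" "complex_of_real (\<integral>i. r i \<partial>\<mu>)"]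
      norm_triangle_ineq[of "\<integral>i. B1 i \<partial>\<mu>" "\<integral>i. B2 i \<partial>\<mu>"] unfolding norm_of_real by linarith
  also have "cmod (\<integral>i. B1 i \<partial>\<mu>) \<le> \<bar>s\<bar> ^ 3 * (8 * G ^ 3 / 6)"
  proof -
    have "cmod (\<integral>i. B1 i \<partial>\<mu>) \<le> (\<integral>i. cmod (B1 i) \<partial>\<mu>)" by (rule integral_norm_bound)
    also have "\<dots> \<le> (\<integral>i. \<bar>s\<bar> ^ 3 * (8 * G ^ 3 / 6) \<partial>\<mu>)"
      using B1i B1b by (intro integral_mono) auto
    finally show ?thesis by (simp add: prob_space)
  qed
  also have "cmod (\<integral>i. B2 i \<partial>\<mu>) \<le> \<bar>s\<bar> ^ 3 * (G * C)"
  proof -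
    have "cmod (\<integral>i. B2 i \<partial>\<mu>) \<le> (\<integral>i. cmod (B2 i) \<partial>\<mu>)" by (rule integral_norm_bound)
    also have "\<dots> \<le> (\<integral>i. \<bar>s\<bar> ^ 3 * (G * C) \<partial>\<mu>)"
      using B2i B2b by (intro integral_mono) auto
    finally show ?thesis by (simp add: prob_space)
  qed
  also have "\<bar>\<integral>i. r i \<partial>\<mu>\<bar> \<le> s\<^sup>2 * \<epsilon> / 2 + s ^ 4 * s2 * C / 4"
  proof -
    have "\<bar>- (s\<^sup>2 / 2) * (cond_var g x - s2 - (u x - markov_op u x))\<bar> \<le> s\<^sup>2 / 2 * \<epsilon>"
      unfolding abs_mult using approx[of x] by (intro mult_mono) auto
    moreover have "\<bar>s ^ 4 * s2 * u x / 4\<bar> \<le> s ^ 4 * s2 * C / 4"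
      using u(2)[of x] s2 by (simp add: abs_mult mult_left_mono)
    ultimately show ?thesis unfolding rint by linarith
  qed
  finally show ?thesis by (simp add: algebra_simps)
qed

text \<open>The corrector \<open>u\<close> makes \<open>\<Phi> (m, x) = exp (\<i> s m) (1 - s\<^sup>2 u x / 2)\<close> an approximate
  eigenfunction of the chain \<open>(M\<^sub>n, X\<^sub>n)\<close>, with eigenvalue \<open>1 - s\<^sup>2 s2 / 2\<close>.\<close>

lemma mart_char_approx:
  fixes u :: "'b \<Rightarrow> real" and s s2 \<epsilon> C :: real
  assumes u: "continuous_on UNIV u" "\<And>x. norm (u x) \<le> C"
    and approx: "\<And>x. \<bar>cond_var g x - s2 - (u x - markov_op u x)\<bar> \<le> \<epsilon>" and s2: "0 \<le> s2"
    and small: "\<bar>1 - s\<^sup>2 * s2 / 2\<bar> \<le> 1"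
  shows "cmod ((\<integral>\<omega>. iexp (s * mart g n x \<omega>) \<partial>\<Omega>) - complex_of_real ((1 - s\<^sup>2 * s2 / 2) ^ n))
    \<le> real n * (s\<^sup>2 * \<epsilon> / 2 + \<bar>s\<bar> ^ 3 * (8 * G ^ 3 / 6 + G * C) + s ^ 4 * s2 * C / 4) + s\<^sup>2 * C"
proof -
  interpret chain: random_maps \<mu> mart_chain by (rule random_maps_mart_chain)
  define E where "E = s\<^sup>2 * \<epsilon> / 2 + \<bar>s\<bar> ^ 3 * (8 * G ^ 3 / 6 + G * C) + s ^ 4 * s2 * C / 4"
  define \<rho> where "\<rho> = 1 - s\<^sup>2 * s2 / 2"
  have C: "0 \<le> C" using order_trans[OF norm_ge_zero u(2)] by blast
  define \<Phi> where "\<Phi> z = iexp (s * fst z) * complex_of_real (1 - s\<^sup>2 / 2 * u (snd z))" for z :: "real \<times> 'b"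
  have \<Phi>c: "continuous_on UNIV \<Phi>"
    unfolding \<Phi>_def by (intro continuous_intros continuous_on_compose2[OF u(1)]) auto
  have su: "\<bar>s\<^sup>2 / 2 * u y\<bar> \<le> s\<^sup>2 / 2 * C" for y
    unfolding abs_mult using u(2)[of y] by (intro mult_mono) auto
  have \<Phi>b: "norm (\<Phi> z) \<le> 1 + s\<^sup>2 / 2 * C" for z
    using su[of "snd z"] abs_triangle_ineq4[of 1 "s\<^sup>2 / 2 * u (snd z)"]
    unfolding \<Phi>_def norm_mult norm_exp_i_times norm_of_real by simp
  note Tc = chain.markov_op_continuous[OF \<Phi>c \<Phi>b] and Tb = chain.markov_op_bound[OF \<Phi>c \<Phi>b]
  have step: "cmod (chain.markov_op \<Phi> z - \<rho> * \<Phi> z) \<le> E" for z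
  proof -
    have "chain.markov_op \<Phi> z = (\<integral>i. iexp (s * fst z) *
        (iexp (s * mart_diff g i (snd z)) * complex_of_real (1 - s\<^sup>2 / 2 * u (f i (snd z)))) \<partial>\<mu>)"
      unfolding chain.markov_op_def
      by (intro Bochner_Integration.integral_cong) (auto simp: \<Phi>_def mart_chain_def exp_add distrib_left)
    also have "\<dots> = iexp (s * fst z) * (\<integral>i.
        iexp (s * mart_diff g i (snd z)) * complex_of_real (1 - s\<^sup>2 / 2 * u (f i (snd z))) \<partial>\<mu>)"
      by simp
    finally have "chain.markov_op \<Phi> z - \<rho> * \<Phi> z = iexp (s * fst z) * ((\<integral>i.
        iexp (s * mart_diff g i (snd z)) * complex_of_real (1 - s\<^sup>2 / 2 * u (f i (snd z))) \<partial>\<mu>)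
         - complex_of_real (\<rho> * (1 - s\<^sup>2 / 2 * u (snd z))))"
      by (simp add: \<Phi>_def algebra_simps)
    then show ?thesis
      using one_step_char[OF u approx s2, of s "snd z"] by (simp add: norm_mult norm_exp_i_times E_def \<rho>_def del: of_real_mult of_real_diff)
  qed
  \<comment> \<open>The eigenvalue has modulus at most 1 by \<open>small\<close>, so the errors of
    the single steps merely add up.\<close>
  have pow: "cmod ((chain.markov_op ^^ n) \<Phi> z - \<rho> ^ n * \<Phi> z) \<le> real n * E" for z
  proof (induction n)
    case (Suc n)
    have i1: "integrable \<Omega> (\<lambda>\<omega>. chain.markov_op \<Phi> (rds_iter mart_chain \<omega> n z))"
      by (rule chain.integrable_iter[OF Tc Tb])
    have i2: "integrable \<Omega> (\<lambda>\<omega>. \<Phi> (rds_iter mart_chain \<omega> n z))"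
      by (rule chain.integrable_iter[OF \<Phi>c \<Phi>b])
    have "(chain.markov_op ^^ Suc n) \<Phi> z = (chain.markov_op ^^ n) (chain.markov_op \<Phi>) z"
      by (simp add: funpow_swap1)
    then have "(chain.markov_op ^^ Suc n) \<Phi> z - \<rho> * (chain.markov_op ^^ n) \<Phi> z =
        (\<integral>\<omega>. chain.markov_op \<Phi> (rds_iter mart_chain \<omega> n z) - \<rho> * \<Phi> (rds_iter mart_chain \<omega> n z) \<partial>\<Omega>)"
      using i1 i2 by (simp add: chain.markov_pow_eq[OF Tc Tb] chain.markov_pow_eq[OF \<Phi>c \<Phi>b])
    also have "cmod \<dots> \<le> (\<integral>\<omega>. cmod (chain.markov_op \<Phi> (rds_iter mart_chain \<omega> n z) - \<rho> * \<Phi> (rds_iter mart_chain \<omega> n z)) \<partial>\<Omega>)"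
      by (rule integral_norm_bound)
    also have "\<dots> \<le> (\<integral>\<omega>. E \<partial>\<Omega>)"
      using i1 i2 step by (intro integral_mono integrable_norm Bochner_Integration.integrable_diff integrable_mult_right) auto
    also have "\<dots> = E" by (simp add: \<Omega>.prob_space)
    finally have a: "cmod ((chain.markov_op ^^ Suc n) \<Phi> z - \<rho> * (chain.markov_op ^^ n) \<Phi> z) \<le> E" .
    have "cmod (\<rho> * ((chain.markov_op ^^ n) \<Phi> z - \<rho> ^ n * \<Phi> z)) \<le> 1 * (real n * E)"
      unfolding norm_mult norm_of_real
      by (rule mult_mono) (use Suc small in \<open>simp_all add: \<rho>_def\<close>)
    then have b: "cmod (\<rho> * (chain.markov_op ^^ n) \<Phi> z - \<rho> ^ Suc n * \<Phi> z) \<le> real n * E"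
      by (simp add: algebra_simps)
    have "cmod ((chain.markov_op ^^ Suc n) \<Phi> z - \<rho> ^ Suc n * \<Phi> z) \<le> E + real n * E"
      by (rule order_trans[OF norm_sub_triangle add_mono[OF a b]])
    then show ?case by (simp add: algebra_simps)
  qed simp
  let ?z = "(0, x)"
  have int: "integrable \<Omega> (\<lambda>\<omega>. iexp (s * mart g n x \<omega>))"
    by (rule \<Omega>.integrable_const_bound[where B=1]) auto
  \<comment> \<open>Dropping the corrector at time n costs \<open>s^2 * C / 2\<close>; dropping it
    at time 0, below, costs the same.\<close>
  have "cmod ((\<integral>\<omega>. iexp (s * mart g n x \<omega>) \<partial>\<Omega>) - (chain.markov_op ^^ n) \<Phi> ?z) \<le> s\<^sup>2 / 2 * C"
  proof -
    have "(\<integral>\<omega>. iexp (s * mart g n x \<omega>) \<partial>\<Omega>) - (chain.markov_op ^^ n) \<Phi> ?z =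
       (\<integral>\<omega>. iexp (s * mart g n x \<omega>) - \<Phi> (rds_iter mart_chain \<omega> n ?z) \<partial>\<Omega>)"
      unfolding chain.markov_pow_eq[OF \<Phi>c \<Phi>b]
      by (rule Bochner_Integration.integral_diff[symmetric, OF int chain.integrable_iter[OF \<Phi>c \<Phi>b]])
    also have "cmod \<dots> \<le> (\<integral>\<omega>. cmod (iexp (s * mart g n x \<omega>) - \<Phi> (rds_iter mart_chain \<omega> n ?z)) \<partial>\<Omega>)"
      by (rule integral_norm_bound)
    also have "\<dots> \<le> (\<integral>\<omega>. s\<^sup>2 / 2 * C \<partial>\<Omega>)"
    proof (rule integral_mono)
      show "integrable \<Omega> (\<lambda>\<omega>. cmod (iexp (s * mart g n x \<omega>) - \<Phi> (rds_iter mart_chain \<omega> n ?z)))"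
        by (intro integrable_norm Bochner_Integration.integrable_diff int chain.integrable_iter[OF \<Phi>c \<Phi>b])
      fix \<omega>
      have "iexp (s * mart g n x \<omega>) - \<Phi> (rds_iter mart_chain \<omega> n ?z) =
          iexp (s * mart g n x \<omega>) * complex_of_real (s\<^sup>2 / 2 * u (rds_iter f \<omega> n x))"
        by (simp add: \<Phi>_def rds_iter_mart_chain algebra_simps)
      then show "cmod (iexp (s * mart g n x \<omega>) - \<Phi> (rds_iter mart_chain \<omega> n ?z)) \<le> s\<^sup>2 / 2 * C"
        using su[of "rds_iter f \<omega> n x"] by (simp only: norm_mult norm_exp_i_times norm_of_real mult_1)
    qed simp
    finally show ?thesis by (simp add: \<Omega>.prob_space)
  qed
  moreover have "cmod (\<rho> ^ n * \<Phi> ?z - complex_of_real (\<rho> ^ n)) \<le> s\<^sup>2 / 2 * C"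
  proof -
    have "\<rho> ^ n * \<Phi> ?z - complex_of_real (\<rho> ^ n) = complex_of_real (- (\<rho> ^ n * (s\<^sup>2 / 2 * u x)))"
      by (simp add: \<Phi>_def algebra_simps)
    also have "cmod \<dots> = \<bar>\<rho>\<bar> ^ n * \<bar>s\<^sup>2 / 2 * u x\<bar>" by (simp only: norm_of_real abs_minus_cancel abs_mult power_abs)
    also have "\<dots> \<le> 1 * (s\<^sup>2 / 2 * C)"
      using small su[of x] by (intro mult_mono power_le_one) (auto simp: \<rho>_def)
    finally show ?thesis by simp
  qed
  ultimately have "cmod ((\<integral>\<omega>. iexp (s * mart g n x \<omega>) \<partial>\<Omega>) - complex_of_real (\<rho> ^ n)) \<le> s\<^sup>2 / 2 * C + real n * E + s\<^sup>2 / 2 * C"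
    using pow[of ?z] by (smt (verit) norm_sub_triangle)
  then have "cmod ((\<integral>\<omega>. iexp (s * mart g n x \<omega>) \<partial>\<Omega>) - complex_of_real (\<rho> ^ n)) \<le> real n * E + s\<^sup>2 * C"
    by linarith
  then show ?thesis unfolding E_def \<rho>_def .
qed

end

section \<open>Central limit theorem\<close>

context bounded_observable
begin

lemma bounded_observable_uminus: "bounded_observable \<mu> f (\<lambda>x. - g x) G"
  by unfold_locales (auto intro!: continuous_intros g_continuous simp: g_bound[simplified])

text \<open>The iterated logarithm bound with a crude variance already gives growth slower than n.
  No averaging of the conditional variance enters, so the result can be used to prove that
  averaging.\<close>

lemma mart_upper_sublinear:
  assumes "0 < e" shows "AE \<omega> in \<Omega>. \<forall>\<^sub>F n in sequentially. mart g n x \<omega> \<le> e * real n"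
proof -
  define v where "v = 4 * G\<^sup>2 + 1"
  have v: "0 < v" unfolding v_def by (rule add_nonneg_pos) simp_all
  have "addf (\<lambda>_. cond_var g) n x \<omega> \<le> v * real n" for n \<omega>
  proof -
    have "addf (\<lambda>_. cond_var g) n x \<omega> \<le> (\<Sum>k<n. v)"
      unfolding addf_def using cond_var_bound by (intro sum_mono) (auto simp: v_def abs_le_iff intro: add_increasing2)
    then show ?thesis by (simp add: mult.commute)
  qed
  then have "AE \<omega> in \<Omega>. \<forall>\<^sub>F n in sequentially. mart g n x \<omega> \<le> 2 ^ 3 * sqrt v * lil_scale n"
    using v by (intro lil_upper_theta) auto
  then show ?thesis
  proof eventually_elim
    case (elim \<omega>)
    have "(\<lambda>n. 2 ^ 3 * sqrt v * (lil_scale n / real n)) \<longlonglongrightarrow> 2 ^ 3 * sqrt v * 0"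
      by (intro tendsto_intros lil_scale_sublinear)
    then have "\<forall>\<^sub>F n in sequentially. 2 ^ 3 * sqrt v * (lil_scale n / real n) < e"
      using assms by (intro order_tendstoD(2)[of _ "2 ^ 3 * sqrt v * 0"]) auto
    with elim eventually_gt_at_top[of 0] show ?case
    proof eventually_elim
      case (elim n)
      then have "2 ^ 3 * sqrt v * lil_scale n \<le> e * real n" by (simp add: field_simps)
      with elim show ?case by linarith
    qed
  qed
qed

lemma mart_sublinear: "AE \<omega> in \<Omega>. (\<lambda>n. mart g n x \<omega> / real n) \<longlonglongrightarrow> 0"
proof -
  interpret neg: bounded_observable \<mu> f "\<lambda>x. - g x" G by (rule bounded_observable_uminus)
  have "AE \<omega> in \<Omega>. \<forall>k. (\<forall>\<^sub>F n in sequentially. mart g n x \<omega> \<le> inverse (real (Suc k)) * real n) \<and>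
      (\<forall>\<^sub>F n in sequentially. - mart g n x \<omega> \<le> inverse (real (Suc k)) * real n)"
    unfolding AE_all_countable
  proof
    fix k
    show "AE \<omega> in \<Omega>. (\<forall>\<^sub>F n in sequentially. mart g n x \<omega> \<le> inverse (real (Suc k)) * real n) \<and>
      (\<forall>\<^sub>F n in sequentially. - mart g n x \<omega> \<le> inverse (real (Suc k)) * real n)"
      using mart_upper_sublinear[of "inverse (real (Suc k))" x] neg.mart_upper_sublinear[of "inverse (real (Suc k))" x]
      unfolding mart_uminus by (simp add: AE_conj_iff)
  qed
  then show ?thesis
  proof eventually_elim
    case (elim \<omega>)
    show ?case
      unfolding lim_sequentially
    proof (intro allI impI)
      fix e :: real assume "0 < e"
      then obtain k where k: "inverse (real (Suc k)) < e" using reals_Archimedean by blast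
      have "\<forall>\<^sub>F n in sequentially. dist (mart g n x \<omega> / real n) 0 < e"
        using elim[rule_format, of k, THEN conjunct1] elim[rule_format, of k, THEN conjunct2] eventually_gt_at_top[of 0]
      proof eventually_elim
        case (elim n)
        then have "\<bar>mart g n x \<omega>\<bar> \<le> inverse (real (Suc k)) * real n" by linarith
        also have "\<dots> < e * real n" using k elim(3) by (intro mult_strict_right_mono) auto
        finally show ?case using elim(3) by (simp add: dist_real_def field_simps)
      qed
      then show "\<exists>N. \<forall>n\<ge>N. dist (mart g n x \<omega> / real n) 0 < e" unfolding eventually_sequentially .
    qed
  qed
qed

end

lemma iexp_diff_le: "cmod (iexp a - iexp b) \<le> \<bar>a - b\<bar>"
proof -
  have "iexp a - iexp b = iexp b * (iexp (a - b) - 1)"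
    by (simp add: right_diff_distrib exp_add[symmetric])
  then have "cmod (iexp a - iexp b) = cmod (iexp (a - b) - 1)" by (simp only: norm_mult norm_exp_i_times mult_1)
  also have "\<dots> \<le> \<bar>a - b\<bar>" using iexp_approx1[of "a - b" 0] by simp
  finally show ?thesis .
qed

text \<open>\<open>averaging\<close> is a Poisson equation for the conditional variance up to a
  uniform error, the form in which \<open>s2\<close> acts as its mean along every orbit.\<close>

locale averaged_observable = bounded_observable \<mu> f g G
  for \<mu> :: "'i measure" and f :: "'i \<Rightarrow> 'b::metric_space \<Rightarrow> 'b" and g G +
  fixes s2 :: real
  assumes s2_nonneg: "0 \<le> s2"
    and averaging: "0 < \<epsilon> \<Longrightarrow> \<exists>u C. continuous_on UNIV u \<and> (\<forall>x. norm (u x) \<le> C) \<and>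
      (\<forall>x. \<bar>cond_var g x - s2 - (u x - markov_op u x)\<bar> \<le> \<epsilon>)"
begin

lemma averaged_observable_uminus: "averaged_observable \<mu> f (\<lambda>x. - g x) G s2"
proof -
  interpret neg: bounded_observable \<mu> f "\<lambda>x. - g x" G by (rule bounded_observable_uminus)
  show ?thesis by unfold_locales (simp_all only: cond_var_uminus s2_nonneg averaging)
qed

text \<open>Summed along an orbit, the coboundary \<open>u - markov_op u\<close> equals the
  martingale of \<open>u\<close> up to boundary terms, and that martingale is sublinear.\<close>

lemma cond_var_average:
  assumes "s2 < v"
  shows "AE \<omega> in \<Omega>. \<forall>\<^sub>F n in sequentially. addf (\<lambda>_. cond_var g) n x \<omega> \<le> v * real n"
proof -
  \<comment> \<open>One third each for the error of the approximate equation, the martingale of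
    \<open>u\<close>, and the boundary terms.\<close>
  define \<epsilon> where "\<epsilon> = (v - s2) / 3"
  have \<epsilon>: "0 < \<epsilon>" using assms by (simp add: \<epsilon>_def)
  obtain u C where u: "continuous_on UNIV u" "\<forall>x. norm (u x) \<le> C"
    "\<forall>x. \<bar>cond_var g x - s2 - (u x - markov_op u x)\<bar> \<le> \<epsilon>"
    using averaging[OF \<epsilon>] by blast
  interpret U: bounded_observable \<mu> f u C using u by unfold_locales auto
  from U.mart_upper_sublinear[OF \<epsilon>, of x] show ?thesis
  proof eventually_elim
    case (elim \<omega>)
    have "\<forall>\<^sub>F n in sequentially. 2 * C \<le> \<epsilon> * real n" using \<epsilon> by real_asymp
    with elim show ?case
    proof eventually_elim
      case (elim n)
      have "addf (\<lambda>_. cond_var g) n x \<omega> \<le> (\<Sum>k<n. s2 + \<epsilon> + (u (rds_iter f \<omega> k x) - markov_op u (rds_iter f \<omega> k x)))"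
        unfolding addf_def
      proof (rule sum_mono)
        fix k show "cond_var g (rds_iter f \<omega> k x) \<le> s2 + \<epsilon> + (u (rds_iter f \<omega> k x) - markov_op u (rds_iter f \<omega> k x))"
          using u(3)[rule_format, of "rds_iter f \<omega> k x"] unfolding abs_le_iff by linarith
      qed
      also have "\<dots> = real n * (s2 + \<epsilon>) + (mart u n x \<omega> - u (rds_iter f \<omega> n x) + u x)"
        unfolding mart_telescope by (simp add: sum.distrib)
      also have "\<dots> \<le> real n * (s2 + \<epsilon>) + (\<epsilon> * real n + \<epsilon> * real n)"
        using elim u(2)[rule_format, of x] u(2)[rule_format, of "rds_iter f \<omega> n x"] by (simp add: abs_le_iff)
      also have "\<dots> = real n * (s2 + 3 * \<epsilon>)" by (simp add: algebra_simps)
      also have "\<dots> = v * real n" by (simp add: \<epsilon>_def field_simps)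
      finally show ?case .
    qed
  qed
qed

theorem lil_upper:
  assumes "sqrt s2 < c"
  shows "AE \<omega> in \<Omega>. \<forall>\<^sub>F n in sequentially. mart g n x \<omega> \<le> c * lil_scale n"
proof -
  \<comment> \<open>The midpoint is positive even if s2 = 0, so its square is an admissible variance
    for \<open>lil_upper_theta\<close>; the cube root below spends the remaining gap on
    \<open>\<theta> ^ 3\<close>.\<close>
  define w where "w = (sqrt s2 + c) / 2"
  have "0 < (r + c) / 2" if "0 \<le> r" "r < c" for r using that by simp
  from this[OF real_sqrt_ge_zero[OF s2_nonneg] assms] have "0 < w" by (simp add: w_def)
  moreover have "sqrt s2 < w" "w < c" using assms by (auto simp: w_def)
  ultimately have w: "sqrt s2 < w" "w < c" "0 < w" by auto
  have "s2 < w\<^sup>2"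
    using w s2_nonneg by (metis less_imp_le real_less_rsqrt real_sqrt_ge_zero real_sqrt_less_iff real_sqrt_unique)
  note avg = cond_var_average[OF this]
  define \<theta> where "\<theta> = root 3 (c / w)"
  have \<theta>: "1 < \<theta>" using w by (simp add: \<theta>_def)
  have "\<theta> ^ 3 = c / w" using w by (simp add: \<theta>_def real_root_pow_pos2)
  then have "\<theta> ^ 3 * sqrt (w\<^sup>2) = c" using w by simp
  then show ?thesis using lil_upper_theta[OF _ \<theta> avg, of x] w by simp
qed

text \<open>The starting point \<open>xs n\<close> may change with n: convergence along every such
  sequence encodes uniformity in the starting point.\<close>

lemma mart_char_tendsto:
  "(\<lambda>n. \<integral>\<omega>. iexp (t / sqrt (real n) * mart g n (xs n) \<omega>) \<partial>\<Omega>) \<longlonglongrightarrow> complex_of_real (exp (- (t\<^sup>2 * s2 / 2)))"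
proof -
  let ?F = "\<lambda>n. \<integral>\<omega>. iexp (t / sqrt (real n) * mart g n (xs n) \<omega>) \<partial>\<Omega>"
  let ?R = "\<lambda>n. complex_of_real ((1 - (t / sqrt (real n))\<^sup>2 * s2 / 2) ^ n)"
  have "(\<lambda>n. ?F n - ?R n) \<longlonglongrightarrow> 0"
    unfolding tendsto_iff
  proof (intro allI impI)
    fix e :: real assume e: "0 < e"
    \<comment> \<open>For s = t / sqrt n the only error surviving n steps is
      \<open>t^2 * \<epsilon> / 2\<close>. The others vanish although their constant C depends on
      \<epsilon>, since \<epsilon> is fixed before n grows.\<close>
    define \<epsilon> where "\<epsilon> = e / (t\<^sup>2 + 1)"
    have t1: "0 < t\<^sup>2 + 1" by (rule add_nonneg_pos) simp_all
    have \<epsilon>: "0 < \<epsilon>" using e t1 by (simp add: \<epsilon>_def)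
    have te: "t\<^sup>2 * \<epsilon> / 2 < e"
    proof -
      have "t\<^sup>2 * \<epsilon> \<le> (t\<^sup>2 + 1) * \<epsilon>" using \<epsilon> by simp
      also have "\<dots> = e" using t1 by (simp add: \<epsilon>_def)
      finally show ?thesis using e by simp
    qed
    obtain u C where u: "continuous_on UNIV u" "\<And>x. norm (u x) \<le> C"
      "\<And>x. \<bar>cond_var g x - s2 - (u x - markov_op u x)\<bar> \<le> \<epsilon>"
      using averaging[OF \<epsilon>] by blast
    define K where "K = 8 * G ^ 3 / 6 + G * C"
    define b where "b n = t\<^sup>2 * \<epsilon> / 2 + \<bar>t\<bar> ^ 3 * K * (1 / sqrt (real n)) + (t ^ 4 * s2 * C / 4 + t\<^sup>2 * C) * (1 / real n)" for n :: nat
    have "(\<lambda>n. 1 / sqrt (real n)) \<longlonglongrightarrow> 0" by real_asymp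
    moreover have "(\<lambda>n. 1 / real n) \<longlonglongrightarrow> 0" by (rule lim_1_over_n)
    ultimately have "b \<longlonglongrightarrow> t\<^sup>2 * \<epsilon> / 2 + \<bar>t\<bar> ^ 3 * K * 0 + (t ^ 4 * s2 * C / 4 + t\<^sup>2 * C) * 0"
      unfolding b_def by (intro tendsto_intros)
    then have be: "\<forall>\<^sub>F n in sequentially. b n < e" using te by (intro order_tendstoD(2)) auto
    have "\<forall>\<^sub>F n in sequentially. t\<^sup>2 * s2 \<le> real n"
      using filterlim_at_top_imp_at_infinity filterlim_real_sequentially unfolding filterlim_at_top by blast
    then show "\<forall>\<^sub>F n in sequentially. dist (?F n - ?R n) 0 < e"
      using be eventually_gt_at_top[of 0]
    proof eventually_elim
      case (elim n)
      let ?s = "t / sqrt (real n)"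
      have s2': "?s\<^sup>2 = t\<^sup>2 / real n" by (simp add: power_divide)
      have s4: "?s ^ 4 = t ^ 4 / (real n)\<^sup>2"
      proof -
        have "?s ^ 4 = (?s\<^sup>2)\<^sup>2" by simp
        then show ?thesis unfolding s2' by (simp add: power_divide)
      qed
      have s3: "real n * \<bar>?s\<bar> ^ 3 = \<bar>t\<bar> ^ 3 * (1 / sqrt (real n))"
      proof -
        have "\<bar>?s\<bar> ^ 3 = \<bar>?s\<bar> * ?s\<^sup>2"
          unfolding power2_abs[symmetric, of ?s] by (simp only: power3_eq_cube power2_eq_square mult.assoc)
        also have "\<dots> = \<bar>t\<bar> / sqrt (real n) * (\<bar>t\<bar>\<^sup>2 / real n)" unfolding s2' by (simp add: abs_div_pos)
        also have "real n * \<dots> = \<bar>t\<bar> * \<bar>t\<bar>\<^sup>2 * (1 / sqrt (real n))" using elim(3) by simp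
        finally show ?thesis by (simp add: power3_eq_cube power2_eq_square)
      qed
      have "0 \<le> t\<^sup>2 * s2 / real n" using s2_nonneg by simp
      moreover have "t\<^sup>2 * s2 / real n \<le> 1" using elim by simp
      ultimately have small: "\<bar>1 - ?s\<^sup>2 * s2 / 2\<bar> \<le> 1" unfolding s2' by (simp add: abs_le_iff)
      have "cmod (?F n - ?R n) \<le> real n * (?s\<^sup>2 * \<epsilon> / 2 + \<bar>?s\<bar> ^ 3 * K + ?s ^ 4 * s2 * C / 4) + ?s\<^sup>2 * C"
        unfolding K_def by (rule mart_char_approx[OF u s2_nonneg small])
      also have "\<dots> = real n * (t\<^sup>2 / real n) * \<epsilon> / 2 + (real n * \<bar>?s\<bar> ^ 3) * K + real n * (t ^ 4 / (real n)\<^sup>2) * s2 * C / 4 + (t\<^sup>2 / real n) * C"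
        unfolding s2' s4 by (simp add: algebra_simps)
      also have "\<dots> = b n" unfolding s3 b_def using elim(3) by (simp add: power2_eq_square field_simps)
      finally show ?case using elim(2) by simp
    qed
  qed
  moreover have "?R \<longlonglongrightarrow> complex_of_real (exp (- (t\<^sup>2 * s2 / 2)))"
  proof (intro tendsto_of_real)
    have "(\<lambda>n. (1 + - (t\<^sup>2 * s2 / 2) / real n) ^ n) \<longlonglongrightarrow> exp (- (t\<^sup>2 * s2 / 2))"
      by (rule tendsto_exp_limit_sequentially)
    then show "(\<lambda>n. (1 - (t / sqrt (real n))\<^sup>2 * s2 / 2) ^ n) \<longlonglongrightarrow> exp (- (t\<^sup>2 * s2 / 2))"
      by (simp add: power_divide mult.commute)
  qed
  ultimately have "(\<lambda>n. (?F n - ?R n) + ?R n) \<longlonglongrightarrow> 0 + complex_of_real (exp (- (t\<^sup>2 * s2 / 2)))"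
    by (rule tendsto_add)
  then show ?thesis by simp
qed

text \<open>The bounded discrepancy D serves Birkhoff sums; with \<open>Y\<close> the martingale
  itself and D = 0 the statement yields the uniform tail bound.\<close>

theorem central_limit:
  assumes Y[measurable]: "\<And>n. Y n \<in> borel_measurable \<Omega>"
    and close: "\<And>n \<omega>. \<omega> \<in> space \<Omega> \<Longrightarrow> \<bar>Y n \<omega> - mart g n (xs n) \<omega>\<bar> \<le> D"
  shows "weak_conv_m (\<lambda>n. distr \<Omega> borel (\<lambda>\<omega>. 1 / sqrt (real n) * Y n \<omega>)) (normal_distribution 0 s2)"
proof (rule levy_continuity)
  show "real_distribution (distr \<Omega> borel (\<lambda>\<omega>. 1 / sqrt (real n) * Y n \<omega>))" for n
    by (rule \<Omega>.real_distribution_distr) measurable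
  show "real_distribution (normal_distribution 0 s2)" by (rule char_normal_distribution(2)[OF s2_nonneg])
  fix t
  let ?F = "\<lambda>n. \<integral>\<omega>. iexp (t / sqrt (real n) * mart g n (xs n) \<omega>) \<partial>\<Omega>"
  let ?H = "\<lambda>n. char (distr \<Omega> borel (\<lambda>\<omega>. 1 / sqrt (real n) * Y n \<omega>)) t"
  have "(\<lambda>n. ?H n - ?F n) \<longlonglongrightarrow> 0"
  proof (rule Lim_null_comparison)
    have "(\<lambda>n. 1 / sqrt (real n)) \<longlonglongrightarrow> 0" by real_asymp
    then have "(\<lambda>n. \<bar>t\<bar> * D * (1 / sqrt (real n))) \<longlonglongrightarrow> \<bar>t\<bar> * D * 0" by (intro tendsto_intros)
    then show "(\<lambda>n. \<bar>t\<bar> * D * (1 / sqrt (real n))) \<longlonglongrightarrow> 0" by simp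
    show "\<forall>\<^sub>F n in sequentially. norm (?H n - ?F n) \<le> \<bar>t\<bar> * D * (1 / sqrt (real n))"
    proof (intro always_eventually allI)
      fix n
      have H: "?H n = (\<integral>\<omega>. iexp (t / sqrt (real n) * Y n \<omega>) \<partial>\<Omega>)"
        unfolding char_def by (subst integral_distr) (auto simp: field_simps)
      have i1: "integrable \<Omega> (\<lambda>\<omega>. iexp (t / sqrt (real n) * Y n \<omega>))"
        by (rule \<Omega>.integrable_const_bound[where B=1]) auto
      have i2: "integrable \<Omega> (\<lambda>\<omega>. iexp (t / sqrt (real n) * mart g n (xs n) \<omega>))"
        by (rule \<Omega>.integrable_const_bound[where B=1]) auto
      have "?H n - ?F n = (\<integral>\<omega>. iexp (t / sqrt (real n) * Y n \<omega>) - iexp (t / sqrt (real n) * mart g n (xs n) \<omega>) \<partial>\<Omega>)"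
        unfolding H by (rule Bochner_Integration.integral_diff[symmetric, OF i1 i2])
      also have "cmod \<dots> \<le> (\<integral>\<omega>. cmod (iexp (t / sqrt (real n) * Y n \<omega>) - iexp (t / sqrt (real n) * mart g n (xs n) \<omega>)) \<partial>\<Omega>)"
        by (rule integral_norm_bound)
      also have "\<dots> \<le> (\<integral>\<omega>. \<bar>t\<bar> * D * (1 / sqrt (real n)) \<partial>\<Omega>)"
      proof (rule integral_mono)
        show "integrable \<Omega> (\<lambda>\<omega>. cmod (iexp (t / sqrt (real n) * Y n \<omega>) - iexp (t / sqrt (real n) * mart g n (xs n) \<omega>)))"
          by (intro integrable_norm Bochner_Integration.integrable_diff i1 i2)
        fix \<omega> assume \<omega>: "\<omega> \<in> space \<Omega>"
        have "cmod (iexp (t / sqrt (real n) * Y n \<omega>) - iexp (t / sqrt (real n) * mart g n (xs n) \<omega>))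
            \<le> \<bar>t / sqrt (real n) * Y n \<omega> - t / sqrt (real n) * mart g n (xs n) \<omega>\<bar>"
          by (rule iexp_diff_le)
        also have "\<dots> = \<bar>t / sqrt (real n)\<bar> * \<bar>Y n \<omega> - mart g n (xs n) \<omega>\<bar>"
          by (simp only: right_diff_distrib[symmetric] abs_mult)
        also have "\<dots> \<le> \<bar>t / sqrt (real n)\<bar> * D" by (intro mult_left_mono close[OF \<omega>]) simp
        finally show "cmod (iexp (t / sqrt (real n) * Y n \<omega>) - iexp (t / sqrt (real n) * mart g n (xs n) \<omega>))
            \<le> \<bar>t\<bar> * D * (1 / sqrt (real n))" by simp
      qed simp
      finally show "norm (?H n - ?F n) \<le> \<bar>t\<bar> * D * (1 / sqrt (real n))" by (simp add: \<Omega>.prob_space)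
    qed
  qed
  from tendsto_add[OF this mart_char_tendsto[of t xs]]
  show "?H \<longlonglongrightarrow> char (normal_distribution 0 s2) t" by (simp add: char_normal_distribution(1)[OF s2_nonneg])
qed

end

section \<open>The lower half of the law of the iterated logarithm\<close>

text \<open>A crude bound: the tail beyond a standard deviations contains an interval of one further
  standard deviation, on which the density is smallest at the right end. The exponent
  \<open>(a + 1)^2 / 2 + 2\<close> is still asymptotic to \<open>a^2 / 2\<close>, which is all that
  matters for large a.\<close>

lemma normal_distribution_tail:
  assumes s2: "0 < s2" and a: "0 \<le> a"
  shows "cdf (normal_distribution 0 s2) (a * sqrt s2) < 1 - exp (- ((a + 1)\<^sup>2 / 2 + 2))"
    and "isCont (cdf (normal_distribution 0 s2)) (a * sqrt s2)"
proof -
  define \<sigma> where "\<sigma> = sqrt s2"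
  have \<sigma>: "0 < \<sigma>" using s2 by (simp add: \<sigma>_def)
  define N where "N = density lborel (\<lambda>t. ennreal (normal_density 0 \<sigma> t))"
  have N: "normal_distribution 0 s2 = N" using s2 by (simp add: normal_distribution_def N_def \<sigma>_def)
  interpret N: real_distribution N unfolding N[symmetric] by (rule char_normal_distribution(2)) (use s2 in simp)
  have "emeasure N {x} = 0" for x
    unfolding N_def by (subst emeasure_density) (auto simp: nn_integral_0_iff_AE intro!: AE_lborel_singleton[THEN eventually_mono] split: split_indicator)
  then show "isCont (cdf (normal_distribution 0 s2)) (a * sqrt s2)"
    unfolding N N.isCont_cdf by (simp add: measure_def)
  define c where "c = normal_density 0 \<sigma> ((a + 1) * \<sigma>)"
  have c: "0 \<le> c" by (simp add: c_def)
  have "(a + 1) * \<sigma> - a * \<sigma> = \<sigma>" "a * \<sigma> \<le> (a + 1) * \<sigma>" using \<sigma> by (auto simp: distrib_right)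
  then have len: "emeasure lborel {a * \<sigma><..(a + 1) * \<sigma>} = ennreal \<sigma>"
    by (simp only: emeasure_lborel_Ioc)
  have "ennreal (c * \<sigma>) = ennreal c * emeasure lborel {a * \<sigma><..(a + 1) * \<sigma>}"
    unfolding len using c \<sigma> by (intro ennreal_mult) auto
  also have "\<dots> = (\<integral>\<^sup>+ t. ennreal c * indicator {a * \<sigma><..(a + 1) * \<sigma>} t \<partial>lborel)"
    by (rule nn_integral_cmult_indicator[symmetric]) simp
  also have "\<dots> \<le> (\<integral>\<^sup>+ t. ennreal (normal_density 0 \<sigma> t) * indicator {a * \<sigma><..(a + 1) * \<sigma>} t \<partial>lborel)"
  proof (rule nn_integral_mono)
    fix t
    show "ennreal c * indicator {a * \<sigma><..(a + 1) * \<sigma>} t \<le> ennreal (normal_density 0 \<sigma> t) * indicator {a * \<sigma><..(a + 1) * \<sigma>} t"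
    proof (cases "t \<in> {a * \<sigma><..(a + 1) * \<sigma>}")
      case True
      have "0 \<le> a * \<sigma>" using a \<sigma> by simp
      then have "t\<^sup>2 \<le> ((a + 1) * \<sigma>)\<^sup>2" using True by (intro power_mono) auto
      then have "c \<le> normal_density 0 \<sigma> t"
        unfolding c_def normal_density_def using \<sigma> by (simp add: divide_right_mono mult_left_mono)
      then show ?thesis using True by (simp add: ennreal_leI)
    qed simp
  qed
  also have "\<dots> = emeasure N {a * \<sigma><..(a + 1) * \<sigma>}"
    unfolding N_def by (subst emeasure_density) auto
  also have "\<dots> = ennreal (measure N {a * \<sigma><..(a + 1) * \<sigma>})" by (rule N.emeasure_eq_measure)
  finally have "c * \<sigma> \<le> measure N {a * \<sigma><..(a + 1) * \<sigma>}" by (simp add: ennreal_le_iff)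
  also have "\<dots> \<le> measure N {a * \<sigma><..}" by (rule N.finite_measure_mono) auto
  also have "\<dots> = 1 - cdf N (a * \<sigma>)"
  proof -
    have "measure N (space N - {..a * \<sigma>}) = 1 - measure N {..a * \<sigma>}" by (rule N.prob_compl) simp
    moreover have "space N - {..a * \<sigma>} = {a * \<sigma><..}" by auto
    ultimately show ?thesis by (simp add: cdf_def)
  qed
  finally have le: "cdf N (a * \<sigma>) \<le> 1 - c * \<sigma>" by simp
  have "c * \<sigma> = exp (- ((a + 1)\<^sup>2 / 2)) / sqrt (2 * pi)"
    unfolding c_def normal_density_def using \<sigma> by (simp add: real_sqrt_mult power_mult_distrib)
  moreover have "exp (- ((a + 1)\<^sup>2 / 2 + 2)) < exp (- ((a + 1)\<^sup>2 / 2)) / sqrt (2 * pi)"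
  proof -
    \<comment> \<open>The summand 2 in the exponent absorbs the normalisation, as sqrt (2 pi) < 3
      \<le> exp 2.\<close>
    have "sqrt (2 * pi) < sqrt (3\<^sup>2)" using pi_less_4 by (intro real_sqrt_less_mono) simp
    also have "\<dots> = 1 + 2" by simp
    also have "\<dots> \<le> exp (2::real)" by (rule exp_ge_add_one_self)
    finally have "sqrt (2 * pi) < exp 2" .
    then have "exp (- ((a + 1)\<^sup>2 / 2)) / exp 2 < exp (- ((a + 1)\<^sup>2 / 2)) / sqrt (2 * pi)"
      by (intro divide_strict_left_mono) auto
    moreover have "exp (- ((a + 1)\<^sup>2 / 2 + 2)) = exp (- ((a + 1)\<^sup>2 / 2)) / exp 2"
      unfolding exp_diff[symmetric] by simp
    ultimately show ?thesis by simp
  qed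
  ultimately show "cdf (normal_distribution 0 s2) (a * sqrt s2) < 1 - exp (- ((a + 1)\<^sup>2 / 2 + 2))"
    using le unfolding N \<sigma>_def[symmetric] by linarith
qed

text \<open>With blocks of factorial size, all earlier blocks together amount to at most the
  fraction 2 / j of block j.\<close>

lemma sum_fact_le: "real j * (\<Sum>l<j. fact l) \<le> 2 * fact j"
proof (induction j)
  case (Suc j)
  have le: "(\<Sum>l<j. fact l :: real) \<le> fact j"
  proof (cases "j \<le> 1")
    case True then show ?thesis by (cases j) auto
  next
    case False
    have "2 * (\<Sum>l<j. fact l :: real) \<le> real j * (\<Sum>l<j. fact l)"
      using False by (intro mult_right_mono sum_nonneg) auto
    then show ?thesis using Suc by simp
  qed
  have "real (Suc j) * (\<Sum>l<Suc j. fact l) \<le> real (Suc j) * (2 * fact j)"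
    using le by (intro mult_left_mono) auto
  then show ?case by simp
qed simp

section \<open>Lower bounds for increments over blocks\<close>

context bounded_observable
begin

text \<open>The bound \<open>p\<close> holds from every starting point, hence at the random state
  reached at time \<open>n\<close>, whatever the first \<open>n\<close> letters were.\<close>

lemma increment_lower:
  assumes A: "Measurable.pred \<Omega> A" and det: "\<And>\<omega> \<omega>'. A (comb_seq n \<omega> \<omega>') \<longleftrightarrow> A \<omega>"
    and p: "\<And>z. p \<le> \<Omega>.prob {\<omega> \<in> space \<Omega>. y \<le> mart g m z \<omega>}"
  shows "p * \<Omega>.prob {\<omega> \<in> space \<Omega>. A \<omega>} \<le>
    \<Omega>.prob {\<omega> \<in> space \<Omega>. A \<omega> \<and> y \<le> mart g (n + m) x \<omega> - mart g n x \<omega>}"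
proof -
  note [measurable] = A
  define Q where "Q \<omega> \<longleftrightarrow> y \<le> mart g (n + m) x \<omega> - mart g n x \<omega>" for \<omega>
  have Q: "Measurable.pred \<Omega> Q" unfolding Q_def[abs_def] by measurable
  define P where "P \<omega> = \<Omega>.prob {\<omega>' \<in> space \<Omega>. y \<le> mart g m (rds_iter f \<omega> n x) \<omega>'}" for \<omega>
  have P: "\<Omega>.prob {\<omega>' \<in> space \<Omega>. Q (comb_seq n \<omega> \<omega>')} = P \<omega>" for \<omega>
    by (simp add: Q_def P_def addf_comb_seq addf_comb_seq_le)
  have P01: "0 \<le> P \<omega>" "P \<omega> \<le> 1" for \<omega> by (simp_all add: P_def)
  have [measurable]: "P \<in> borel_measurable \<Omega>"
    using prob_comb_seq(2)[OF A Q det] unfolding P .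
  have "p * \<Omega>.prob {\<omega> \<in> space \<Omega>. A \<omega>} = (\<integral>\<omega>. indicator {\<omega> \<in> space \<Omega>. A \<omega>} \<omega> * p \<partial>\<Omega>)" by simp
  also have "\<dots> \<le> (\<integral>\<omega>. indicator {\<omega> \<in> space \<Omega>. A \<omega>} \<omega> * P \<omega> \<partial>\<Omega>)"
  proof (rule integral_mono)
    show "integrable \<Omega> (\<lambda>\<omega>. indicator {\<omega> \<in> space \<Omega>. A \<omega>} \<omega> * P \<omega>)"
      by (rule \<Omega>.integrable_const_bound[where B=1]) (auto simp: indicator_def P01)
    show "integrable \<Omega> (\<lambda>\<omega>. indicator {\<omega> \<in> space \<Omega>. A \<omega>} \<omega> * p)"
      by (rule \<Omega>.integrable_const_bound[where B="\<bar>p\<bar>"]) (auto simp: indicator_def)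
    show "indicator {\<omega> \<in> space \<Omega>. A \<omega>} \<omega> * p \<le> indicator {\<omega> \<in> space \<Omega>. A \<omega>} \<omega> * P \<omega>" for \<omega>
      unfolding P_def by (intro mult_left_mono p) (simp add: indicator_def)
  qed
  also have "\<dots> = \<Omega>.prob {\<omega> \<in> space \<Omega>. A \<omega> \<and> y \<le> mart g (n + m) x \<omega> - mart g n x \<omega>}"
    using prob_comb_seq(1)[OF A Q det, unfolded P] unfolding Q_def by (rule sym)
  finally show ?thesis .
qed

text \<open>A moderate deviation bound from the central limit theorem: k pieces each gaining a
  standard deviations of a piece amount to a sqrt k standard deviations of their union, with
  probability at least p^k.\<close>

lemma block_lower:
  assumes p0: "0 \<le> p" and p: "\<And>z. p \<le> \<Omega>.prob {\<omega> \<in> space \<Omega>. y \<le> mart g m z \<omega>}"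
  shows "p ^ k \<le> \<Omega>.prob {\<omega> \<in> space \<Omega>. real k * y \<le> mart g (k * m) x \<omega>}"
proof (induction k)
  case 0
  then show ?case by (simp add: \<Omega>.prob_space)
next
  case (Suc k)
  have "p ^ Suc k \<le> p * \<Omega>.prob {\<omega> \<in> space \<Omega>. real k * y \<le> mart g (k * m) x \<omega>}"
    using Suc p0 by (simp add: mult_left_mono)
  also have "\<dots> \<le> \<Omega>.prob {\<omega> \<in> space \<Omega>. real k * y \<le> mart g (k * m) x \<omega> \<and>
      y \<le> mart g (k * m + m) x \<omega> - mart g (k * m) x \<omega>}"
    by (rule increment_lower[OF _ _ p]) (simp_all add: addf_comb_seq_le)
  also have "\<dots> \<le> \<Omega>.prob {\<omega> \<in> space \<Omega>. real (Suc k) * y \<le> mart g (Suc k * m) x \<omega>}"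
    by (rule \<Omega>.finite_measure_mono) (auto simp: algebra_simps)
  finally show ?case .
qed

text \<open>A conditional Borel--Cantelli argument: given the past, each increment reaches \<open>y j\<close> with
  probability at least \<open>p j\<close>, and these bounds are not summable.\<close>

lemma increments_infinitely_often:
  assumes N: "\<And>j. N (Suc j) = N j + L j"
    and p: "\<And>j z. j0 \<le> j \<Longrightarrow> p j \<le> \<Omega>.prob {\<omega> \<in> space \<Omega>. y j \<le> mart g (L j) z \<omega>}"
    and p1: "\<And>j. 0 \<le> p j" and div: "\<not> summable p"
  shows "AE \<omega> in \<Omega>. \<exists>\<^sub>F j in sequentially. y j \<le> mart g (N (Suc j)) x \<omega> - mart g (N j) x \<omega>"
proof -
  define Q where "Q j \<omega> \<longleftrightarrow> y j \<le> mart g (N (Suc j)) x \<omega> - mart g (N j) x \<omega>" for j \<omega>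
  have Qm[measurable]: "Measurable.pred \<Omega> (Q j)" for j unfolding Q_def by measurable
  have Nmono: "N i \<le> N j" if "i \<le> j" for i j using lift_Suc_mono_le[of N] N that by simp
  define R where "R J K \<omega> \<longleftrightarrow> (\<forall>j\<in>{J..<J + K}. \<not> Q j \<omega>)" for J K \<omega>
  have Rm[measurable]: "Measurable.pred \<Omega> (R J K)" for J K unfolding R_def by measurable
  \<comment> \<open>Whether all increments J, ..., J + K - 1 fail is decided by the letters before
    time \<open>N (J + K)\<close>, where the next increment begins.\<close>
  have Rdet: "R J K (comb_seq (N (J + K)) \<omega> \<omega>') = R J K \<omega>" for J K \<omega> \<omega>'
    unfolding R_def Q_def by (intro ball_cong refl) (simp add: addf_comb_seq_le Nmono del: add_Suc)
  have Rp: "\<Omega>.prob {\<omega> \<in> space \<Omega>. R J K \<omega>} \<le> exp (- (\<Sum>k<K. p (J + k)))" if "j0 \<le> J" for J K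
  proof (induction K)
    case (Suc K)
    let ?R = "{\<omega> \<in> space \<Omega>. R J K \<omega>}"
    have "p (J + K) * \<Omega>.prob ?R \<le> \<Omega>.prob {\<omega> \<in> space \<Omega>. R J K \<omega> \<and>
        y (J + K) \<le> mart g (N (J + K) + L (J + K)) x \<omega> - mart g (N (J + K)) x \<omega>}"
      using that by (intro increment_lower Rm Rdet p) simp
    then have a: "p (J + K) * \<Omega>.prob ?R \<le> \<Omega>.prob {\<omega> \<in> space \<Omega>. R J K \<omega> \<and> Q (J + K) \<omega>}"
      by (simp add: Q_def N)
    have sub: "{\<omega> \<in> space \<Omega>. R J K \<omega> \<and> Q (J + K) \<omega>} \<subseteq> ?R" by auto
    have "{\<omega> \<in> space \<Omega>. R J (Suc K) \<omega>} = ?R - {\<omega> \<in> space \<Omega>. R J K \<omega> \<and> Q (J + K) \<omega>}"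
      by (auto simp: R_def less_Suc_eq)
    then have "\<Omega>.prob {\<omega> \<in> space \<Omega>. R J (Suc K) \<omega>} = \<Omega>.prob ?R - \<Omega>.prob {\<omega> \<in> space \<Omega>. R J K \<omega> \<and> Q (J + K) \<omega>}"
      using \<Omega>.finite_measure_Diff[OF _ _ sub] by simp
    also have "\<dots> \<le> (1 - p (J + K)) * \<Omega>.prob ?R" using a by (simp add: algebra_simps)
    also have "\<dots> \<le> exp (- p (J + K)) * \<Omega>.prob ?R"
      using exp_ge_add_one_self[of "- p (J + K)"] by (intro mult_right_mono) auto
    also have "\<dots> \<le> exp (- p (J + K)) * exp (- (\<Sum>k<K. p (J + k)))" using Suc by (intro mult_left_mono) auto
    finally show ?case by (simp add: exp_add[symmetric] algebra_simps)
  qed simp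
  \<comment> \<open>If failing forever from J on had positive probability, minus its logarithm would
    bound the partial sums of \<open>p\<close>.\<close>
  have zero: "\<Omega>.prob {\<omega> \<in> space \<Omega>. \<forall>j\<ge>J. \<not> Q j \<omega>} = 0" if J: "j0 \<le> J" for J
  proof (rule ccontr)
    let ?S = "{\<omega> \<in> space \<Omega>. \<forall>j\<ge>J. \<not> Q j \<omega>}"
    assume "\<Omega>.prob ?S \<noteq> 0"
    then have pos: "0 < \<Omega>.prob ?S" using measure_nonneg[of \<Omega> ?S] by linarith
    have le: "\<Omega>.prob ?S \<le> exp (- (\<Sum>k<K. p (J + k)))" for K
      by (rule order_trans[OF \<Omega>.finite_measure_mono Rp[OF J]]) (auto simp: R_def)
    have bound: "(\<Sum>k<K. p (J + k)) \<le> - ln (\<Omega>.prob ?S)" for K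
    proof -
      have "ln (\<Omega>.prob ?S) \<le> ln (exp (- (\<Sum>k<K. p (J + k))))" using le[of K] pos by (subst ln_le_cancel_iff) auto
      then show ?thesis by simp
    qed
    have "summable (\<lambda>k. p (J + k))"
      by (rule bounded_imp_summable[where B="- ln (\<Omega>.prob ?S)"]) (use bound[of "Suc _"] p1 in \<open>auto simp: lessThan_Suc_atMost\<close>)
    then have "summable p" using summable_iff_shift[of p J] by (simp add: add.commute)
    with div show False by simp
  qed
  have "AE \<omega> in \<Omega>. \<forall>J\<in>{j0..}. \<not> (\<forall>j\<ge>J. \<not> Q j \<omega>)"
    unfolding AE_ball_countable[OF countableI_type]
  proof
    fix J assume "J \<in> {j0..}"
    then have "\<Omega>.prob {\<omega> \<in> space \<Omega>. \<forall>j\<ge>J. \<not> Q j \<omega>} = 0" by (simp add: zero)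
    then have "{\<omega> \<in> space \<Omega>. \<forall>j\<ge>J. \<not> Q j \<omega>} \<in> null_sets \<Omega>"
      by (intro null_setsI) (auto simp: \<Omega>.emeasure_eq_measure)
    then show "AE \<omega> in \<Omega>. \<not> (\<forall>j\<ge>J. \<not> Q j \<omega>)"
      by (rule AE_I') auto
  qed
  then show ?thesis
  proof eventually_elim
    case (elim \<omega>)
    show ?case
      unfolding frequently_sequentially Q_def[symmetric]
    proof
      fix J
      obtain j where "j \<ge> max J j0" "Q j \<omega>" using elim[rule_format, of "max J j0"] by auto
      then show "\<exists>j\<ge>J. Q j \<omega>" by (intro exI[of _ j]) auto
    qed
  qed
qed

end

context averaged_observable
begin

text \<open>If bad starting points existed at arbitrarily large times, choosing them as
  \<open>xs\<close> would contradict the central limit theorem with moving starting points.\<close>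

lemma uniform_tail:
  assumes "0 < s2" "0 \<le> a"
  obtains m0 where "\<forall>m\<ge>m0. \<forall>x. exp (- ((a + 1)\<^sup>2 / 2 + 2)) \<le> \<Omega>.prob {\<omega> \<in> space \<Omega>. a * sqrt s2 * sqrt (real m) \<le> mart g m x \<omega>}"
proof (rule ccontr)
  assume no: "\<not> thesis"
  define p where "p = exp (- ((a + 1)\<^sup>2 / 2 + 2))"
  define P where "P m x = \<Omega>.prob {\<omega> \<in> space \<Omega>. a * sqrt s2 * sqrt (real m) \<le> mart g m x \<omega>}" for m x
  have bad: "\<exists>m\<ge>m0. \<exists>x. P m x < p" for m0
    using no that[of m0] unfolding P_def p_def by (meson not_le)
  \<comment> \<open>An arbitrary point when no starting point is bad at time m; only a bad time is
    examined below.\<close>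
  define xs where "xs m = (SOME x. P m x < p)" for m
  let ?D = "\<lambda>n. distr \<Omega> borel (\<lambda>\<omega>. 1 / sqrt (real n) * mart g n (xs n) \<omega>)"
  have "weak_conv_m ?D (normal_distribution 0 s2)"
    by (rule central_limit[where D=0 and xs=xs]) auto
  then have "(\<lambda>n. cdf (?D n) (a * sqrt s2)) \<longlonglongrightarrow> cdf (normal_distribution 0 s2) (a * sqrt s2)"
    unfolding weak_conv_m_def weak_conv_def using normal_distribution_tail(2)[OF assms] by blast
  then have "\<forall>\<^sub>F n in sequentially. cdf (?D n) (a * sqrt s2) < 1 - p"
    by (rule order_tendstoD(2)) (use normal_distribution_tail(1)[OF assms] in \<open>simp add: p_def\<close>)
  then obtain m0 where m0: "\<And>n. n \<ge> m0 \<Longrightarrow> cdf (?D n) (a * sqrt s2) < 1 - p"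
    unfolding eventually_sequentially by blast
  obtain m where m: "m \<ge> max m0 1" "\<exists>x. P m x < p" using bad by blast
  from someI_ex[OF m(2)] have x: "P m (xs m) < p" by (simp add: xs_def)
  have sq: "0 < sqrt (real m)" using m(1) by simp
  have "cdf (?D m) (a * sqrt s2) = \<Omega>.prob {\<omega> \<in> space \<Omega>. 1 / sqrt (real m) * mart g m (xs m) \<omega> \<le> a * sqrt s2}"
    unfolding cdf_def by (subst measure_distr) (auto simp: vimage_def Int_def conj_commute)
  also have "\<dots> \<ge> 1 - P m (xs m)"
  proof -
    have "1 - P m (xs m) = \<Omega>.prob (space \<Omega> - {\<omega> \<in> space \<Omega>. a * sqrt s2 * sqrt (real m) \<le> mart g m (xs m) \<omega>})"
      unfolding P_def by (subst \<Omega>.prob_compl) auto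
    also have "\<dots> \<le> \<Omega>.prob {\<omega> \<in> space \<Omega>. 1 / sqrt (real m) * mart g m (xs m) \<omega> \<le> a * sqrt s2}"
      using sq by (intro \<Omega>.finite_measure_mono) (auto simp: field_simps not_le)
    finally show ?thesis .
  qed
  finally have "1 - P m (xs m) \<le> cdf (?D m) (a * sqrt s2)" .
  then show False using m0[of m] m(1) x by simp
qed

text \<open>Block j gains about \<sigma> sqrt (2 L ln j), with L its length: a probability of order
  1 / j is just enough for infinitely many successes. The value before the block, possibly very
  negative, is bounded by the upper half applied to \<open>- g\<close>.\<close>

theorem lil_lower:
  assumes s2: "0 < s2" and c: "0 \<le> c" "c < sqrt s2"
  shows "AE \<omega> in \<Omega>. \<exists>\<^sub>F n in sequentially. c * lil_scale n \<le> mart g n x \<omega>"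
proof -
  define \<sigma> where "\<sigma> = sqrt s2"
  have \<sigma>: "0 < \<sigma>" "c < \<sigma>" using s2 c by (auto simp: \<sigma>_def)
  \<comment> \<open>For large a the losses disappear: the exponent
    \<open>((a + 1)^2 + 4) / 2\<close> of the tail bound against \<open>a^2 / 2\<close>, and the
    tolerance 1 / a for rounding and for ln ln.\<close>
  have "((\<lambda>a::real. a * sqrt ((1 - 1 / a) / ((a + 1)\<^sup>2 + 4)) / (1 + 1 / a)) \<longlongrightarrow> 1) at_top"
    by real_asymp
  then have "\<forall>\<^sub>F a in at_top. c / \<sigma> < a * sqrt ((1 - 1 / a) / ((a + 1)\<^sup>2 + 4)) / (1 + 1 / a) \<and> (1::real) < a"
    using \<sigma> by (intro eventually_conj order_tendstoD(1)[where y=1] eventually_gt_at_top) auto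
  then obtain a :: real where a: "1 < a"
    "c / \<sigma> < a * sqrt ((1 - 1 / a) / ((a + 1)\<^sup>2 + 4)) / (1 + 1 / a)"
    by (auto dest: eventually_happens)
  define \<beta> where "\<beta> = (a + 1)\<^sup>2 / 2 + 2"
  define \<eta> where "\<eta> = 1 / a"
  have \<beta>: "0 < \<beta>" by (simp add: \<beta>_def add_nonneg_pos)
  have \<eta>: "0 < \<eta>" "\<eta> < 1" using a(1) by (auto simp: \<eta>_def)
  have main: "c * (sqrt 2 * (1 + \<eta>)) < a * \<sigma> * sqrt ((1 - \<eta>) / \<beta>)"
  proof -
    have "(a + 1)\<^sup>2 + 4 = 2 * \<beta>" by (simp add: \<beta>_def)
    then have "c / \<sigma> < a * sqrt ((1 - \<eta>) / (2 * \<beta>)) / (1 + \<eta>)"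
      using a(2) unfolding \<eta>_def[symmetric] by simp
    then have "c * (1 + \<eta>) < a * \<sigma> * sqrt ((1 - \<eta>) / (2 * \<beta>))" using \<sigma> \<eta> by (simp add: field_simps)
    then have "sqrt 2 * (c * (1 + \<eta>)) < sqrt 2 * (a * \<sigma> * sqrt ((1 - \<eta>) / (2 * \<beta>)))" by simp
    also have "\<dots> = a * \<sigma> * sqrt (2 * ((1 - \<eta>) / (2 * \<beta>)))" by (subst real_sqrt_mult[of 2]) simp
    also have "2 * ((1 - \<eta>) / (2 * \<beta>)) = (1 - \<eta>) / \<beta>" using \<beta> by (simp add: field_simps)
    finally show ?thesis by (simp add: mult_ac)
  qed
  have "0 \<le> a" using a(1) by simp
  from s2 this obtain m0 where "\<forall>m\<ge>m0. \<forall>x. exp (- ((a + 1)\<^sup>2 / 2 + 2)) \<le>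
      \<Omega>.prob {\<omega> \<in> space \<Omega>. a * sqrt s2 * sqrt (real m) \<le> mart g m x \<omega>}"
    by (rule uniform_tail)
  note m0 = this[folded \<beta>_def \<sigma>_def]
  \<comment> \<open>Each piece succeeds with probability at least \<open>exp (- \<beta>)\<close>, so
    ln j / \<beta> of them succeed together with probability at least 1 / j; rounding down keeps the
    series divergent.\<close>
  define k where "k j = nat \<lfloor>ln (real j) / \<beta>\<rfloor>" for j :: nat
  define L where "L j = k j * fact j" for j
  define N where "N j = (\<Sum>l<j. L l)" for j
  define y where "y j = real (k j) * (a * \<sigma> * sqrt (fact j))" for j
  have p: "exp (- \<beta>) ^ k j \<le> \<Omega>.prob {\<omega> \<in> space \<Omega>. y j \<le> mart g (L j) z \<omega>}" if "m0 \<le> j" for j z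
    unfolding y_def L_def
  proof (rule block_lower)
    have "m0 \<le> fact j" using that fact_ge_self[of j] by (rule order_trans)
    then show "exp (- \<beta>) \<le> \<Omega>.prob {\<omega> \<in> space \<Omega>. a * \<sigma> * sqrt (fact j) \<le> mart g (fact j) z \<omega>}" for z
      using m0 by (metis of_nat_fact)
  qed simp
  have nonsum: "\<not> summable (\<lambda>j. exp (- \<beta>) ^ k j)"
  proof
    assume "summable (\<lambda>j. exp (- \<beta>) ^ k j)"
    then have "summable (\<lambda>j. inverse (real j))"
    proof (rule summable_comparison_test_ev[rotated])
      show "\<forall>\<^sub>F j in sequentially. norm (inverse (real j)) \<le> exp (- \<beta>) ^ k j"
        using eventually_gt_at_top[of 0]
      proof eventually_elim
        case (elim j)
        have "0 \<le> ln (real j) / \<beta>" using elim \<beta> by simp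
        then have "real (k j) \<le> ln (real j) / \<beta>" unfolding k_def by linarith
        then have "real (k j) * \<beta> \<le> ln (real j)" using \<beta> by (simp add: field_simps)
        then have "exp (- ln (real j)) \<le> exp (real (k j) * - \<beta>)" by simp
        then show ?case using elim by (simp add: exp_of_nat_mult exp_minus power_inverse le_imp_inverse_le)
      qed
    qed
    then show False using not_summable_harmonic by blast
  qed
  have io: "AE \<omega> in \<Omega>. \<exists>\<^sub>F j in sequentially. y j \<le> mart g (N (Suc j)) x \<omega> - mart g (N j) x \<omega>"
    by (rule increments_infinitely_often[where p="\<lambda>j. exp (- \<beta>) ^ k j" and L=L and ?j0.0=m0, OF _ p _ nonsum])
       (auto simp: N_def)
  interpret neg: averaged_observable \<mu> f "\<lambda>x. - g x" G s2 by (rule averaged_observable_uminus)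
  have up: "AE \<omega> in \<Omega>. \<forall>\<^sub>F n in sequentially. - mart g n x \<omega> \<le> (\<sigma> + 1) * lil_scale n"
    using neg.lil_upper[of "\<sigma> + 1" x] unfolding mart_uminus \<sigma>_def by simp
  \<comment> \<open>\<open>sqrt (W j)\<close> is the common unit: the scale at the end of the block,
    the scale at its start and the gain are compared with it in \<open>b1\<close>, \<open>b2\<close>
    and \<open>b3\<close>.\<close>
  define W where "W j = real (L j) * ln (real j)" for j
  have kbig: "\<forall>\<^sub>F j in sequentially. (1 - \<eta>) * ln (real j) / \<beta> \<le> real (k j) \<and> 1 \<le> k j"
  proof -
    have "\<forall>\<^sub>F j in sequentially. (1 - \<eta>) * ln (real j) / \<beta> \<le> ln (real j) / \<beta> - 1"
    proof -
      have "\<forall>\<^sub>F j in sequentially. 1 \<le> \<eta> / \<beta> * ln (real j)" using \<eta> \<beta> by real_asymp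
      then show ?thesis by eventually_elim (simp add: algebra_simps diff_divide_distrib)
    qed
    moreover have "\<forall>\<^sub>F j in sequentially. 1 \<le> ln (real j) / \<beta>" using \<beta> by real_asymp
    ultimately show ?thesis
    proof eventually_elim
      case (elim j)
      have "ln (real j) / \<beta> - 1 \<le> real (k j)" unfolding k_def by linarith
      moreover have "1 \<le> k j" using elim(2) unfolding k_def by linarith
      ultimately show ?case using elim(1) by simp
    qed
  qed
  have kmono: "k l \<le> k j" if "l \<le> j" for l j
  proof (cases "l = 0")
    case True then show ?thesis by (simp add: k_def)
  next
    case False
    then have "ln (real l) / \<beta> \<le> ln (real j) / \<beta>" using that \<beta> by (intro divide_right_mono) auto
    then show ?thesis unfolding k_def by (intro nat_mono floor_mono)
  qed
  have Nj: "real j * real (N j) \<le> 2 * real (L j)" for j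
  proof -
    have "real (N j) \<le> (\<Sum>l<j. real (k j) * fact l)"
      unfolding N_def L_def of_nat_sum by (intro sum_mono) (simp add: kmono mult_right_mono)
    then have "real j * real (N j) \<le> real j * (real (k j) * (\<Sum>l<j. fact l))"
      by (intro mult_left_mono) (simp_all add: sum_distrib_left)
    also have "\<dots> = real (k j) * (real j * (\<Sum>l<j. fact l))" by simp
    also have "\<dots> \<le> real (k j) * (2 * fact j)" by (intro mult_left_mono sum_fact_le) simp
    finally show ?thesis by (simp add: L_def)
  qed
  have Ngrow: "\<forall>\<^sub>F j in sequentially. j \<le> N (Suc j)"
    using kbig
  proof eventually_elim
    case (elim j)
    have "j \<le> fact j" by (rule fact_ge_self)
    also have "\<dots> \<le> L j" using elim by (simp add: L_def)
    also have "\<dots> \<le> N (Suc j)" by (simp add: N_def)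
    finally show ?case .
  qed
  then have Nlim: "filterlim (\<lambda>j. N (Suc j)) at_top sequentially"
    by (rule filterlim_at_top_mono[OF filterlim_ident])
  then have Nlim': "filterlim N at_top sequentially" by (simp add: filterlim_sequentially_Suc)
  \<comment> \<open>The total length up to the end of block j is at most
    \<open>exp (2 * j * ln j)\<close>; the double logarithm reduces this to ln j up to the factor 1
    + \<eta>.\<close>
  have lnln: "\<forall>\<^sub>F j in sequentially. ln (ln (real (N (Suc j)))) \<le> (1 + \<eta>) * ln (real j)"
  proof -
    have e1: "\<forall>\<^sub>F j in sequentially. 4 * (ln (real j) / \<beta>) \<le> exp (real j * ln (real j))" using \<beta> by real_asymp
    have e2: "\<forall>\<^sub>F j in sequentially. ln (2 * (real j * ln (real j))) \<le> (1 + \<eta>) * ln (real j)" using \<eta> by real_asymp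
    have e3: "\<forall>\<^sub>F j in sequentially. 2 \<le> j" by (rule eventually_ge_at_top)
    have e4: "\<forall>\<^sub>F j in sequentially. 3 \<le> N (Suc j)" using Nlim by (simp add: filterlim_at_top)
    show ?thesis using e1 e2 e3 e4
    proof eventually_elim
      case (elim j)
      have "2 * real (N j) \<le> real j * real (N j)" using elim(3) by (intro mult_right_mono) auto
      then have "real (N j) \<le> real (L j)" using Nj[of j] by linarith
      then have "real (N (Suc j)) \<le> 2 * real (L j)" by (simp add: N_def)
      also have "\<dots> = 2 * real (k j) * fact j" by (simp add: L_def)
      also have "\<dots> \<le> (4 * (ln (real j) / \<beta>)) * real j ^ j"
      proof (rule mult_mono)
        have "0 \<le> ln (real j) / \<beta>" using elim(3) \<beta> by simp
        then have "real (k j) \<le> ln (real j) / \<beta>" unfolding k_def by linarith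
        then show "2 * real (k j) \<le> 4 * (ln (real j) / \<beta>)" using \<open>0 \<le> ln (real j) / \<beta>\<close> by linarith
        show "fact j \<le> real j ^ j" using fact_le_power[of j, where 'a=real] by simp
        show "0 \<le> 4 * (ln (real j) / \<beta>)" using \<open>0 \<le> ln (real j) / \<beta>\<close> by simp
      qed simp
      also have "\<dots> \<le> exp (real j * ln (real j)) * exp (real j * ln (real j))"
      proof (rule mult_mono)
        have "real j ^ j = exp (ln (real j) * real j)" using elim(3) by (simp add: powr_def flip: powr_realpow)
        then show "real j ^ j \<le> exp (real j * ln (real j))" by (simp add: mult.commute)
      qed (use elim(1) in auto)
      also have "\<dots> = exp (2 * (real j * ln (real j)))" by (simp add: exp_add[symmetric])
      finally have "ln (real (N (Suc j))) \<le> 2 * (real j * ln (real j))"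
        using elim(4) by (metis exp_le_cancel_iff exp_ln of_nat_0_less_iff less_le_trans zero_less_numeral)
      moreover have "0 < ln (real (N (Suc j)))" using elim(4) by simp
      ultimately have "ln (ln (real (N (Suc j)))) \<le> ln (2 * (real j * ln (real j)))"
        by (subst ln_le_cancel_iff) auto
      then show ?case using elim(2) by linarith
    qed
  qed
  \<comment> \<open>\<open>main\<close> leaves a positive gap on the right, while the past
    contributes order 1 / sqrt j in the unit \<open>sqrt (W j)\<close>.\<close>
  have small: "\<forall>\<^sub>F j in sequentially. (\<sigma> + 1) * sqrt (4 * (1 + \<eta>) / real j) \<le>
      a * \<sigma> * sqrt ((1 - \<eta>) / \<beta>) - c * (sqrt 2 * (1 + \<eta>))"
  proof -
    have "(\<lambda>j. 1 / real j) \<longlonglongrightarrow> 0" by (rule lim_1_over_n)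
    then have "(\<lambda>j. (\<sigma> + 1) * sqrt (4 * (1 + \<eta>) * (1 / real j))) \<longlonglongrightarrow> (\<sigma> + 1) * sqrt (4 * (1 + \<eta>) * 0)"
      by (intro tendsto_intros)
    then have "\<forall>\<^sub>F j in sequentially. (\<sigma> + 1) * sqrt (4 * (1 + \<eta>) * (1 / real j)) <
       a * \<sigma> * sqrt ((1 - \<eta>) / \<beta>) - c * (sqrt 2 * (1 + \<eta>))"
      by (rule order_tendstoD(2)) (use main in simp)
    then show ?thesis by eventually_elim simp
  qed
  have det: "\<forall>\<^sub>F j in sequentially. c * lil_scale (N (Suc j)) + (\<sigma> + 1) * lil_scale (N j) \<le> y j"
  proof -
    have "\<forall>\<^sub>F j in sequentially. 3 \<le> N j" using Nlim' by (simp add: filterlim_at_top)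
    moreover have "\<forall>\<^sub>F j in sequentially. 2 / real j \<le> \<eta> \<and> 1 < j" using \<eta> by (intro eventually_conj eventually_gt_at_top) real_asymp
    ultimately show ?thesis using kbig lnln small
    proof eventually_elim
      case (elim j)
      have j: "0 < real j" "0 < ln (real j)" using elim(2) by auto
      have W0: "0 \<le> W j" using j by (simp add: W_def)
      have ll0: "0 \<le> ln (ln (real (N j)))"
      proof -
        have "exp 1 \<le> real (N j)" using exp_le elim(1) by linarith
        then have "1 \<le> ln (real (N j))" using elim(1) by (simp add: ln_ge_iff)
        then show ?thesis by simp
      qed
      have NN: "N j \<le> N (Suc j)" by (simp add: N_def)
      have llmono: "ln (ln (real (N j))) \<le> ln (ln (real (N (Suc j))))"
        using elim(1) NN by (subst ln_le_cancel_iff) auto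
      have Njle: "real (N j) \<le> 2 / real j * real (L j)" using Nj[of j] j(1) by (simp add: field_simps)
      have NSle: "real (N (Suc j)) \<le> (1 + \<eta>) * real (L j)"
      proof -
        have "real (N j) \<le> \<eta> * real (L j)"
          using Njle elim(2) by (meson mult_right_mono of_nat_0_le_iff order_trans)
        then show ?thesis by (simp add: N_def algebra_simps)
      qed
      have b1: "lil_scale (N (Suc j)) \<le> sqrt 2 * (1 + \<eta>) * sqrt (W j)"
      proof -
        have "real (N (Suc j)) * ln (ln (real (N (Suc j)))) \<le> ((1 + \<eta>) * real (L j)) * ((1 + \<eta>) * ln (real j))"
          using NSle elim(4) ll0 llmono \<eta> by (intro mult_mono) auto
        then have "2 * real (N (Suc j)) * ln (ln (real (N (Suc j)))) \<le> 2 * (1 + \<eta>)\<^sup>2 * W j"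
          by (simp add: W_def power2_eq_square algebra_simps)
        then have "lil_scale (N (Suc j)) \<le> sqrt (2 * (1 + \<eta>)\<^sup>2 * W j)"
          unfolding lil_scale_def by (rule real_sqrt_le_mono)
        then show ?thesis using \<eta> by (simp add: real_sqrt_mult)
      qed
      have b2: "lil_scale (N j) \<le> sqrt (4 * (1 + \<eta>) / real j) * sqrt (W j)"
      proof -
        have "real (N j) * ln (ln (real (N j))) \<le> (2 / real j * real (L j)) * ((1 + \<eta>) * ln (real j))"
          using Njle elim(4) ll0 llmono \<eta> by (intro mult_mono) auto
        moreover have "4 * (1 + \<eta>) / real j * W j = 2 * ((2 / real j * real (L j)) * ((1 + \<eta>) * ln (real j)))"
          by (simp add: W_def)
        ultimately have "2 * real (N j) * ln (ln (real (N j))) \<le> 4 * (1 + \<eta>) / real j * W j"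
          by linarith
        then show ?thesis
          unfolding lil_scale_def real_sqrt_mult[symmetric] by (rule real_sqrt_le_mono)
      qed
      have b3: "a * \<sigma> * sqrt ((1 - \<eta>) / \<beta>) * sqrt (W j) \<le> y j"
      proof -
        have "(1 - \<eta>) / \<beta> * W j = ((1 - \<eta>) * ln (real j) / \<beta>) * (real (k j) * fact j)"
          by (simp add: W_def L_def algebra_simps)
        also have "\<dots> \<le> real (k j) * (real (k j) * fact j)" using elim(3) by (intro mult_right_mono) auto
        also have "\<dots> = (real (k j))\<^sup>2 * fact j" by (simp add: power2_eq_square)
        finally have "sqrt ((1 - \<eta>) / \<beta> * W j) \<le> sqrt ((real (k j))\<^sup>2 * fact j)" by (rule real_sqrt_le_mono)
        also have "\<dots> = real (k j) * sqrt (fact j)" by (simp add: real_sqrt_mult)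
        finally have "sqrt ((1 - \<eta>) / \<beta>) * sqrt (W j) \<le> real (k j) * sqrt (fact j)" by (simp only: real_sqrt_mult)
        then have "a * \<sigma> * (sqrt ((1 - \<eta>) / \<beta>) * sqrt (W j)) \<le> a * \<sigma> * (real (k j) * sqrt (fact j))"
          using a(1) \<sigma>(1) by (intro mult_left_mono) auto
        then show ?thesis by (simp add: y_def mult_ac)
      qed
      have "c * lil_scale (N (Suc j)) + (\<sigma> + 1) * lil_scale (N j) \<le>
          c * (sqrt 2 * (1 + \<eta>) * sqrt (W j)) + (\<sigma> + 1) * (sqrt (4 * (1 + \<eta>) / real j) * sqrt (W j))"
        using c(1) \<sigma>(1) by (intro add_mono mult_left_mono b1 b2) auto
      also have "\<dots> = (c * (sqrt 2 * (1 + \<eta>)) + (\<sigma> + 1) * sqrt (4 * (1 + \<eta>) / real j)) * sqrt (W j)"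
        by (simp only: distrib_right mult.assoc)
      also have "\<dots> \<le> (a * \<sigma> * sqrt ((1 - \<eta>) / \<beta>)) * sqrt (W j)"
        using elim(5) W0 by (intro mult_right_mono) auto
      also have "\<dots> \<le> y j" by (rule b3)
      finally show ?case .
    qed
  qed
  from io up show ?thesis
  proof eventually_elim
    case (elim \<omega>)
    have "\<forall>\<^sub>F j in sequentially. - mart g (N j) x \<omega> \<le> (\<sigma> + 1) * lil_scale (N j)"
      using elim(2) Nlim' by (rule eventually_compose_filterlim)
    with det have "\<forall>\<^sub>F j in sequentially. y j \<le> mart g (N (Suc j)) x \<omega> - mart g (N j) x \<omega> \<longrightarrow>
        c * lil_scale (N (Suc j)) \<le> mart g (N (Suc j)) x \<omega>"
      by eventually_elim linarith
    then have fr: "\<exists>\<^sub>F j in sequentially. c * lil_scale (N (Suc j)) \<le> mart g (N (Suc j)) x \<omega>"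
      using elim(1) by (rule frequently_mp)
    show ?case
    proof (rule ccontr)
      assume "\<not> (\<exists>\<^sub>F n in sequentially. c * lil_scale n \<le> mart g n x \<omega>)"
      then have "\<forall>\<^sub>F n in sequentially. \<not> c * lil_scale n \<le> mart g n x \<omega>" by (simp add: not_frequently)
      then have "\<forall>\<^sub>F j in sequentially. \<not> c * lil_scale (N (Suc j)) \<le> mart g (N (Suc j)) x \<omega>"
        using Nlim by (rule eventually_compose_filterlim)
      then show False using fr by (simp add: frequently_def)
    qed
  qed
qed

end

section \<open>Limit laws for Hoelder observables\<close>

context random_maps
begin

lemma measurable_joint:
  fixes F :: "(nat \<Rightarrow> 'i) \<Rightarrow> 'b \<Rightarrow> real"
  assumes sets: "sets \<nu> = sets borel" and m: "\<And>x. (\<lambda>\<omega>. F \<omega> x) \<in> borel_measurable \<Omega>"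
    and c: "\<And>\<omega>. \<omega> \<in> space \<Omega> \<Longrightarrow> continuous_on UNIV (F \<omega>)"
  shows "(\<lambda>z. F (fst z) (snd z)) \<in> borel_measurable (\<Omega> \<Otimes>\<^sub>M \<nu>)"
proof (rule borel_measurable_caratheodory[OF separable, where g="\<lambda>z. F (fst z)"])
  show "snd \<in> \<Omega> \<Otimes>\<^sub>M \<nu> \<rightarrow>\<^sub>M borel" using measurable_snd[of \<Omega> \<nu>] sets by (simp cong: measurable_cong_sets)
  show "(\<lambda>z. F (fst z) y) \<in> borel_measurable (\<Omega> \<Otimes>\<^sub>M \<nu>)" for y
    by (rule measurable_compose[OF measurable_fst m])
  show "continuous_on UNIV (F (fst z))" if "z \<in> space (\<Omega> \<Otimes>\<^sub>M \<nu>)" for z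
    using that by (intro c) (auto simp: space_pair_measure)
qed

lemma birkhoff_sum_measurable:
  assumes "continuous_on UNIV h"
  shows "(\<lambda>\<omega>. birkhoff_sum f h n x \<omega>) \<in> borel_measurable \<Omega>"
  unfolding birkhoff_sum_def by (intro borel_measurable_sum measurable_continuous_iter assms)

lemma birkhoff_sum_continuous:
  assumes "continuous_on UNIV h" "\<omega> \<in> space \<Omega>"
  shows "continuous_on UNIV (\<lambda>x. birkhoff_sum f h n x \<omega>)"
  unfolding birkhoff_sum_def
  by (intro continuous_intros continuous_on_compose2[OF assms(1) rds_iter_continuous[OF assms(2)]]) auto

end

section \<open>Second moments and the asymptotic variance\<close>

context bounded_observable
begin

lemma mart_continuous:
  assumes "\<omega> \<in> space \<Omega>" shows "continuous_on UNIV (\<lambda>x. mart g n x \<omega>)"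
  unfolding addf_def
  by (intro continuous_intros continuous_on_compose2[OF mart_diff_continuous rds_iter_continuous[OF assms]]
      component_in_space[OF assms]) auto

lemma mart_square_bound: "(mart g n x \<omega>)\<^sup>2 \<le> (real n * (2 * G))\<^sup>2"
  using mart_bound[of n x \<omega>] G_nonneg by (simp flip: abs_le_square_iff add: abs_mult)

lemma mart_integrable: "integrable \<Omega> (\<lambda>\<omega>. mart g n x \<omega>)"
  by (rule \<Omega>.integrable_const_bound[where B="real n * (2 * G)"]) (use mart_bound in auto)

lemma mart_square_integrable: "integrable \<Omega> (\<lambda>\<omega>. (mart g n x \<omega>)\<^sup>2)"
  by (rule \<Omega>.integrable_const_bound[where B="(real n * (2 * G))\<^sup>2", OF AE_I2])
     (use mart_square_bound[of n x] in \<open>simp_all only: real_norm_def abs_power2\<close>, measurable)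

lemma mart_mean: "(\<integral>\<omega>. mart g n x \<omega> \<partial>\<Omega>) = 0"
proof (induction n arbitrary: x)
  case (Suc n)
  have "(\<integral>\<omega>. mart g (Suc n) x \<omega> \<partial>\<Omega>) = (\<integral>i. (\<integral>\<omega>. mart g (Suc n) x (case_nat i \<omega>) \<partial>\<Omega>) \<partial>\<mu>)"
    by (rule integral_shift(1)[OF mart_measurable, where C="real (Suc n) * (2 * G)"])
       (simp only: real_norm_def mart_bound)
  also have "\<dots> = (\<integral>i. mart_diff g i x \<partial>\<mu>)"
    unfolding addf_case_nat using mart_integrable by (simp add: \<Omega>.prob_space Suc)
  finally show ?case by (simp add: mart_diff_integral)
qed (simp add: addf_def[abs_def])

text \<open>Orthogonality of increments: after splitting off the first letter the cross term
  vanishes, since the rest of the martingale has mean zero from every starting point.\<close>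

lemma mart_second_moment: "(\<integral>\<omega>. (mart g n x \<omega>)\<^sup>2 \<partial>\<Omega>) = (\<Sum>k<n. (markov_op ^^ k) (cond_var g) x)"
proof (induction n arbitrary: x)
  case (Suc n)
  note pi = integrable_map[OF markov_pow_continuous[OF cond_var_continuous cond_var_bound]
      markov_pow_bound[OF cond_var_continuous cond_var_bound]]
  have m: "(\<lambda>\<omega>. (mart g (Suc n) x \<omega>)\<^sup>2) \<in> borel_measurable \<Omega>" by measurable
  have inner: "(\<integral>\<omega>. (mart_diff g i x + mart g n (f i x) \<omega>)\<^sup>2 \<partial>\<Omega>) =
      (mart_diff g i x)\<^sup>2 + (\<Sum>k<n. (markov_op ^^ k) (cond_var g) (f i x))" for i
  proof -
    have "(\<integral>\<omega>. (mart_diff g i x + mart g n (f i x) \<omega>)\<^sup>2 \<partial>\<Omega>) =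
       (\<integral>\<omega>. (mart_diff g i x)\<^sup>2 + 2 * mart_diff g i x * mart g n (f i x) \<omega> + (mart g n (f i x) \<omega>)\<^sup>2 \<partial>\<Omega>)"
      by (simp add: power2_sum algebra_simps)
    also have "\<dots> = (mart_diff g i x)\<^sup>2 + (\<integral>\<omega>. (mart g n (f i x) \<omega>)\<^sup>2 \<partial>\<Omega>)"
      using mart_integrable mart_square_integrable by (simp add: \<Omega>.prob_space mart_mean)
    finally show ?thesis by (simp add: Suc)
  qed
  have "(\<integral>\<omega>. (mart g (Suc n) x \<omega>)\<^sup>2 \<partial>\<Omega>) = (\<integral>i. (\<integral>\<omega>. (mart g (Suc n) x (case_nat i \<omega>))\<^sup>2 \<partial>\<Omega>) \<partial>\<mu>)"
    by (rule integral_shift(1)[OF m, where C="(real (Suc n) * (2 * G))\<^sup>2"])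
       (simp only: real_norm_def abs_power2 mart_square_bound)
  also have "\<dots> = (\<integral>i. (mart_diff g i x)\<^sup>2 + (\<Sum>k<n. (markov_op ^^ k) (cond_var g) (f i x)) \<partial>\<mu>)"
    unfolding addf_case_nat inner ..
  also have "\<dots> = cond_var g x + (\<Sum>k<n. \<integral>i. (markov_op ^^ k) (cond_var g) (f i x) \<partial>\<mu>)"
    using mart_diff_square_integrable pi
    by (simp add: Bochner_Integration.integral_sum cond_var_def[of g x])
  also have "\<dots> = cond_var g x + (\<Sum>k<n. (markov_op ^^ Suc k) (cond_var g) x)"
    by (simp add: markov_op_def[of "(markov_op ^^ _) (cond_var g)"])
  finally show ?case unfolding sum.lessThan_Suc_shift by simp
qed simp

text \<open>Started from \<nu>, the second moment of the martingale is exactly n times the limit,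
  because the integral of \<open>cond_var g\<close> is unchanged by powers of the Markov operator.
  Only the bounded difference to \<open>B n\<close> is estimated.\<close>

lemma variance_tendsto:
  assumes st: "stationary f \<mu> \<nu>"
    and Bm: "\<And>n. (\<lambda>z. B n (snd z) (fst z)) \<in> borel_measurable (\<Omega> \<Otimes>\<^sub>M \<nu>)"
    and close: "\<And>n x \<omega>. \<bar>B n x \<omega> - mart g n x \<omega>\<bar> \<le> D"
  shows "(\<lambda>n. 1 / real n * (\<integral>(\<omega>, x). (B n x \<omega>)\<^sup>2 \<partial>(\<Omega> \<Otimes>\<^sub>M \<nu>))) \<longlonglongrightarrow> (\<integral>x. cond_var g x \<partial>\<nu>)"
proof -
  interpret nu: prob_space \<nu> using st by (simp add: stationary_def)
  interpret P: pair_prob_space \<Omega> \<nu> by unfold_locales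
  have sets: "sets \<nu> = sets borel" using st by (simp add: stationary_def)
  have D: "0 \<le> D" using order_trans[OF abs_ge_zero close] by blast
  define s2 where "s2 = (\<integral>x. cond_var g x \<partial>\<nu>)"
  define M where "M n z = mart g n (snd z) (fst z)" for n and z :: "(nat \<Rightarrow> 'i) \<times> 'b"
  define B' where "B' n z = B n (snd z) (fst z)" for n and z :: "(nat \<Rightarrow> 'i) \<times> 'b"
  have Mm[measurable]: "M n \<in> borel_measurable (\<Omega> \<Otimes>\<^sub>M \<nu>)" for n
    unfolding M_def[abs_def] by (rule measurable_joint[OF sets mart_measurable mart_continuous])
  have Bm'[measurable]: "B' n \<in> borel_measurable (\<Omega> \<Otimes>\<^sub>M \<nu>)" for n
    unfolding B'_def[abs_def] by (rule Bm)
  have BM: "\<bar>B' n z - M n z\<bar> \<le> D" for n z unfolding B'_def M_def by (rule close)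
  have Mb: "\<bar>M n z\<bar> \<le> real n * (2 * G)" for n z unfolding M_def by (rule mart_bound)
  have Mi: "integrable (\<Omega> \<Otimes>\<^sub>M \<nu>) (\<lambda>z. (M n z)\<^sup>2)" for n
  proof (rule P.P.integrable_const_bound[where B="(real n * (2 * G))\<^sup>2"])
    have "(M n z)\<^sup>2 \<le> (real n * (2 * G))\<^sup>2" for z unfolding M_def by (rule mart_square_bound)
    then show "AE z in \<Omega> \<Otimes>\<^sub>M \<nu>. norm ((M n z)\<^sup>2) \<le> (real n * (2 * G))\<^sup>2"
      by (intro AE_I2) (simp only: real_norm_def abs_power2)
  qed measurable
  have Bi: "integrable (\<Omega> \<Otimes>\<^sub>M \<nu>) (\<lambda>z. (B' n z)\<^sup>2)" for n
  proof (rule P.P.integrable_const_bound[where B="(real n * (2 * G) + D)\<^sup>2"])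
    have "\<bar>B' n z\<bar> \<le> real n * (2 * G) + D" for z using BM[of n z] Mb[of n z] by linarith
    then have "\<bar>B' n z\<bar>\<^sup>2 \<le> (real n * (2 * G) + D)\<^sup>2" for z by (intro power_mono) auto
    then show "AE z in \<Omega> \<Otimes>\<^sub>M \<nu>. norm ((B' n z)\<^sup>2) \<le> (real n * (2 * G) + D)\<^sup>2" by simp
  qed measurable
  have second: "(\<integral>z. (M n z)\<^sup>2 \<partial>(\<Omega> \<Otimes>\<^sub>M \<nu>)) = real n * s2" for n
  proof -
    have "(\<integral>z. (M n z)\<^sup>2 \<partial>(\<Omega> \<Otimes>\<^sub>M \<nu>)) = (\<integral>x. (\<integral>\<omega>. (M n (\<omega>, x))\<^sup>2 \<partial>\<Omega>) \<partial>\<nu>)"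
      using P.integral_snd[of "\<lambda>\<omega> x. (M n (\<omega>, x))\<^sup>2"] Mi[of n] by (simp add: case_prod_beta')
    also have "\<dots> = (\<integral>x. (\<Sum>k<n. (markov_op ^^ k) (cond_var g) x) \<partial>\<nu>)"
      by (simp add: M_def mart_second_moment)
    also have "\<dots> = (\<Sum>k<n. \<integral>x. (markov_op ^^ k) (cond_var g) x \<partial>\<nu>)"
      by (rule Bochner_Integration.integral_sum) (rule stationary_integrable[OF st
        markov_pow_continuous[OF cond_var_continuous cond_var_bound] markov_pow_bound[OF cond_var_continuous cond_var_bound]])
    also have "\<dots> = real n * s2"
      by (simp add: stationary_integral_pow[OF st cond_var_continuous cond_var_bound] s2_def)
    finally show ?thesis .
  qed
  have "(\<lambda>n. 1 / real n * (\<integral>z. (B' n z)\<^sup>2 \<partial>(\<Omega> \<Otimes>\<^sub>M \<nu>)) - s2) \<longlonglongrightarrow> 0"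
  proof (rule Lim_null_comparison)
    have "(\<lambda>n. 1 / sqrt (real n)) \<longlonglongrightarrow> 0" by real_asymp
    moreover have "(\<lambda>n. 1 / real n) \<longlonglongrightarrow> 0" by (rule lim_1_over_n)
    ultimately have "(\<lambda>n. D\<^sup>2 * (1 / real n) + D * (s2 + 1) * (1 / sqrt (real n))) \<longlonglongrightarrow> D\<^sup>2 * 0 + D * (s2 + 1) * 0"
      by (intro tendsto_intros)
    then show "(\<lambda>n. D\<^sup>2 * (1 / real n) + D * (s2 + 1) * (1 / sqrt (real n))) \<longlonglongrightarrow> 0" by simp
    show "\<forall>\<^sub>F n in sequentially. norm (1 / real n * (\<integral>z. (B' n z)\<^sup>2 \<partial>(\<Omega> \<Otimes>\<^sub>M \<nu>)) - s2)
        \<le> D\<^sup>2 * (1 / real n) + D * (s2 + 1) * (1 / sqrt (real n))"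
      using eventually_gt_at_top[of 0]
    proof eventually_elim
      case (elim n)
      \<comment> \<open>The weight that balances 2 |M| \<le> M^2 / r + r: both terms then have mean
        of order sqrt n.\<close>
      define r where "r = sqrt (real n)"
      have r: "0 < r" "real n = r * r" using elim by (auto simp: r_def)
      have pt: "\<bar>(B' n z)\<^sup>2 - (M n z)\<^sup>2\<bar> \<le> D\<^sup>2 + D * ((M n z)\<^sup>2 / r + r)" for z
      proof -
        have "(B' n z)\<^sup>2 - (M n z)\<^sup>2 = (B' n z - M n z) * (B' n z + M n z)"
          by (simp add: power2_eq_square algebra_simps)
        also have "\<bar>\<dots>\<bar> \<le> D * (D + 2 * \<bar>M n z\<bar>)"
          unfolding abs_mult using BM[of n z] D by (intro mult_mono) auto
        also have "2 * \<bar>M n z\<bar> \<le> (M n z)\<^sup>2 / r + r"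
        proof -
          have "(\<bar>M n z\<bar> - r)\<^sup>2 = (M n z)\<^sup>2 + r * r - 2 * \<bar>M n z\<bar> * r"
            by (simp add: power2_eq_square algebra_simps)
          moreover have "0 \<le> (\<bar>M n z\<bar> - r)\<^sup>2" by (rule zero_le_power2)
          ultimately have "2 * \<bar>M n z\<bar> * r \<le> (M n z)\<^sup>2 + r * r" by linarith
          then show ?thesis using r(1) by (simp add: field_simps)
        qed
        finally show ?thesis using D by (simp add: power2_eq_square distrib_left mult_left_mono)
      qed
      have "\<bar>(\<integral>z. (B' n z)\<^sup>2 \<partial>(\<Omega> \<Otimes>\<^sub>M \<nu>)) - real n * s2\<bar> = \<bar>\<integral>z. (B' n z)\<^sup>2 - (M n z)\<^sup>2 \<partial>(\<Omega> \<Otimes>\<^sub>M \<nu>)\<bar>"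
        using Bi Mi by (simp add: second)
      also have "\<dots> \<le> (\<integral>z. \<bar>(B' n z)\<^sup>2 - (M n z)\<^sup>2\<bar> \<partial>(\<Omega> \<Otimes>\<^sub>M \<nu>))" by (rule integral_abs_bound)
      also have "\<dots> \<le> (\<integral>z. D\<^sup>2 + D * ((M n z)\<^sup>2 / r + r) \<partial>(\<Omega> \<Otimes>\<^sub>M \<nu>))"
        using Bi[of n] Mi[of n] pt by (intro integral_mono) auto
      also have "\<dots> = D\<^sup>2 + D * (real n * s2 / r + r)"
        using Mi[of n] by (simp add: P.P.prob_space second)
      also have "\<dots> = real n * (D\<^sup>2 * (1 / real n) + D * (s2 + 1) * (1 / r))"
        using r by (simp add: field_simps)
      finally have "\<bar>(\<integral>z. (B' n z)\<^sup>2 \<partial>(\<Omega> \<Otimes>\<^sub>M \<nu>)) - real n * s2\<bar> \<le>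
          real n * (D\<^sup>2 * (1 / real n) + D * (s2 + 1) * (1 / r))" .
      moreover have "\<bar>(\<integral>z. (B' n z)\<^sup>2 \<partial>(\<Omega> \<Otimes>\<^sub>M \<nu>)) - real n * s2\<bar> =
          real n * \<bar>1 / real n * (\<integral>z. (B' n z)\<^sup>2 \<partial>(\<Omega> \<Otimes>\<^sub>M \<nu>)) - s2\<bar>"
      proof -
        have "(\<integral>z. (B' n z)\<^sup>2 \<partial>(\<Omega> \<Otimes>\<^sub>M \<nu>)) - real n * s2 = real n * (1 / real n * (\<integral>z. (B' n z)\<^sup>2 \<partial>(\<Omega> \<Otimes>\<^sub>M \<nu>)) - s2)"
          using elim by (simp add: right_diff_distrib)
        then show ?thesis by (simp only: abs_mult abs_of_nat)
      qed
      ultimately show ?case using elim by (simp add: r_def)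
    qed
  qed
  then have "(\<lambda>n. 1 / real n * (\<integral>z. (B' n z)\<^sup>2 \<partial>(\<Omega> \<Otimes>\<^sub>M \<nu>))) \<longlonglongrightarrow> s2" by (rule LIM_zero_cancel)
  then show ?thesis by (simp add: B'_def s2_def case_prod_beta')
qed

end

text \<open>The slack runs through 1 / (k + 1) so that countably many almost sure statements
  suffice; the bounded error disappears because \<open>L\<close> tends to infinity.\<close>

lemma limsup_eq_by_scale:
  fixes b M L :: "nat \<Rightarrow> real"
  assumes close: "\<And>n. \<bar>b n - M n\<bar> \<le> D" and L: "filterlim L at_top sequentially"
    and up: "\<And>k. \<forall>\<^sub>F n in sequentially. M n \<le> (\<sigma> + inverse (real (Suc k))) * L n"
    and lo: "\<And>k. \<exists>\<^sub>F n in sequentially. (\<sigma> - inverse (real (Suc k))) * L n \<le> M n"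
  shows "limsup (\<lambda>n. ereal (1 / L n * b n)) = ereal \<sigma>"
proof (rule antisym)
  have Dsmall: "\<forall>\<^sub>F n in sequentially. 0 < L n \<and> D \<le> e * L n" if "0 < e" for e
  proof -
    have "\<forall>\<^sub>F n in sequentially. max 1 (D / e) \<le> L n" using L unfolding filterlim_at_top by blast
    then show ?thesis
    proof eventually_elim
      case (elim n)
      then have "D / e \<le> L n" "0 < L n" by auto
      then show ?case using that by (simp add: field_simps)
    qed
  qed
  show "limsup (\<lambda>n. ereal (1 / L n * b n)) \<le> ereal \<sigma>"
  proof (rule ccontr)
    assume "\<not> limsup (\<lambda>n. ereal (1 / L n * b n)) \<le> ereal \<sigma>"
    then have "ereal \<sigma> < limsup (\<lambda>n. ereal (1 / L n * b n))" by (rule not_le_imp_less)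
    then obtain r where r: "ereal \<sigma> < ereal r" "ereal r < limsup (\<lambda>n. ereal (1 / L n * b n))"
      by (blast dest: ereal_dense2)
    define e where "e = (r - \<sigma>) / 2"
    have e: "0 < e" using r(1) by (simp add: e_def)
    obtain k where k: "inverse (real (Suc k)) < e" using reals_Archimedean[OF e] by blast
    have "\<forall>\<^sub>F n in sequentially. ereal (1 / L n * b n) \<le> ereal r"
      using up[of k] Dsmall[OF e]
    proof eventually_elim
      case (elim n)
      have "b n \<le> M n + D" using close[of n] by linarith
      also have "\<dots> \<le> (\<sigma> + inverse (real (Suc k))) * L n + e * L n" using elim by linarith
      also have "\<dots> \<le> (\<sigma> + e) * L n + e * L n" using k elim by (intro add_right_mono mult_right_mono) auto
      also have "\<dots> = r * L n" by (simp add: e_def field_simps)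
      finally show ?case using elim by (simp add: field_simps)
    qed
    then have "limsup (\<lambda>n. ereal (1 / L n * b n)) \<le> ereal r" by (rule Limsup_bounded)
    with r(2) show False by simp
  qed
  show "ereal \<sigma> \<le> limsup (\<lambda>n. ereal (1 / L n * b n))"
  proof (rule ccontr)
    assume "\<not> ereal \<sigma> \<le> limsup (\<lambda>n. ereal (1 / L n * b n))"
    then have "limsup (\<lambda>n. ereal (1 / L n * b n)) < ereal \<sigma>" by (rule not_le_imp_less)
    then obtain r where r: "limsup (\<lambda>n. ereal (1 / L n * b n)) < ereal r" "ereal r < ereal \<sigma>"
      by (blast dest: ereal_dense2)
    define e where "e = (\<sigma> - r) / 2"
    have e: "0 < e" using r(2) by (simp add: e_def)
    obtain k where k: "inverse (real (Suc k)) < e" using reals_Archimedean[OF e] by blast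
    have "\<forall>\<^sub>F n in sequentially. \<not> (\<sigma> - inverse (real (Suc k))) * L n \<le> M n"
      using Limsup_lessD[OF r(1)] Dsmall[OF e]
    proof eventually_elim
      case (elim n)
      show ?case
      proof
        assume "(\<sigma> - inverse (real (Suc k))) * L n \<le> M n"
        moreover have "(\<sigma> - e) * L n \<le> (\<sigma> - inverse (real (Suc k))) * L n"
          using k elim by (intro mult_right_mono) auto
        ultimately have "(\<sigma> - e) * L n - e * L n \<le> b n" using close[of n] elim by linarith
        moreover have "(\<sigma> - e) * L n - e * L n = r * L n" by (simp add: e_def field_simps)
        ultimately have "r * L n \<le> b n" by simp
        moreover have "b n < r * L n" using elim by (simp add: field_simps)
        ultimately show False by simp
      qed
    qed
    then show False using lo[of k] by (simp add: frequently_def)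
  qed
qed

context averaged_observable
begin

text \<open>For s2 = 0 the constant is negative and the upper half for \<open>- g\<close> gives the
  bound for all large n; otherwise a negative constant is replaced by 0.\<close>

lemma lil_lower_all:
  assumes "c < sqrt s2"
  shows "AE \<omega> in \<Omega>. \<exists>\<^sub>F n in sequentially. c * lil_scale n \<le> mart g n x \<omega>"
proof (cases "s2 = 0")
  case True
  interpret neg: averaged_observable \<mu> f "\<lambda>x. - g x" G s2 by (rule averaged_observable_uminus)
  have "AE \<omega> in \<Omega>. \<forall>\<^sub>F n in sequentially. - mart g n x \<omega> \<le> - c * lil_scale n"
    using neg.lil_upper[of "- c" x] assms True unfolding mart_uminus by simp
  then show ?thesis
  proof eventually_elim
    case (elim \<omega>)
    then have "\<forall>\<^sub>F n in sequentially. c * lil_scale n \<le> mart g n x \<omega>" by eventually_elim simp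
    then show ?case by (rule eventually_frequently[rotated]) simp
  qed
next
  case False
  then have s2: "0 < s2" using s2_nonneg by simp
  have "AE \<omega> in \<Omega>. \<exists>\<^sub>F n in sequentially. max 0 c * lil_scale n \<le> mart g n x \<omega>"
    using s2 assms by (intro lil_lower) auto
  then show ?thesis
  proof eventually_elim
    case (elim \<omega>)
    have "\<forall>\<^sub>F n in sequentially. max 0 c * lil_scale n \<le> mart g n x \<omega> \<longrightarrow> c * lil_scale n \<le> mart g n x \<omega>"
      using lil_scale_pos
    proof eventually_elim
      case (elim n)
      have "c * lil_scale n \<le> max 0 c * lil_scale n" using elim by (intro mult_right_mono) auto
      then show ?case by linarith
    qed
    then show ?case using elim by (rule frequently_mp)
  qed
qed

theorem law_of_iterated_logarithm:
  assumes close: "\<And>n \<omega>. \<bar>Y n \<omega> - mart g n x \<omega>\<bar> \<le> D"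
  shows "AE \<omega> in \<Omega>. limsup (\<lambda>n. ereal (1 / lil_scale n * Y n \<omega>)) = ereal (sqrt s2)"
proof -
  have "AE \<omega> in \<Omega>. \<forall>k. \<forall>\<^sub>F n in sequentially. mart g n x \<omega> \<le> (sqrt s2 + inverse (real (Suc k))) * lil_scale n"
    unfolding AE_all_countable by (intro allI lil_upper) simp
  moreover have "AE \<omega> in \<Omega>. \<forall>k. \<exists>\<^sub>F n in sequentially. (sqrt s2 - inverse (real (Suc k))) * lil_scale n \<le> mart g n x \<omega>"
    unfolding AE_all_countable by (intro allI lil_lower_all) simp
  ultimately show ?thesis
  proof eventually_elim
    case (elim \<omega>)
    have "filterlim lil_scale at_top sequentially" unfolding lil_scale_def[abs_def] by real_asymp
    with close show ?case by (rule limsup_eq_by_scale) (use elim in auto)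
  qed
qed

end

text \<open>Convergence of \<open>normalized_variance\<close> is part of the conclusion because
  \<open>lim\<close> carries no information on a divergent sequence. The central limit theorem is
  stated for centred sums, since the sums themselves divided by sqrt n have mean of order sqrt n
  unless \<nu>(h) = 0.\<close>

theorem theorem1p6:
  fixes f :: "'i \<Rightarrow> 'a::metric_space \<Rightarrow> 'a"
    and \<mu> :: "'i measure" and \<nu> :: "'a measure" and h :: "'a \<Rightarrow> real"
  assumes "compact (UNIV :: 'a set)"
    and "random_dynamical_system f \<mu>"
    and "proximal f (space \<mu>)"
    and "local_contraction f \<mu>"
    and "stationary f \<mu> \<nu>"
    and "hoelder_continuous h"
  shows "convergent (normalized_variance f \<mu> \<nu> h) \<and>
    (\<forall>x. AE \<omega> in sequence_measure \<mu>.
       (\<lambda>n. 1 / real n * birkhoff_sum f h n x \<omega>) \<longlonglongrightarrow> (\<integral>y. h y \<partial>\<nu>)) \<and>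
    (\<forall>x. weak_conv_m
       (\<lambda>n. distr (sequence_measure \<mu>) borel
          (\<lambda>\<omega>. 1 / sqrt (real n) * (birkhoff_sum f h n x \<omega> - real n * (\<integral>y. h y \<partial>\<nu>))))
       (normal_distribution 0 (asymptotic_variance f \<mu> \<nu> h))) \<and>
    (\<forall>x. AE \<omega> in sequence_measure \<mu>.
       limsup (\<lambda>n. ereal (1 / sqrt (2 * real n * ln (ln (real n))) *
          (birkhoff_sum f h n x \<omega> - real n * (\<integral>y. h y \<partial>\<nu>))))
       = ereal (sqrt (asymptotic_variance f \<mu> \<nu> h)))"
proof -
  note st = assms(5)
  interpret contracting_maps \<mu> f by (rule contracting_maps_rds[OF assms(1-4)])
  interpret nu: prob_space \<nu> using st by (simp add: stationary_def)
  define m where "m = (\<integral>y. h y \<partial>\<nu>)"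
  obtain \<alpha> C where \<alpha>: "0 < \<alpha>" and hC: "\<And>x y. \<bar>h x - h y\<bar> \<le> C * dist x y powr \<alpha>"
    using assms(6) unfolding hoelder_continuous_def by blast
  interpret dh: dist_power \<mu> f \<alpha> by unfold_locales (rule \<alpha>)
  have "\<bar>h x - h y\<bar> \<le> \<bar>C\<bar> * dist x y powr \<alpha>" for x y
    by (rule order_trans[OF hC]) (simp add: mult_right_mono)
  then obtain g where gc: "continuous_on UNIV g" and gh: "\<And>x. h x - m = g x - markov_op g x"
    using dh.poisson_equation[OF st, of "\<bar>C\<bar>" h] unfolding m_def by auto
  obtain G where G: "0 < G" "\<And>x. norm (g x) \<le> G" by (rule compact_continuous_bounded[OF assms(1) gc]) blast
  interpret bounded_observable \<mu> f g G by unfold_locales (auto intro: gc G(2)[simplified])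
  \<comment> \<open>Read off from the Poisson equation, whose solution is already known to be
    continuous.\<close>
  have hc: "continuous_on UNIV h"
  proof -
    have "h = (\<lambda>x. g x - markov_op g x + m)" using gh by (auto simp: fun_eq_iff algebra_simps)
    moreover have "continuous_on UNIV (\<lambda>x. g x - markov_op g x + m)"
      by (intro continuous_intros gc markov_op_continuous[OF gc g_bound])
    ultimately show ?thesis by simp
  qed
  define s2 where "s2 = (\<integral>x. cond_var g x \<partial>\<nu>)"
  \<comment> \<open>Half of \<epsilon> pays for replacing the conditional variance by a Lipschitz
    function, the other half for the resulting change of the \<nu>-mean; for the Lipschitz function
    the Poisson equation holds exactly, with exponent 1.\<close>
  interpret averaged_observable \<mu> f g G s2
  proof unfold_locales
    show "0 \<le> s2" unfolding s2_def by (simp add: cond_var_nonneg)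
    fix \<epsilon> :: real assume \<epsilon>: "0 < \<epsilon>"
    obtain L \<phi> where \<phi>: "0 \<le> L" "\<forall>x y. \<bar>\<phi> x - \<phi> y\<bar> \<le> L * dist x y" "\<forall>x. \<bar>cond_var g x - \<phi> x\<bar> \<le> \<epsilon> / 2"
      using lipschitz_approximation[OF assms(1) cond_var_continuous, of "\<epsilon> / 2"] \<epsilon> by auto
    interpret d1: dist_power \<mu> f 1 by unfold_locales simp
    obtain u where u: "continuous_on UNIV u" "\<And>x. \<phi> x - (\<integral>y. \<phi> y \<partial>\<nu>) = u x - markov_op u x"
      using d1.poisson_equation[OF st, of L \<phi>] \<phi> by auto
    obtain K where K: "0 < K" "\<And>x. norm (u x) \<le> K" by (rule compact_continuous_bounded[OF assms(1) u(1)]) blast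
    have \<phi>c: "continuous_on UNIV \<phi>"
    proof -
      define c where "c = (\<integral>y. \<phi> y \<partial>\<nu>)"
      have e: "\<phi> x = u x - markov_op u x + c" for x using u(2)[of x] by (simp add: c_def)
      have "continuous_on UNIV (\<lambda>x. u x - markov_op u x + c)"
        by (intro continuous_intros u(1) markov_op_continuous[OF u(1) K(2)])
      then show ?thesis unfolding e[symmetric] .
    qed
    obtain K' where K': "0 < K'" "\<And>x. norm (\<phi> x) \<le> K'" by (rule compact_continuous_bounded[OF assms(1) \<phi>c]) blast
    have i1: "integrable \<nu> (cond_var g)" by (rule stationary_integrable[OF st cond_var_continuous cond_var_bound])
    have i2: "integrable \<nu> \<phi>" by (rule stationary_integrable[OF st \<phi>c K'(2)])
    have "\<bar>s2 - (\<integral>y. \<phi> y \<partial>\<nu>)\<bar> \<le> (\<integral>y. \<bar>cond_var g y - \<phi> y\<bar> \<partial>\<nu>)"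
      unfolding s2_def using integral_abs_bound[of \<nu> "\<lambda>y. cond_var g y - \<phi> y"] i1 i2 by simp
    also have "\<dots> \<le> (\<integral>y. \<epsilon> / 2 \<partial>\<nu>)" using i1 i2 \<phi>(3) by (intro integral_mono) auto
    finally have c: "\<bar>s2 - (\<integral>y. \<phi> y \<partial>\<nu>)\<bar> \<le> \<epsilon> / 2" by (simp add: nu.prob_space)
    have "\<bar>cond_var g x - s2 - (u x - markov_op u x)\<bar> \<le> \<epsilon>" for x
      using c \<phi>(3)[rule_format, of x] unfolding u(2)[symmetric] by linarith
    then show "\<exists>u C. continuous_on UNIV u \<and> (\<forall>x. norm (u x) \<le> C) \<and>
        (\<forall>x. \<bar>cond_var g x - s2 - (u x - markov_op u x)\<bar> \<le> \<epsilon>)"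
      using u(1) K(2) by blast
  qed
  have close: "\<bar>(birkhoff_sum f h n x \<omega> - real n * m) - mart g n x \<omega>\<bar> \<le> 2 * G" for n x \<omega>
  proof -
    have "birkhoff_sum f h n x \<omega> - real n * m = (\<Sum>k<n. h (rds_iter f \<omega> k x) - m)"
      by (simp add: birkhoff_sum_def sum_subtractf)
    then have "(birkhoff_sum f h n x \<omega> - real n * m) - mart g n x \<omega> = g x - g (rds_iter f \<omega> n x)"
      by (simp add: mart_telescope gh)
    then show ?thesis using G(2)[of x] G(2)[of "rds_iter f \<omega> n x"] by simp
  qed
  have var: "normalized_variance f \<mu> \<nu> h \<longlonglongrightarrow> s2"
  proof -
    have "sets \<nu> = sets borel" using st by (simp add: stationary_def)
    then have "(\<lambda>z. birkhoff_sum f h n (snd z) (fst z)) \<in> borel_measurable (\<Omega> \<Otimes>\<^sub>M \<nu>)" for n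
      by (rule measurable_joint[OF _ birkhoff_sum_measurable[OF hc] birkhoff_sum_continuous[OF hc]])
    then have "(\<lambda>z. birkhoff_sum f h n (snd z) (fst z) - real n * m) \<in> borel_measurable (\<Omega> \<Otimes>\<^sub>M \<nu>)" for n
      by (intro borel_measurable_diff borel_measurable_const)
    from variance_tendsto[OF st, of "\<lambda>n x \<omega>. birkhoff_sum f h n x \<omega> - real n * m", OF this close]
    show ?thesis unfolding s2_def normalized_variance_def[abs_def] m_def .
  qed
  then have asym: "asymptotic_variance f \<mu> \<nu> h = s2"
    unfolding asymptotic_variance_def by (rule limI)
  have slln: "AE \<omega> in \<Omega>. (\<lambda>n. 1 / real n * birkhoff_sum f h n x \<omega>) \<longlonglongrightarrow> m" for x
    using mart_sublinear[of x]
  proof eventually_elim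
    case (elim \<omega>)
    have "(\<lambda>n. ((birkhoff_sum f h n x \<omega> - real n * m) - mart g n x \<omega>) / real n) \<longlonglongrightarrow> 0"
    proof (rule Lim_null_comparison)
      show "\<forall>\<^sub>F n in sequentially. norm (((birkhoff_sum f h n x \<omega> - real n * m) - mart g n x \<omega>) / real n) \<le> 2 * G * (1 / real n)"
        using close by (intro always_eventually allI) (simp add: divide_right_mono)
      show "(\<lambda>n. 2 * G * (1 / real n)) \<longlonglongrightarrow> 0" using tendsto_mult_left[OF lim_1_over_n, of "2 * G"] by simp
    qed
    from tendsto_add[OF tendsto_add[OF this elim] tendsto_const[of m]]
    have "(\<lambda>n. ((birkhoff_sum f h n x \<omega> - real n * m) - mart g n x \<omega>) / real n + mart g n x \<omega> / real n + m) \<longlonglongrightarrow> 0 + 0 + m" .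
    then have "(\<lambda>n. ((birkhoff_sum f h n x \<omega> - real n * m) - mart g n x \<omega>) / real n + mart g n x \<omega> / real n + m) \<longlonglongrightarrow> m" by simp
    then show ?case
    proof (rule Lim_transform_eventually)
      show "\<forall>\<^sub>F n in sequentially. ((birkhoff_sum f h n x \<omega> - real n * m) - mart g n x \<omega>) / real n + mart g n x \<omega> / real n + m
          = 1 / real n * birkhoff_sum f h n x \<omega>"
        using eventually_gt_at_top[of 0] by eventually_elim (simp add: field_simps)
    qed
  qed
  have clt: "weak_conv_m (\<lambda>n. distr \<Omega> borel (\<lambda>\<omega>. 1 / sqrt (real n) * (birkhoff_sum f h n x \<omega> - real n * m)))
      (normal_distribution 0 s2)" for x
    by (rule central_limit[where xs="\<lambda>_. x", OF _ close])
       (intro borel_measurable_diff birkhoff_sum_measurable[OF hc] borel_measurable_const)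
  have lil: "AE \<omega> in \<Omega>. limsup (\<lambda>n. ereal (1 / sqrt (2 * real n * ln (ln (real n))) * (birkhoff_sum f h n x \<omega> - real n * m)))
      = ereal (sqrt s2)" for x
    using law_of_iterated_logarithm[OF close, of x] unfolding lil_scale_def .
  show ?thesis
    unfolding asym m_def[symmetric] using var slln clt lil by (auto simp: convergent_def)
qed

end
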